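(* Let $m>1$, $0\le u_0\in L^1(\mathbb{R}^N)$. Let $J\ge0$ a.e. on $\mathbb{R}^N$ be symmetric with $\|J\|_{L^1(\mathbb{R}^N)}=1$, and suppose $\|J\|_{L^p(\mathbb{R}^N)}\le C_{J,p}<\infty$ for some $p\in(1,\infty]$; put $q=p/(p-1)\in[1,\infty)$. Let $u$ be a very weak solution of $$\partial_tu+(I-J\ast)[u^m]=0,\qquad u(\cdot,0)=u_0 .$$ Then $$\|u(\cdot,t)\|_{L^\infty(\mathbb{R}^N)}\le\begin{cases}2\big(mq\,C(m)^{\frac{m}{m-1}}\big)^{\frac1m}t^{-\frac1{m-1}}&\text{for a.e. }0<t\le t_0,\\[1mm] 2\Big(\dfrac{mC(m)}{m-1}C_{J,p}\Big)^q\|u_0\|_{L^1(\mathbb{R}^N)}&\text{for a.e. }t>t_0,\end{cases}$$ where $C(m):=2^{\frac{m}{m-1}}$ and $$t_0:=(mq)^{\frac{m-1}{m}}\Big(\frac{m}{m-1}C_{J,p}\Big)^{-q(m-1)}C(m)^{1-q(m-1)}\|u_0\|_{L^1(\mathbb{R}^N)}^{-(m-1)}.$$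
   Context: Throughout $N\ge3$. "Symmetric" means $J(-z)=J(z)$. The operator is $-\mathcal{L}^J[\psi]:=\psi-J\ast\psi$, which maps $L^r(\mathbb{R}^N)$ to $L^r(\mathbb{R}^N)$ for every $r\in[1,\infty]$. Very weak solution on $Q_T:=\mathbb{R}^N\times(0,T)$: a nonnegative measurable $u$ such that (i) $u\in L^1(Q_T)\cap C([0,T];L^1_{\rm loc}(\mathbb{R}^N))$ and $u^m\in L^1(Q_T)$; (ii) for a.e. $0<\tau_1\le\tau_2\le T$ and all $\psi\in C_{\rm c}^\infty(\mathbb{R}^N\times[\tau_1,\tau_2])$, $$\int_{\tau_1}^{\tau_2}\!\!\int_{\mathbb{R}^N}\big(u\,\partial_t\psi-(-\mathcal{L}^J)[u^m]\psi\big)dx\,dt=\int_{\mathbb{R}^N}u(x,\tau_2)\psi(x,\tau_2)dx-\int_{\mathbb{R}^N}u(x,\tau_1)\psi(x,\tau_1)dx;$$ (iii) $u(\cdot,0)=u_0$ a.e. in $\mathbb{R}^N$. Here $u$ is a very weak solution for every $T>0$. *)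

theory Defs
  imports "HOL-Analysis.Analysis" "HOL-Probability.Essential_Supremum"
begin

text \<open>
  Throughout, functions are representatives of classes modulo null sets, and ``measurable'' means
  Lebesgue measurable. A function \<open>u x t\<close> of space and time is curried.
\<close>

subsection \<open>Norms and exponents\<close>

text \<open>The extended-valued norm of \<open>L\<^sup>p\<close> for \<open>1 \<le> p \<le> \<infinity>\<close>; only meant for measurable \<open>f\<close>.\<close>

definition Lp_norm :: "ereal \<Rightarrow> 'a measure \<Rightarrow> ('a \<Rightarrow> real) \<Rightarrow> ennreal" where
  "Lp_norm p M f =
     (if p = \<infinity> then esssup M (\<lambda>x. ennreal \<bar>f x\<bar>)
      else let r = real_of_ereal p; I = (\<integral>\<^sup>+ x. ennreal (\<bar>f x\<bar> powr r) \<partial>M)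
           in if I = \<infinity> then \<infinity> else ennreal (enn2real I powr (1 / r)))"

definition conj_exponent :: "ereal \<Rightarrow> real" where
  "conj_exponent p = (if p = \<infinity> then 1 else real_of_ereal p / (real_of_ereal p - 1))"

subsection \<open>The nonlocal operator\<close>

definition convolve :: "('a::euclidean_space \<Rightarrow> real) \<Rightarrow> ('a \<Rightarrow> real) \<Rightarrow> 'a \<Rightarrow> real" where
  "convolve J f x = (LINT y|lebesgue. J (x - y) * f y)"

text \<open>This is the operator written \<open>-L\<^sup>J = I - J*\<close>, sign included.\<close>

definition neg_L :: "('a::euclidean_space \<Rightarrow> real) \<Rightarrow> ('a \<Rightarrow> real) \<Rightarrow> 'a \<Rightarrow> real" where
  "neg_L J f x = f x - convolve J f x"

subsection \<open>Test functions\<close>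

primrec C_k :: "nat \<Rightarrow> ('a::real_normed_vector \<Rightarrow> real) \<Rightarrow> bool" where
  "C_k 0 f \<longleftrightarrow> continuous_on UNIV f"
| "C_k (Suc k) f \<longleftrightarrow> (\<forall>x. f differentiable at x) \<and> (\<forall>v. C_k k (\<lambda>x. frechet_derivative f (at x) v))"

definition C_infinity :: "('a::real_normed_vector \<Rightarrow> real) \<Rightarrow> bool" where
  "C_infinity f \<longleftrightarrow> (\<forall>k. C_k k f)"

text \<open>
  A function in \<open>C\<^sub>c\<^sup>\<infinity>\<close> of the closed slab \<open>\<real>\<^sup>N \<times> [\<tau>\<^sub>1, \<tau>\<^sub>2]\<close> need not vanish at times \<open>\<tau>\<^sub>1\<close> and \<open>\<tau>\<^sub>2\<close>.
  Smoothness up to the boundary of the slab means being the restriction of a smooth function on the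
  whole space; a test function is therefore given by such a function \<open>\<psi>\<close>, with compact support,
  of which only the values on the slab are ever used.
\<close>

definition test_function :: "('a::euclidean_space \<times> real \<Rightarrow> real) \<Rightarrow> bool" where
  "test_function \<psi> \<longleftrightarrow> C_infinity \<psi> \<and> compact (closure {z. \<psi> z \<noteq> 0})"

subsection \<open>Very weak solutions\<close>

definition cylinder :: "real \<Rightarrow> ('a \<times> real) set" where
  "cylinder T = UNIV \<times> {0<..<T}"

definition continuous_into_L1_loc :: "real \<Rightarrow> ('a::euclidean_space \<Rightarrow> real \<Rightarrow> real) \<Rightarrow> bool" where
  "continuous_into_L1_loc T u \<longleftrightarrow>
     (\<forall>K. compact K \<longrightarrow>
       (\<forall>t\<in>{0..T}. set_integrable lebesgue K (\<lambda>x. u x t) \<and>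
          ((\<lambda>s. LINT x:K|lebesgue. \<bar>u x s - u x t\<bar>) \<longlongrightarrow> 0) (at t within {0..T})))"

text \<open>
  The null set of excluded pairs \<open>\<tau> = (\<tau>\<^sub>1, \<tau>\<^sub>2)\<close> is chosen before the test function.
\<close>

definition very_weak_solution ::
  "('a::euclidean_space \<Rightarrow> real) \<Rightarrow> real \<Rightarrow> ('a \<Rightarrow> real) \<Rightarrow> real \<Rightarrow> ('a \<Rightarrow> real \<Rightarrow> real) \<Rightarrow> bool" where
  "very_weak_solution J m u0 T u \<longleftrightarrow>
     set_borel_measurable lebesgue (cylinder T) (\<lambda>(x, t). u x t) \<and>
     (AE (x, t) in lebesgue. (x, t) \<in> cylinder T \<longrightarrow> 0 \<le> u x t) \<and>
     set_integrable lebesgue (cylinder T) (\<lambda>(x, t). u x t) \<and>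
     continuous_into_L1_loc T u \<and>
     set_integrable lebesgue (cylinder T) (\<lambda>(x, t). u x t powr m) \<and>
     (AE (\<tau>\<^sub>1, \<tau>\<^sub>2) in lebesgue. 0 < \<tau>\<^sub>1 \<and> \<tau>\<^sub>1 \<le> \<tau>\<^sub>2 \<and> \<tau>\<^sub>2 \<le> T \<longrightarrow>
        (\<forall>\<psi>. test_function \<psi> \<longrightarrow>
           (LINT t:{\<tau>\<^sub>1..\<tau>\<^sub>2}|lebesgue. LINT x|lebesgue.
              u x t * deriv (\<lambda>s. \<psi> (x, s)) t - neg_L J (\<lambda>y. u y t powr m) x * \<psi> (x, t))
           = (LINT x|lebesgue. u x \<tau>\<^sub>2 * \<psi> (x, \<tau>\<^sub>2)) - (LINT x|lebesgue. u x \<tau>\<^sub>1 * \<psi> (x, \<tau>\<^sub>1)))) \<and>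
     (AE x in lebesgue. u x 0 = u0 x)"

subsection \<open>Constants of the estimate\<close>

definition C_m :: "real \<Rightarrow> real" where
  "C_m m = 2 powr (m / (m - 1))"

text \<open>
  \<open>M\<close> is the \<open>L\<^sup>1\<close> norm of the initial datum. It enters with the negative exponent \<open>-(m - 1)\<close>, so the
  critical time is infinite for \<open>M = 0\<close>; HOL's \<open>0 powr a = 0\<close> would give \<open>0\<close> instead.
\<close>

definition critical_time :: "real \<Rightarrow> real \<Rightarrow> real \<Rightarrow> real \<Rightarrow> ereal" where
  "critical_time m q C\<^sub>J M =
     (if M = 0 then \<infinity>
      else ereal ((m * q) powr ((m - 1) / m) * (m / (m - 1) * C\<^sub>J) powr (- (q * (m - 1)))
                  * C_m m powr (1 - q * (m - 1)) * M powr (- (m - 1))))"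

end

theory Submission
  imports Defs
begin

text \<open>
  For almost every \<open>x\<close> the equation is an ordinary differential equation in time,
  \<open>\<partial>\<^sub>t u = J * u\<^sup>m - u\<^sup>m\<close>. The estimate comes from a lower bound on \<open>\<partial>\<^sub>t u\<close>, which turns it into an
  inequality at a fixed time.

  Testing with bumps in space times a function of time that is one on \<open>[0, T]\<close> shows that a very weak
  solution satisfies the integrated equation: for every \<open>t > 0\<close> and almost every \<open>x\<close>, \<open>u(x,t)\<close> is
  \<open>u\<^sub>0(x)\<close> plus the integral of \<open>J * u\<^sup>m - u\<^sup>m\<close> over \<open>(0, t)\<close> (lemma \<open>AE_eq_trajectory\<close>). In
  particular mass is conserved. Since \<open>J\<close> is nonnegative with integral one, such solutions obey a
  comparison principle (\<open>mild_solution_comparison\<close>). For \<open>\<lambda> > 1\<close> the function \<open>\<lambda> u(x, \<lambda>\<^bsup>m-1\<^esup> t)\<close> is a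
  solution with datum \<open>\<lambda> u\<^sub>0 \<ge> u\<^sub>0\<close>, so it lies above \<open>u\<close>. Hence \<open>t\<^bsup>1/(m-1)\<^esup> u(x,t)\<close> is nondecreasing in
  \<open>t\<close>, the monotonicity of Benilan and Crandall; it says \<open>\<partial>\<^sub>t u \<ge> - u/((m-1)t)\<close>, and with the equation
  it gives, for almost every \<open>(x,t)\<close>,
  \<open>u\<^sup>m \<le> J * u\<^sup>m + u/((m-1)t)\<close> (\<open>differential_inequality\<close>).

  Now fix \<open>t\<close>. Splitting \<open>J\<close> into a bounded part and a part of small \<open>L\<^sup>1\<close> norm, the inequality first
  shows that \<open>u(\<cdot>,t)\<close> is bounded (\<open>AE_bounded_of_inequality\<close>). Let \<open>K\<close> be its essential supremum and
  \<open>M\<close> the mass. By Hoelder's inequality and interpolation,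
  \<open>J * u\<^sup>m \<le> C \<parallel>u\<^sup>m\<parallel>\<^sub>q \<le> C M\<^bsup>1/q\<^esup> K\<^bsup>m-1/q\<^esup>\<close>, so that
  \<open>K\<^sup>m \<le> C M\<^bsup>1/q\<^esup> K\<^bsup>m-1/q\<^esup> + K/((m-1)t)\<close>. One of the two terms is at least half of \<open>K\<^sup>m\<close>, that is,
  \<open>K \<le> max ((2C)\<^sup>q M) ((2/((m-1)t))\<^bsup>1/(m-1)\<^esup>)\<close> (\<open>AE_le_max_of_inequality\<close>). Each of these two numbers
  is bounded by the corresponding branch of the estimate, and the branches meet at the
  critical time (\<open>max_bound_le\<close>).
\<close>

section \<open>Smooth test functions\<close>

text \<open>
  Closure of \<open>C\<^sup>k\<close> under products, under composition with affine maps and under antiderivatives, which is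
  all that is needed to assemble test functions from one-dimensional bumps.
\<close>

lemma C_k_continuous: "C_k k f \<Longrightarrow> continuous_on UNIV f"
  by (cases k) (auto simp only: C_k.simps intro!: continuous_at_imp_continuous_on differentiable_imp_continuous_within)

lemma C_k_Suc_D: "C_k (Suc k) f \<Longrightarrow> C_k k f"
proof (induction k arbitrary: f)
  case 0
  show ?case using C_k_continuous[OF 0] by simp
next
  case (Suc k)
  from Suc.prems have *: "f differentiable at x" "C_k (Suc k) (\<lambda>x. frechet_derivative f (at x) v)" for x v
    unfolding C_k.simps(2)[of "Suc k" f] by blast+
  with Suc.IH have "C_k k (\<lambda>x. frechet_derivative f (at x) v)" for v by blast
  with * show ?case by simp
qed

lemma C_k_const: "C_k k (\<lambda>_. c)"
  by (induction k arbitrary: c) simp_all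

lemma C_k_add: "C_k k f \<Longrightarrow> C_k k g \<Longrightarrow> C_k k (\<lambda>x. f x + g x)"
proof (induction k arbitrary: f g)
  case 0
  then show ?case by (auto intro: continuous_intros)
next
  case (Suc k)
  have *: "((\<lambda>x. f x + g x) has_derivative
      (\<lambda>v. frechet_derivative f (at x) v + frechet_derivative g (at x) v)) (at x)" for x
    using Suc.prems by (intro has_derivative_add) (auto simp flip: frechet_derivative_works)
  have "frechet_derivative (\<lambda>x. f x + g x) (at x) v
      = frechet_derivative f (at x) v + frechet_derivative g (at x) v" for x v
    using frechet_derivative_at[OF *, of x] by metis
  with Suc differentiableI[OF *] show ?case by auto
qed

lemma C_k_mult: "C_k k f \<Longrightarrow> C_k k g \<Longrightarrow> C_k k (\<lambda>x. f x * g x)"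
proof (induction k arbitrary: f g)
  case 0
  then show ?case by (auto intro: continuous_intros)
next
  case (Suc k)
  have *: "((\<lambda>x. f x * g x) has_derivative
      (\<lambda>v. f x * frechet_derivative g (at x) v + frechet_derivative f (at x) v * g x)) (at x)" for x
    using Suc.prems by (intro has_derivative_mult) (auto simp flip: frechet_derivative_works)
  have "frechet_derivative (\<lambda>x. f x * g x) (at x) v
      = f x * frechet_derivative g (at x) v + frechet_derivative f (at x) v * g x" for x v
    using frechet_derivative_at[OF *, of x] by metis
  moreover have "C_k k (\<lambda>x. f x * frechet_derivative g (at x) v + frechet_derivative f (at x) v * g x)" for v
    using Suc.prems by (intro C_k_add Suc.IH) (auto intro: C_k_Suc_D simp del: C_k.simps simp: C_k.simps(2)[of k f] C_k.simps(2)[of k g])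
  ultimately show ?case using differentiableI[OF *] by auto
qed

lemma C_k_compose_affine:
  fixes f :: "'b::real_normed_vector \<Rightarrow> real" and L :: "'a::real_normed_vector \<Rightarrow> 'b"
  assumes L: "bounded_linear L"
  shows "C_k k f \<Longrightarrow> C_k k (\<lambda>z. f (c + L z))"
proof (induction k arbitrary: f)
  case 0
  then show ?case
    by (auto intro!: continuous_on_compose2[of UNIV f] continuous_intros
        linear_continuous_on[OF L])
next
  case (Suc k)
  have *: "((\<lambda>z. f (c + L z)) has_derivative (\<lambda>v. frechet_derivative f (at (c + L z)) (L v))) (at z)" for z
  proof -
    have "((\<lambda>z. c + L z) has_derivative L) (at z)"
      using has_derivative_add[OF has_derivative_const bounded_linear_imp_has_derivative[OF L]] by simp
    moreover have "(f has_derivative frechet_derivative f (at (c + L z))) (at (c + L z))"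
      using Suc.prems by (simp flip: frechet_derivative_works)
    ultimately show ?thesis using has_derivative_compose by blast
  qed
  have "frechet_derivative (\<lambda>z. f (c + L z)) (at z) v = frechet_derivative f (at (c + L z)) (L v)" for z v
    using frechet_derivative_at[OF *, of z] by metis
  moreover have "C_k k (\<lambda>z. frechet_derivative f (at (c + L z)) (L v))" for v
    using Suc.prems by (intro Suc.IH[of "\<lambda>y. frechet_derivative f (at y) (L v)"]) simp
  ultimately show ?case using differentiableI[OF *] by auto
qed

lemma C_k_of_real_derivative:
  fixes F f :: "real \<Rightarrow> real"
  assumes F: "\<And>x. (F has_real_derivative f x) (at x)" and f: "C_k k f"
  shows "C_k (Suc k) F"
proof -
  have *: "(F has_derivative (\<lambda>v. v * f x)) (at x)" for x
    using F[of x] by (simp add: has_field_derivative_def mult.commute[of _ "f x"] mult_commute_abs)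
  have "frechet_derivative F (at x) v = v * f x" for x v
    using frechet_derivative_at[OF *, of x] by metis
  then show ?thesis
    using * f by (auto simp: differentiable_def intro!: C_k_mult C_k_const)
qed

lemma C_infinity_mult: "C_infinity f \<Longrightarrow> C_infinity g \<Longrightarrow> C_infinity (\<lambda>x. f x * g x)"
  by (simp add: C_infinity_def C_k_mult)

lemma C_infinity_prod:
  assumes "finite I" "\<And>i. i \<in> I \<Longrightarrow> C_infinity (f i)"
  shows "C_infinity (\<lambda>x. \<Prod>i\<in>I. f i x)"
  using assms
proof (induction I)
  case empty
  show ?case by (simp add: C_infinity_def C_k_const)
next
  case (insert i I)
  then show ?case by (simp add: C_infinity_mult)
qed

lemma C_infinity_compose_affine:
  "bounded_linear L \<Longrightarrow> C_infinity f \<Longrightarrow> C_infinity (\<lambda>z. f (c + L z))"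
  by (simp add: C_infinity_def C_k_compose_affine)

lemma C_infinity_of_real_derivative:
  assumes "\<And>x. (F has_real_derivative f x) (at x)" and "C_infinity f"
  shows "C_infinity F"
  using C_k_of_real_derivative[OF assms(1)] assms(2) C_k_Suc_D unfolding C_infinity_def by blast

text \<open>
  The functions \<open>P(1/x) e\<^bsup>-1/x\<^esup>\<close> on the positive half-line, extended by zero. For polynomial \<open>P\<close> they
  form a class closed under differentiation, so all of them are smooth.
\<close>

definition flat_fun :: "real poly \<Rightarrow> real \<Rightarrow> real" where
  "flat_fun P x = (if x \<le> 0 then 0 else poly P (inverse x) * exp (- inverse x))"

lemma poly_times_exp_tendsto_0:
  "((\<lambda>y::real. poly P y * exp (- y)) \<longlongrightarrow> 0) at_top"
proof -
  have "((\<lambda>y::real. \<Sum>i\<le>degree P. coeff P i * (y ^ i / exp y)) \<longlongrightarrow> (\<Sum>i\<le>degree P. coeff P i * 0)) at_top"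
    by (intro tendsto_sum tendsto_mult tendsto_const tendsto_power_div_exp_0)
  then show ?thesis
    by (simp add: poly_altdef sum_distrib_right exp_minus divide_inverse mult.assoc)
qed

lemma flat_fun_has_derivative:
  "(flat_fun P has_real_derivative flat_fun ([:0, 0, 1:] * (P - pderiv P)) x) (at x)"
proof -
  consider "x < 0" | "x = 0" | "x > 0" by linarith
  then show ?thesis
  proof cases
    case 1
    have "((\<lambda>_. 0) has_real_derivative 0) (at x)" by simp
    then have "(flat_fun P has_real_derivative 0) (at x)"
      by (rule DERIV_cong_ev[THEN iffD1, OF refl _ refl, rotated])
         (use eventually_nhds_in_open[of "{..<0}" x] 1 in \<open>auto simp: flat_fun_def elim!: eventually_mono\<close>)
    then show ?thesis using 1 by (simp add: flat_fun_def)
  next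
    case 2
    have R: "((\<lambda>h. flat_fun P h / h) \<longlongrightarrow> 0) (at_right 0)"
    proof -
      have "((\<lambda>h. poly (pCons 0 P) (inverse h) * exp (- inverse h)) \<longlongrightarrow> 0) (at_right (0::real))"
        by (rule filterlim_compose[OF poly_times_exp_tendsto_0 filterlim_inverse_at_top_right])
      moreover have "\<forall>\<^sub>F h in at_right 0. poly (pCons 0 P) (inverse h) * exp (- inverse h) = flat_fun P h / h"
        by (auto simp: eventually_at_filter flat_fun_def field_simps)
      ultimately show ?thesis by (rule Lim_transform_eventually)
    qed
    have L: "((\<lambda>h. flat_fun P h / h) \<longlongrightarrow> 0) (at_left 0)"
      by (rule Lim_transform_eventually[OF tendsto_const]) (auto simp: eventually_at_filter flat_fun_def)
    have "((\<lambda>h. flat_fun P h / h) \<longlongrightarrow> 0) (at 0)"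
      using L R filterlim_at_split by blast
    then have "(flat_fun P has_real_derivative 0) (at 0)"
      by (simp add: DERIV_def flat_fun_def)
    then show ?thesis using 2 by (simp add: flat_fun_def)
  next
    case 3
    have "((\<lambda>x. poly P (inverse x) * exp (- inverse x)) has_real_derivative
        poly ([:0, 0, 1:] * (P - pderiv P)) (inverse x) * exp (- inverse x)) (at x)"
      using 3 by (auto intro!: derivative_eq_intros poly_DERIV[THEN DERIV_chain2]
          simp: field_simps power2_eq_square)
    then have "(flat_fun P has_real_derivative
        poly ([:0, 0, 1:] * (P - pderiv P)) (inverse x) * exp (- inverse x)) (at x)"
      by (rule DERIV_cong_ev[THEN iffD1, OF refl _ refl, rotated])
         (use eventually_nhds_in_open[of "{0<..}" x] 3 in \<open>auto simp: flat_fun_def elim!: eventually_mono\<close>)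
    then show ?thesis using 3 by (simp add: flat_fun_def)
  qed
qed

lemma C_infinity_flat_fun: "C_infinity (flat_fun P)"
proof -
  have "C_k k (flat_fun P)" for k
  proof (induction k arbitrary: P)
    case 0
    show ?case
      using DERIV_isCont[OF flat_fun_has_derivative] by (auto intro!: continuous_at_imp_continuous_on)
  next
    case (Suc k)
    then show ?case using C_k_of_real_derivative[OF flat_fun_has_derivative] by blast
  qed
  then show ?thesis by (simp add: C_infinity_def)
qed

text \<open>The bump \<open>e\<^bsup>-1/(n(x-a))\<^esup> e\<^bsup>-1/(n(b-x))\<^esup>\<close> on \<open>(a, b)\<close>, zero elsewhere; it tends to the indicator of \<open>(a, b)\<close> as \<open>n \<rightarrow> \<infinity>\<close>.\<close>

definition bump :: "real \<Rightarrow> real \<Rightarrow> real \<Rightarrow> real \<Rightarrow> real" where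
  "bump n a b x = flat_fun 1 (n * (x - a)) * flat_fun 1 (n * (b - x))"

lemma flat_fun_1_bounds: "0 \<le> flat_fun 1 x" "flat_fun 1 x \<le> 1"
  by (auto simp: flat_fun_def)

lemma bump_bounds: "0 \<le> bump n a b x" "bump n a b x \<le> 1"
  by (auto simp: bump_def flat_fun_1_bounds mult_le_one)

lemma bump_support: "0 < n \<Longrightarrow> x \<notin> {a<..<b} \<Longrightarrow> bump n a b x = 0"
  by (auto simp: bump_def flat_fun_def mult_le_0_iff)

lemma C_infinity_bump: "C_infinity (bump n a b)"
proof -
  have "C_infinity (\<lambda>x. flat_fun 1 (- (n * a) + n * x) * flat_fun 1 (n * b + (- n) * x))"
    by (intro C_infinity_mult C_infinity_compose_affine bounded_linear_mult_right C_infinity_flat_fun)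
  then show ?thesis by (simp add: bump_def[abs_def] algebra_simps)
qed

lemma bump_tendsto: "(\<lambda>n. bump (real (Suc n)) a b x) \<longlonglongrightarrow> indicator {a<..<b} x"
proof (cases "x \<in> {a<..<b}")
  case True
  have *: "(\<lambda>n. flat_fun 1 (real (Suc n) * c)) \<longlonglongrightarrow> 1" if "c > 0" for c
  proof -
    have "(\<lambda>n. exp (- inverse c * inverse (real (Suc n)))) \<longlonglongrightarrow> exp (- inverse c * 0)"
      by (intro tendsto_intros LIMSEQ_inverse_real_of_nat)
    moreover have "flat_fun 1 (real (Suc n) * c) = exp (- inverse c * inverse (real (Suc n)))" for n
      using that by (simp add: flat_fun_def mult_le_0_iff not_le)
    ultimately show ?thesis by simp
  qed
  have "(\<lambda>n. bump (real (Suc n)) a b x) \<longlonglongrightarrow> 1 * 1"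
    unfolding bump_def by (intro tendsto_mult *) (use True in auto)
  then show ?thesis using True by simp
next
  case False
  then show ?thesis by (simp add: bump_support del: of_nat_Suc)
qed

lemma bump_continuous: "continuous_on UNIV (bump n a b)"
  using C_infinity_bump C_k_continuous unfolding C_infinity_def by blast

text \<open>A product of two normalised antiderivatives of bumps, one of them reflected, rises from \<open>0\<close> to \<open>1\<close>,
  stays there, and returns to \<open>0\<close>.\<close>

lemma smooth_cutoff_exists:
  fixes T :: real
  assumes "0 \<le> T"
  obtains \<eta> where "C_infinity \<eta>" "\<And>s. s \<in> {-1..T + 1} \<Longrightarrow> \<eta> s = 1" "\<And>s. s \<notin> {-2..T + 2} \<Longrightarrow> \<eta> s = 0"
proof -
  define f where "f = bump 1 0 1"
  have cont: "continuous_on A f" for A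
    unfolding f_def using bump_continuous continuous_on_subset by blast
  have int: "f integrable_on {a..b}" for a b
    by (intro integrable_continuous_real cont)
  have f0: "f x = 0" if "x \<notin> {0<..<1}" for x using that by (simp add: f_def bump_support)
  (* the lower limit -1 lies outside the support of f, so that G is differentiable at 0 as well *)
  define G where "G x = integral {-1..x} f" for x
  have G0: "G x = 0" if "x \<le> 0" for x
    unfolding G_def using that by (subst Henstock_Kurzweil_Integration.integral_cong[where g="\<lambda>_. 0"]) (auto simp: f0)
  have Gder: "(G has_real_derivative f x) (at x)" for x
  proof (cases "x > -1")
    case True
    have "(G has_real_derivative f x) (at x within {-1..x+1})"
      unfolding G_def by (rule integral_has_real_derivative[OF cont]) (use True in auto)
    moreover have "at x within {-1..x+1} = at x"
      using True by (intro at_within_interior) (simp add: interior_atLeastAtMost_real)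
    ultimately show ?thesis by simp
  next
    case False
    have "((\<lambda>_. 0) has_real_derivative 0) (at x)" by simp
    then have "(G has_real_derivative 0) (at x)"
      by (rule DERIV_cong_ev[THEN iffD1, OF refl _ refl, rotated])
         (use eventually_nhds_in_open[of "{..<0}" x] False in \<open>auto simp: G0 elim!: eventually_mono\<close>)
    then show ?thesis using False by (simp add: f0)
  qed
  have Gc: "G x = G 1" if "x \<ge> 1" for x
  proof -
    have "G x = G 1 + integral {1..x} f"
      unfolding G_def using that by (intro Henstock_Kurzweil_Integration.integral_combine[symmetric] int) auto
    also have "integral {1..x} f = 0" using that by (subst Henstock_Kurzweil_Integration.integral_cong[where g="\<lambda>_. 0"]) (auto simp: f0)
    finally show ?thesis by simp
  qed
  have "G 1 \<noteq> 0"
  proof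
    assume "G 1 = 0"
    have "continuous_on {-1..1} f" by (rule cont)
    moreover have "f x \<ge> 0" for x by (simp add: f_def bump_bounds)
    ultimately have "\<forall>x\<in>{-1..1}. f x = 0"
      using integral_eq_0_iff[of "-1" 1 f] \<open>G 1 = 0\<close> by (simp add: G_def)
    then have "f (1/2) = 0" by auto
    then show False by (simp add: f_def bump_def flat_fun_def)
  qed
  define \<eta> where "\<eta> s = (G (2 + 1 * s) * G ((T + 2) + (- 1) * s)) * (1 / (G 1 * G 1))" for s
  have G: "C_infinity G" using C_infinity_of_real_derivative[OF Gder] by (simp add: f_def C_infinity_bump)
  have "C_infinity (\<lambda>s. G (c + k * s))" for c k
    by (rule C_infinity_compose_affine[OF bounded_linear_mult_right G])
  moreover have "C_infinity (\<lambda>s::real. 1 / (G 1 * G 1))"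
    by (simp add: C_infinity_def C_k_const)
  ultimately have "C_infinity \<eta>"
    unfolding \<eta>_def[abs_def] by (intro C_infinity_mult)
  moreover have "\<eta> s = 1" if "s \<in> {-1..T + 1}" for s
    using that Gc[of "2 + s"] Gc[of "T + 2 - s"] \<open>G 1 \<noteq> 0\<close> by (simp add: \<eta>_def)
  moreover have "\<eta> s = 0" if "s \<notin> {-2..T + 2}" for s
    using that G0[of "2 + s"] G0[of "T + 2 - s"] by (auto simp: \<eta>_def)
  ultimately show ?thesis using that by blast
qed

text \<open>Product of one-dimensional bumps, an approximation of the indicator of a box.\<close>

definition box_bump :: "real \<Rightarrow> 'a::euclidean_space \<Rightarrow> 'a \<Rightarrow> 'a \<Rightarrow> real" where
  "box_bump n a b x = (\<Prod>i\<in>Basis. bump n (a \<bullet> i) (b \<bullet> i) (x \<bullet> i))"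

lemma box_bump_bounds: "0 \<le> box_bump n a b x" "box_bump n a b x \<le> 1"
  unfolding box_bump_def by (auto intro!: prod_nonneg prod_le_1 simp: bump_bounds)

lemma box_bump_support: "0 < n \<Longrightarrow> x \<notin> box a b \<Longrightarrow> box_bump n a b x = 0"
  by (force simp: box_bump_def mem_box bump_support prod_zero_iff)

lemma box_bump_tendsto: "(\<lambda>n. box_bump (real (Suc n)) a b x) \<longlonglongrightarrow> indicator (box a b) x"
proof -
  have "(\<lambda>n. box_bump (real (Suc n)) a b x) \<longlonglongrightarrow> (\<Prod>i\<in>Basis. indicator {a \<bullet> i<..<b \<bullet> i} (x \<bullet> i))"
    unfolding box_bump_def by (intro tendsto_prod bump_tendsto)
  also have "(\<Prod>i\<in>Basis. indicator {a \<bullet> i<..<b \<bullet> i} (x \<bullet> i)) = (indicator (box a b) x :: real)"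
    by (auto simp: indicator_def mem_box prod_zero_iff)
  finally show ?thesis .
qed

lemma C_infinity_box_bump: "C_infinity (box_bump n a b)"
proof -
  have "C_infinity (\<lambda>x. \<Prod>i\<in>Basis. bump n (a \<bullet> i) (b \<bullet> i) (0 + x \<bullet> i))"
    by (intro C_infinity_prod C_infinity_compose_affine bounded_linear_inner_left C_infinity_bump) auto
  then show ?thesis by (simp add: box_bump_def[abs_def])
qed

lemma box_bump_continuous: "continuous_on UNIV (box_bump n a b)"
  using C_infinity_box_bump C_k_continuous unfolding C_infinity_def by blast

lemma test_function_box_bump_cutoff:
  fixes a b :: "'a::euclidean_space"
  assumes \<eta>: "C_infinity \<eta>" "\<And>s. s \<notin> {c..d} \<Longrightarrow> \<eta> s = 0" and n: "0 < n"
  shows "test_function (\<lambda>z. box_bump n a b (fst z) * \<eta> (snd z))"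
  unfolding test_function_def
proof
  have "C_infinity (\<lambda>z::'a \<times> real. box_bump n a b (0 + fst z) * \<eta> (0 + snd z))"
    by (intro C_infinity_mult C_infinity_compose_affine bounded_linear_fst bounded_linear_snd
        C_infinity_box_bump \<eta>)
  then show "C_infinity (\<lambda>z::'a \<times> real. box_bump n a b (fst z) * \<eta> (snd z))" by simp
  have "{z. box_bump n a b (fst z) * \<eta> (snd z) \<noteq> 0} \<subseteq> cbox a b \<times> {c..d}"
  proof
    fix z assume "z \<in> {z. box_bump n a b (fst z) * \<eta> (snd z) \<noteq> 0}"
    then have "fst z \<in> box a b" "snd z \<in> {c..d}"
      using box_bump_support[OF n, of "fst z" a b] \<eta>(2)[of "snd z"] by force+
    then show "z \<in> cbox a b \<times> {c..d}"
      using box_subset_cbox[of a b] by (auto simp: mem_Times_iff)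
  qed
  then have "bounded {z. box_bump n a b (fst z) * \<eta> (snd z) \<noteq> 0}"
    by (rule bounded_subset[OF bounded_Times[OF bounded_cbox bounded_closed_interval]])
  then show "compact (closure {z. box_bump n a b (fst z) * \<eta> (snd z) \<noteq> 0})"
    by (simp add: compact_closure)
qed

section \<open>Lebesgue integration on Euclidean spaces\<close>

text \<open>
  Let \<open>P\<close> and \<open>N\<close> be the measures with densities \<open>f\<^sup>+\<close> and \<open>f\<^sup>-\<close>. The covering lemma squeezes a countable
  union of nonoverlapping boxes between a set and an open neighbourhood of it, and \<open>P\<close> is outer
  regular, so \<open>N \<le> P\<close> extends from boxes to Borel sets; on \<open>{f < 0}\<close> the measure \<open>P\<close> vanishes.
\<close>

lemma AE_nonneg_if_box_integrals_nonneg: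
  fixes f :: "'a::euclidean_space \<Rightarrow> real"
  assumes int: "integrable lborel f"
    and nn: "\<And>a b. 0 \<le> (LINT x:box a b|lborel. f x)"
  shows "AE x in lborel. 0 \<le> f x"
proof -
  have f[measurable]: "f \<in> borel_measurable borel" using int by (simp add: integrable_iff_bounded)
  define P where "P = density lborel (\<lambda>x. ennreal (f x))"
  define N where "N = density lborel (\<lambda>x. ennreal (- f x))"
  have sets[measurable_cong]: "sets P = sets borel" "sets N = sets borel" by (simp_all add: P_def N_def)
  have le_box: "emeasure N (box a b) \<le> emeasure P (box a b)" for a b
  proof -
    let ?g = "\<lambda>x. indicator (box a b) x * f x"
    have g: "integrable lborel ?g" using integrable_mult_indicator[OF _ int, of "box a b"] by simp
    have e: "emeasure P (box a b) = (\<integral>\<^sup>+x. ennreal (?g x) \<partial>lborel)"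
      "emeasure N (box a b) = (\<integral>\<^sup>+x. ennreal (- ?g x) \<partial>lborel)"
      unfolding P_def N_def
      by (subst emeasure_density; auto intro!: nn_integral_cong split: split_indicator)+
    have fin: "emeasure P (box a b) \<noteq> \<infinity>" "emeasure N (box a b) \<noteq> \<infinity>"
      using integrableD(2,3)[OF g] unfolding e by simp_all
    have "0 \<le> integral\<^sup>L lborel ?g" using nn[of a b] by (simp add: set_lebesgue_integral_def)
    also have "\<dots> = enn2real (emeasure P (box a b)) - enn2real (emeasure N (box a b))"
      unfolding e by (rule real_lebesgue_integral_def[OF g])
    finally show ?thesis using fin
      by (metis diff_ge_0_iff_ge enn2real_nonneg ennreal_enn2real ennreal_le_iff infinity_ennreal_def less_top)
  qed
  have le_open: "emeasure N A \<le> emeasure P G"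
    if A: "A \<subseteq> cbox a b" "A \<in> sets borel" "A \<subseteq> G" "open G" and ab: "box a b \<noteq> {}" for A G and a b :: 'a
  proof -
    have "gauge (\<lambda>x. if x \<in> A then G else UNIV)" using A by (auto simp: gauge_def)
    from covering_lemma[OF A(1) ab this] obtain D where D: "countable D"
      "\<And>K. K \<in> D \<Longrightarrow> interior K \<noteq> {} \<and> (\<exists>c d. K = cbox c d)"
      "pairwise (\<lambda>A B. interior A \<inter> interior B = {}) D"
      "\<And>K. K \<in> D \<Longrightarrow> \<exists>x\<in>A \<inter> K. K \<subseteq> (if x \<in> A then G else UNIV)"
      "A \<subseteq> \<Union> D" by metis
    have DG: "K \<subseteq> G" if "K \<in> D" for K using D(4)[OF that] by (auto split: if_splits)
    have disj: "disjoint_family_on interior D"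
      using D(3) by (auto simp: disjoint_family_on_def pairwise_def)
    have null: "(\<Union>K\<in>D. K - interior K) \<in> null_sets N"
    proof (intro null_sets_UN' D(1))
      fix K assume "K \<in> D"
      then obtain c d where K: "K = cbox c d" using D(2) by blast
      have "K - interior K \<in> null_sets lborel"
        unfolding K interior_cbox using emeasure_lborel_cbox_eq[of c d] emeasure_lborel_box_eq[of c d]
        by (intro null_setsI) (auto simp: emeasure_Diff box_subset_cbox)
      then show "K - interior K \<in> null_sets N"
        unfolding N_def by (subst null_sets_density_iff)
          (auto dest: AE_not_in null_setsD2 elim!: eventually_mono simp del: Diff_iff)
    qed
    have "emeasure N A \<le> emeasure N ((\<Union>K\<in>D. interior K) \<union> (\<Union>K\<in>D. K - interior K))"
      using D(5) null_setsD2[OF null] by (intro emeasure_mono sets.Un) (auto simp: sets intro!: borel_open)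
    also have "\<dots> = emeasure N (\<Union>K\<in>D. interior K)"
      using D(1) by (intro emeasure_Un_null_set null) (auto simp: sets intro!: borel_open)
    also have "\<dots> = (\<integral>\<^sup>+K. emeasure N (interior K) \<partial>count_space D)"
      using D(1) disj by (intro emeasure_UN_countable) (auto simp: sets)
    also have "\<dots> \<le> (\<integral>\<^sup>+K. emeasure P (interior K) \<partial>count_space D)"
      using D(2) le_box by (intro nn_integral_mono) fastforce
    also have "\<dots> = emeasure P (\<Union>K\<in>D. interior K)"
      using D(1) disj by (intro emeasure_UN_countable[symmetric]) (auto simp: sets)
    also have "\<dots> \<le> emeasure P G"
      using DG interior_subset A by (intro emeasure_mono) (fastforce simp: sets)+
    finally show ?thesis .
  qed
  have finP: "finite_measure P"
    using integrableD(2)[OF int] by (intro finite_measureI) (simp add: P_def emeasure_density)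
  have "AE x in lborel. x \<in> cbox (- (real n *\<^sub>R One)) (real n *\<^sub>R One) \<longrightarrow> 0 \<le> f x" if n: "n > 0" for n :: nat
  proof -
    define C where "C = cbox (- (real n *\<^sub>R One)) (real n *\<^sub>R One :: 'a)"
    define A where "A = {x \<in> C. f x < 0}"
    have "A = cbox (- (real n *\<^sub>R One)) (real n *\<^sub>R One) \<inter> {x \<in> space borel. f x < 0}"
      by (auto simp: A_def C_def)
    also have "\<dots> \<in> sets borel" by measurable
    finally have A[measurable]: "A \<in> sets borel" .
    have ne: "box (- (real n *\<^sub>R One)) (real n *\<^sub>R One :: 'a) \<noteq> {}"
      using n by (auto simp: box_eq_empty)
    have "emeasure N A \<le> emeasure P G" if "A \<subseteq> G" "open G" for G
      using le_open[OF _ A that ne] by (auto simp: A_def C_def)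
    then have "emeasure N A \<le> (INF U\<in>{U. A \<subseteq> U \<and> open U}. emeasure P U)"
      by (intro INF_greatest) auto
    also have "\<dots> = emeasure P A"
      using finP sets A by (intro outer_regular[symmetric]) (auto simp: finite_measure.emeasure_finite)
    also have "\<dots> = 0"
    proof -
      have "emeasure P A = (\<integral>\<^sup>+x. ennreal (f x) * indicator A x \<partial>lborel)"
        unfolding P_def by (rule emeasure_density) auto
      also have "\<dots> = (\<integral>\<^sup>+(x::'a). 0 \<partial>lborel)"
        by (intro nn_integral_cong) (auto simp: A_def ennreal_neg split: split_indicator)
      finally show ?thesis by simp
    qed
    finally have "A \<in> null_sets N" using A sets by (auto intro!: null_setsI)
    then have "AE x in lborel. x \<in> A \<longrightarrow> ennreal (- f x) = 0"
      unfolding N_def by (subst (asm) null_sets_density_iff) auto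
    then show ?thesis
      by eventually_elim (auto simp: A_def C_def ennreal_eq_0_iff)
  qed
  then have "AE x in lborel. \<forall>n::nat. n > 0 \<longrightarrow> x \<in> cbox (- (real n *\<^sub>R One)) (real n *\<^sub>R One) \<longrightarrow> 0 \<le> f x"
    by (subst AE_all_countable) auto
  then show ?thesis
  proof eventually_elim
    case (elim x)
    obtain n :: nat where n: "norm x < real n" using reals_Archimedean2 by blast
    have "x \<in> cbox (- (real n *\<^sub>R One)) (real n *\<^sub>R One)"
      unfolding mem_box using n Basis_le_norm[of _ x] by (fastforce simp: abs_le_iff)
    moreover have "n > 0" using n norm_ge_zero[of x] by (cases n) auto
    ultimately show ?case using elim by blast
  qed
qed

lemma AE_eq_0_if_box_integrals_eq_0:
  fixes f :: "'a::euclidean_space \<Rightarrow> real"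
  assumes int: "integrable lborel f" and 0: "\<And>a b. (LINT x:box a b|lborel. f x) = 0"
  shows "AE x in lborel. f x = 0"
proof -
  have "AE x in lborel. 0 \<le> f x" by (rule AE_nonneg_if_box_integrals_nonneg[OF int]) (simp add: 0)
  moreover have "AE x in lborel. 0 \<le> - f x"
    by (rule AE_nonneg_if_box_integrals_nonneg)
      (use int 0 in \<open>auto simp: set_lebesgue_integral_def\<close>)
  ultimately show ?thesis by eventually_elim simp
qed

text \<open>
  Lebesgue integrals of a function that agrees almost everywhere with a Borel function; the
  integrals with respect to \<open>lborel\<close> are accessible to Fubini's theorem.
\<close>

lemma
  fixes f g :: "'a::euclidean_space \<Rightarrow> real"
  assumes ae: "AE x in lborel. f x = g x" and g[measurable]: "g \<in> borel_measurable borel"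
  shows lebesgue_measurable_if_AE_eq: "f \<in> borel_measurable lebesgue"
    and lebesgue_integral_eq_lborel: "integral\<^sup>L lebesgue f = integral\<^sup>L lborel g"
    and lebesgue_integrable_iff_lborel: "integrable lebesgue f \<longleftrightarrow> integrable lborel g"
proof -
  have g': "g \<in> borel_measurable lebesgue" by (simp add: measurable_completion)
  have ae': "AE x in lebesgue. f x = g x" using ae by (rule AE_completion)
  show f': "f \<in> borel_measurable lebesgue"
  proof (rule measurableI)
    fix S :: "real set" assume S: "S \<in> sets borel"
    have "AE x in lebesgue. x \<in> g -` S \<inter> space lebesgue \<longleftrightarrow> x \<in> f -` S \<inter> space lebesgue"
      using ae' by eventually_elim auto
    then show "f -` S \<inter> space lebesgue \<in> sets lebesgue"
      by (rule completion.in_sets_AE) (use measurable_sets[OF g' S] in auto)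
  qed auto
  have "integral\<^sup>L lebesgue f = integral\<^sup>L lebesgue g"
    by (rule integral_cong_AE[OF f' g' ae'])
  then show "integral\<^sup>L lebesgue f = integral\<^sup>L lborel g"
    by (simp add: integral_completion)
  have "integrable lebesgue f \<longleftrightarrow> integrable lebesgue g"
    by (rule integrable_cong_AE[OF f' g' ae'])
  then show "integrable lebesgue f \<longleftrightarrow> integrable lborel g"
    by (simp add: integrable_completion)
qed

lemma lborel_reflect:
  fixes x :: "'a::euclidean_space"
  shows "distr lborel borel (\<lambda>y. x - y) = lborel"
  using lborel_affine[of "-1" x] by (simp add: density_1)

lemma AE_lborel_reflect:
  fixes x :: "'a::euclidean_space"
  assumes "AE z in lborel. P z"
  shows "AE y in lborel. P (x - y)"
proof (rule AE_distrD[of "\<lambda>y. x - y" lborel borel P])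
  show "AE z in distr lborel borel (\<lambda>y. x - y). P z"
    unfolding lborel_reflect by (rule assms)
qed simp

lemma AE_lborel_prod_fst:
  fixes P :: "'a::euclidean_space \<times> 'b::euclidean_space \<Rightarrow> bool"
  assumes "AE z in lborel. P z"
  shows "AE x in lborel. AE t in lborel. P (x, t)"
  by (rule lborel_pair.AE_pair) (use assms in \<open>simp only: lborel_prod\<close>)

lemma AE_lborel_prod_snd:
  fixes P :: "'a::euclidean_space \<times> 'b::euclidean_space \<Rightarrow> bool"
  assumes "AE z in lborel. P z"
  shows "AE t in lborel. AE x in lborel. P (x, t)"
proof -
  obtain N where N: "N \<in> null_sets lborel" "\<And>z. z \<notin> N \<Longrightarrow> P z"
    using assms by (auto elim!: AE_E3)
  have Ns: "N \<in> sets (lborel \<Otimes>\<^sub>M lborel)" using N(1) by (simp only: lborel_prod null_setsD2)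
  have "AE x in lborel. AE t in lborel. (x, t) \<notin> N"
    using AE_lborel_prod_fst[OF AE_not_in[OF N(1)]] .
  then have "AE t in lborel. AE x in lborel. (x, t) \<notin> N"
    by (subst (asm) lborel_pair.AE_commute) (use sets.compl_sets[OF Ns] in \<open>auto simp: space_pair_measure Collect_neg_eq Compl_eq_Diff_UNIV\<close>)
  then show ?thesis by eventually_elim (auto elim!: eventually_mono intro: N(2))
qed

lemma AE_lborel_prodI:
  fixes P :: "'a::euclidean_space \<times> 'b::euclidean_space \<Rightarrow> bool"
  assumes "Measurable.pred borel P" "AE t in lborel. AE x in lborel. P (x, t)"
  shows "AE z in lborel. P z"
proof -
  have P: "{z \<in> space (lborel \<Otimes>\<^sub>M lborel). P z} \<in> sets (lborel \<Otimes>\<^sub>M lborel)"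
    unfolding lborel_prod using assms(1) by (simp add: pred_def)
  have "AE x in lborel. AE t in lborel. P (x, t)"
    by (subst lborel_pair.AE_commute) (use assms(2) P in auto)
  then show ?thesis using lborel_pair.AE_pair_measure[OF P] unfolding lborel_prod by blast
qed

section \<open>Convolution in the space variable\<close>

text \<open>Convolution of \<open>J\<close> with \<open>f\<close> in space only, at each fixed time.\<close>

definition space_conv :: "('a::euclidean_space \<Rightarrow> real) \<Rightarrow> ('a \<times> real \<Rightarrow> real) \<Rightarrow> 'a \<times> real \<Rightarrow> real" where
  "space_conv J f z = (LINT y|lborel. J (fst z - y) * f (y, snd z))"

lemma nn_integral_lborel_translate:
  fixes F :: "'a::euclidean_space \<Rightarrow> ennreal"
  assumes [measurable]: "F \<in> borel_measurable borel"
  shows "(\<integral>\<^sup>+x. F (x - y) \<partial>lborel) = (\<integral>\<^sup>+x. F x \<partial>lborel)"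
proof -
  have "(\<integral>\<^sup>+x. F x \<partial>lborel) = (\<integral>\<^sup>+x. F x \<partial>distr lborel borel ((+) (- y)))"
    by (simp only: lborel_distr_plus)
  also have "\<dots> = (\<integral>\<^sup>+x. F (x - y) \<partial>lborel)"
    by (subst nn_integral_distr) simp_all
  finally show ?thesis by simp
qed

lemma integral_lborel_translate:
  fixes F :: "'a::euclidean_space \<Rightarrow> real"
  assumes [measurable]: "F \<in> borel_measurable borel"
  shows "(\<integral>x. F (x - y) \<partial>lborel) = (\<integral>x. F x \<partial>lborel)"
proof -
  have "(\<integral>x. F x \<partial>lborel) = (\<integral>x. F x \<partial>distr lborel borel ((+) (- y)))"
    by (simp only: lborel_distr_plus)
  also have "\<dots> = (\<integral>x. F (x - y) \<partial>lborel)"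
    by (subst integral_distr) simp_all
  finally show ?thesis by simp
qed

lemma nn_integral_convolution:
  fixes J g :: "'a::euclidean_space \<Rightarrow> ennreal"
  assumes [measurable]: "J \<in> borel_measurable borel" "g \<in> borel_measurable borel"
  shows "(\<integral>\<^sup>+x. \<integral>\<^sup>+y. J (x - y) * g y \<partial>lborel \<partial>lborel) = (\<integral>\<^sup>+x. J x \<partial>lborel) * (\<integral>\<^sup>+y. g y \<partial>lborel)"
proof -
  have "(\<integral>\<^sup>+x. \<integral>\<^sup>+y. J (x - y) * g y \<partial>lborel \<partial>lborel) = (\<integral>\<^sup>+y. \<integral>\<^sup>+x. J (x - y) * g y \<partial>lborel \<partial>lborel)"
    by (subst lborel_pair.Fubini') simp_all
  also have "\<dots> = (\<integral>\<^sup>+y. (\<integral>\<^sup>+x. J x \<partial>lborel) * g y \<partial>lborel)"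
    by (simp add: nn_integral_multc nn_integral_lborel_translate)
  finally show ?thesis by (simp add: nn_integral_cmult)
qed

lemma
  fixes J g :: "'a::euclidean_space \<Rightarrow> real"
  assumes J: "integrable lborel J" and g: "integrable lborel g"
  shows convolution_AE_integrable: "AE x in lborel. integrable lborel (\<lambda>y. J (x - y) * g y)"
    and convolution_integrable: "integrable lborel (\<lambda>x. LINT y|lborel. J (x - y) * g y)"
    and convolution_integral:
      "(LINT x|lborel. LINT y|lborel. J (x - y) * g y) = (LINT x|lborel. J x) * (LINT y|lborel. g y)"
proof -
  have [measurable]: "J \<in> borel_measurable borel" "g \<in> borel_measurable borel"
    using J g by (simp_all add: integrable_iff_bounded)
  have "integrable (lborel \<Otimes>\<^sub>M lborel) (\<lambda>(x, y). J (x - y) * g y)"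
  proof (rule integrableI_bounded)
    have "(\<integral>\<^sup>+z. ennreal (norm (case z of (x, y) \<Rightarrow> J (x - y) * g y)) \<partial>(lborel \<Otimes>\<^sub>M lborel))
      = (\<integral>\<^sup>+x. \<integral>\<^sup>+y. ennreal \<bar>J (x - y)\<bar> * ennreal \<bar>g y\<bar> \<partial>lborel \<partial>lborel)"
      by (subst lborel.nn_integral_fst[symmetric]) (simp_all add: abs_mult ennreal_mult)
    also have "\<dots> < \<infinity>"
      using J g by (subst nn_integral_convolution) (auto simp: integrable_iff_bounded ennreal_mult_less_top)
    finally show "(\<integral>\<^sup>+z. ennreal (norm (case z of (x, y) \<Rightarrow> J (x - y) * g y)) \<partial>(lborel \<Otimes>\<^sub>M lborel)) < \<infinity>" .
  qed simp
  note int = this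
  show "AE x in lborel. integrable lborel (\<lambda>y. J (x - y) * g y)"
    using lborel_pair.AE_integrable_fst'[OF int] by simp
  show "integrable lborel (\<lambda>x. LINT y|lborel. J (x - y) * g y)"
    using lborel_pair.integrable_fst'[OF int] by simp
  have "(LINT x|lborel. LINT y|lborel. J (x - y) * g y) = (LINT y|lborel. LINT x|lborel. J (x - y) * g y)"
    using lborel_pair.Fubini_integral[OF int] by simp
  also have "\<dots> = (LINT y|lborel. (LINT x|lborel. J x) * g y)"
    by (simp add: integral_lborel_translate)
  finally show "(LINT x|lborel. LINT y|lborel. J (x - y) * g y) = (LINT x|lborel. J x) * (LINT y|lborel. g y)"
    by simp
qed

lemma space_conv_measurable [measurable]:
  fixes J :: "'a::euclidean_space \<Rightarrow> real"
  assumes [measurable]: "J \<in> borel_measurable borel" "f \<in> borel_measurable borel"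
  shows "space_conv J f \<in> borel_measurable borel"
proof -
  have "(\<lambda>z. LINT y|lborel. J (fst z - y) * f (y, snd z)) \<in> borel_measurable (borel :: ('a \<times> real) measure)"
    unfolding borel_prod[symmetric] by measurable
  then show ?thesis by (simp add: space_conv_def[abs_def])
qed

lemma borel_measurable_sections:
  fixes f :: "'a::euclidean_space \<times> 'b::euclidean_space \<Rightarrow> real"
  assumes f: "f \<in> borel_measurable borel"
  shows "(\<lambda>x. f (x, t)) \<in> borel_measurable borel" "(\<lambda>t. f (x, t)) \<in> borel_measurable borel"
proof -
  have "(\<lambda>x. (x, t)) \<in> borel \<rightarrow>\<^sub>M borel" "(\<lambda>t. (x, t)) \<in> borel \<rightarrow>\<^sub>M borel"
    by (intro borel_measurable_continuous_onI continuous_intros)+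
  then show "(\<lambda>x. f (x, t)) \<in> borel_measurable borel" "(\<lambda>t. f (x, t)) \<in> borel_measurable borel"
    using f by (auto intro: measurable_compose)
qed

lemma nn_integral_lborel_prod_fst:
  fixes F :: "'a::euclidean_space \<times> 'b::euclidean_space \<Rightarrow> ennreal"
  assumes "F \<in> borel_measurable borel"
  shows "(\<integral>\<^sup>+z. F z \<partial>lborel) = (\<integral>\<^sup>+x. \<integral>\<^sup>+t. F (x, t) \<partial>lborel \<partial>lborel)"
  using lborel.nn_integral_fst[of F lborel] assms by (simp add: borel_prod lborel_prod)

lemma nn_integral_lborel_prod_snd:
  fixes F :: "'a::euclidean_space \<times> 'b::euclidean_space \<Rightarrow> ennreal"
  assumes "F \<in> borel_measurable borel"
  shows "(\<integral>\<^sup>+z. F z \<partial>lborel) = (\<integral>\<^sup>+t. \<integral>\<^sup>+x. F (x, t) \<partial>lborel \<partial>lborel)"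
  using lborel_pair.nn_integral_snd[of F] assms by (simp add: borel_prod lborel_prod)

lemma
  fixes f :: "'a::euclidean_space \<times> 'b::euclidean_space \<Rightarrow> real"
  assumes "integrable lborel f"
  shows AE_integrable_lborel_fst: "AE x in lborel. integrable lborel (\<lambda>t. f (x, t))"
    and integrable_lborel_fst: "integrable lborel (\<lambda>x. LINT t|lborel. f (x, t))"
    and integral_lborel_fst: "(LINT x|lborel. LINT t|lborel. f (x, t)) = integral\<^sup>L lborel f"
    and AE_integrable_lborel_snd: "AE t in lborel. integrable lborel (\<lambda>x. f (x, t))"
    and integrable_lborel_snd: "integrable lborel (\<lambda>t. LINT x|lborel. f (x, t))"
    and integral_lborel_snd: "(LINT t|lborel. LINT x|lborel. f (x, t)) = integral\<^sup>L lborel f"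
proof -
  have f: "integrable (lborel \<Otimes>\<^sub>M lborel) f" using assms by (simp only: lborel_prod)
  have f': "integrable (lborel \<Otimes>\<^sub>M lborel) (case_prod (\<lambda>x t. f (x, t)))" using f by simp
  show "AE x in lborel. integrable lborel (\<lambda>t. f (x, t))"
    by (rule lborel_pair.AE_integrable_fst'[OF f])
  show "integrable lborel (\<lambda>x. LINT t|lborel. f (x, t))"
    by (rule lborel_pair.integrable_fst'[OF f])
  show "(LINT x|lborel. LINT t|lborel. f (x, t)) = integral\<^sup>L lborel f"
    using lborel_pair.integral_fst'[OF f] by (simp only: lborel_prod)
  show "AE t in lborel. integrable lborel (\<lambda>x. f (x, t))"
    by (rule lborel_pair.AE_integrable_snd[OF f'])
  show "integrable lborel (\<lambda>t. LINT x|lborel. f (x, t))"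
    by (rule lborel_pair.integrable_snd[OF f'])
  show "(LINT t|lborel. LINT x|lborel. f (x, t)) = integral\<^sup>L lborel f"
    using lborel_pair.integral_snd[OF f'] by (simp only: lborel_prod case_prod_eta split_def prod.collapse)
qed

lemma
  fixes J :: "'a::euclidean_space \<Rightarrow> real"
  assumes J: "integrable lborel J" and f: "integrable lborel f"
  shows space_conv_AE_integrable: "AE z in lborel. integrable lborel (\<lambda>y. J (fst z - y) * f (y, snd z))"
    and space_conv_integrable: "integrable lborel (space_conv J f)"
    and space_conv_integral: "integral\<^sup>L lborel (space_conv J f) = (LINT x|lborel. J x) * integral\<^sup>L lborel f"
proof -
  have [measurable]: "J \<in> borel_measurable borel" "f \<in> borel_measurable borel"
    using J f by (simp_all add: integrable_iff_bounded)
  let ?H = "\<lambda>p :: ('a \<times> real) \<times> 'a. J (fst (fst p) - snd p) * f (snd p, snd (fst p))"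
  have H[measurable]: "?H \<in> borel_measurable borel"
    unfolding borel_prod[symmetric] by measurable
  have "integrable lborel ?H"
  proof (rule integrableI_bounded)
    have "(\<integral>\<^sup>+p. ennreal (norm (?H p)) \<partial>lborel)
      = (\<integral>\<^sup>+z. \<integral>\<^sup>+y. ennreal (norm (?H (z, y))) \<partial>lborel \<partial>lborel)"
      by (rule nn_integral_lborel_prod_fst) measurable
    also have "\<dots> = (\<integral>\<^sup>+t. \<integral>\<^sup>+x. \<integral>\<^sup>+y. ennreal (norm (?H ((x, t), y))) \<partial>lborel \<partial>lborel \<partial>lborel)"
      by (rule nn_integral_lborel_prod_snd)
        (rule lborel.borel_measurable_nn_integral, unfold borel_prod[symmetric], measurable)
    also have "\<dots> = (\<integral>\<^sup>+t. \<integral>\<^sup>+x. \<integral>\<^sup>+y. ennreal \<bar>J (x - y)\<bar> * ennreal \<bar>f (y, t)\<bar> \<partial>lborel \<partial>lborel \<partial>lborel)"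
      by (simp add: abs_mult ennreal_mult)
    also have "\<dots> = (\<integral>\<^sup>+t. (\<integral>\<^sup>+x. \<bar>J x\<bar> \<partial>lborel) * (\<integral>\<^sup>+y. \<bar>f (y, t)\<bar> \<partial>lborel) \<partial>lborel)"
      by (intro nn_integral_cong nn_integral_convolution)
        (auto intro!: measurable_compose[OF _ measurable_ennreal] borel_measurable_abs borel_measurable_sections)
    also have "\<dots> = (\<integral>\<^sup>+x. \<bar>J x\<bar> \<partial>lborel) * (\<integral>\<^sup>+t. \<integral>\<^sup>+y. \<bar>f (y, t)\<bar> \<partial>lborel \<partial>lborel)"
      by (intro nn_integral_cmult) measurable
    also have "(\<integral>\<^sup>+t. \<integral>\<^sup>+y. \<bar>f (y, t)\<bar> \<partial>lborel \<partial>lborel) = (\<integral>\<^sup>+z. \<bar>f z\<bar> \<partial>lborel)"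
      by (rule nn_integral_lborel_prod_snd[symmetric]) measurable
    also have "(\<integral>\<^sup>+x. \<bar>J x\<bar> \<partial>lborel) * (\<integral>\<^sup>+z. \<bar>f z\<bar> \<partial>lborel) < \<infinity>"
      using J f by (auto simp: integrable_iff_bounded ennreal_mult_less_top)
    finally show "(\<integral>\<^sup>+p. ennreal (norm (?H p)) \<partial>lborel) < \<infinity>" .
  qed simp
  note int = this
  show "AE z in lborel. integrable lborel (\<lambda>y. J (fst z - y) * f (y, snd z))"
    using AE_integrable_lborel_fst[OF int] by simp
  show int': "integrable lborel (space_conv J f)"
    using integrable_lborel_fst[OF int] by (simp add: space_conv_def[abs_def])
  have "integral\<^sup>L lborel (space_conv J f) = (LINT t|lborel. LINT x|lborel. space_conv J f (x, t))"
    by (rule integral_lborel_snd[OF int', symmetric])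
  also have "\<dots> = (LINT t|lborel. (LINT x|lborel. J x) * (LINT y|lborel. f (y, t)))"
  proof (rule integral_cong_AE)
    show "(\<lambda>t. LINT x|lborel. space_conv J f (x, t)) \<in> borel_measurable lborel"
      using integrable_lborel_snd[OF int'] by simp
    show "(\<lambda>t. (LINT x|lborel. J x) * (LINT y|lborel. f (y, t))) \<in> borel_measurable lborel"
      using integrable_lborel_snd[OF f] by simp
    show "AE t in lborel. (LINT x|lborel. space_conv J f (x, t)) = (LINT x|lborel. J x) * (LINT y|lborel. f (y, t))"
      using AE_integrable_lborel_snd[OF f]
      by eventually_elim (simp add: space_conv_def convolution_integral[OF J])
  qed
  also have "\<dots> = (LINT x|lborel. J x) * integral\<^sup>L lborel f"
    by (simp add: integral_lborel_snd[OF f])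
  finally show "integral\<^sup>L lborel (space_conv J f) = (LINT x|lborel. J x) * integral\<^sup>L lborel f" .
qed

section \<open>Integrated form of the equation\<close>

lemma continuous_on_indefinite_integral:
  fixes h :: "real \<Rightarrow> real"
  assumes h: "integrable lborel h"
  shows "continuous_on UNIV (\<lambda>t. LINT s|lborel. indicator {0<..t} s * h s)"
proof (intro continuous_at_imp_continuous_on ballI)
  fix t :: real
  show "isCont (\<lambda>t. LINT s|lborel. indicator {0<..t} s * h s) t"
    unfolding continuous_at_sequentially o_def
  proof (intro allI impI)
    fix T :: "nat \<Rightarrow> real" assume T: "T \<longlonglongrightarrow> t"
    have [measurable]: "h \<in> borel_measurable borel" using h by (simp add: integrable_iff_bounded)
    show "(\<lambda>n. LINT s|lborel. indicator {0<..T n} s * h s) \<longlonglongrightarrow> (LINT s|lborel. indicator {0<..t} s * h s)"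
    proof (rule integral_dominated_convergence[where w = "\<lambda>s. \<bar>h s\<bar>"])
      show "AE s in lborel. (\<lambda>n. indicator {0<..T n} s * h s) \<longlonglongrightarrow> indicator {0<..t} s * h s"
        using AE_lborel_singleton[of t]
      proof eventually_elim
        case (elim s)
        have "\<forall>\<^sub>F n in sequentially. indicator {0<..T n} s = (indicator {0<..t} s :: real)"
        proof (cases "s < t")
          case True
          show ?thesis using order_tendstoD(1)[OF T True]
            by eventually_elim (use True in \<open>auto simp: indicator_def\<close>)
        next
          case False
          then have "t < s" using elim by simp
          show ?thesis using order_tendstoD(2)[OF T \<open>t < s\<close>]
            by eventually_elim (use \<open>t < s\<close> in \<open>auto simp: indicator_def\<close>)
        qed
        then have "\<forall>\<^sub>F n in sequentially. indicator {0<..T n} s * h s = indicator {0<..t} s * h s"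
          by eventually_elim simp
        then show ?case by (rule tendsto_eventually)
      qed
    qed (use h in \<open>auto simp: indicator_def\<close>)
  qed
qed

lemma integrable_subinterval:
  fixes h :: "real \<Rightarrow> real"
  assumes "integrable lborel (\<lambda>s. indicator {0<..T} s * h s)" "0 \<le> a" "b \<le> T"
  shows "integrable lborel (\<lambda>s. indicator {a<..b} s * h s)"
proof -
  have "integrable lborel (\<lambda>s. indicator {a<..b} s *\<^sub>R (indicator {0<..T} s * h s))"
    by (intro integrable_mult_indicator assms) simp
  also have "(\<lambda>s. indicator {a<..b} s *\<^sub>R (indicator {0<..T} s * h s)) = (\<lambda>s. indicator {a<..b} s * h s)"
    using assms(2,3) by (auto simp: indicator_def)
  finally show ?thesis .
qed

text \<open>
  A function \<open>z\<close> with derivative \<open>\<kappa> \<le> G - d\<close>, where \<open>G \<ge> 0\<close>: its positive part grows at most at the rate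
  \<open>G - 1\<^bsub>z > 0\<^esub> d\<close>. Instead of a chain rule, convexity of the positive part is used on a grid of
  mesh \<open>t/(n+1)\<close>, with \<open>n \<rightarrow> \<infinity>\<close>; \<open>d\<close> is assumed to vanish with \<open>z\<close>, since there the grid values of
  \<open>1\<^bsub>z > 0\<^esub>\<close> need not converge. The function \<open>e\<close> is a version of \<open>1\<^bsub>z > 0\<^esub> d\<close>.
\<close>

lemma positive_part_le_integral:
  fixes z \<kappa> d e G :: "real \<Rightarrow> real"
  assumes t: "0 < t"
    and int: "integrable lborel (\<lambda>s. indicator {0<..t} s * \<kappa> s)"
      "integrable lborel (\<lambda>s. indicator {0<..t} s * d s)"
      "integrable lborel (\<lambda>s. indicator {0<..t} s * G s)"
      "integrable lborel (\<lambda>s. indicator {0<..t} s * e s)"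
    and z: "\<And>a b. 0 \<le> a \<Longrightarrow> a \<le> b \<Longrightarrow> b \<le> t \<Longrightarrow> z b - z a = (LINT s|lborel. indicator {a<..b} s * \<kappa> s)"
    and cont: "continuous_on {0..t} z"
    and z0: "z 0 \<le> 0"
    and G: "\<And>s. 0 \<le> G s"
    and le: "AE s in lborel. s \<in> {0<..t} \<longrightarrow> \<kappa> s \<le> G s - d s"
    and d0: "AE s in lborel. s \<in> {0<..t} \<longrightarrow> z s = 0 \<longrightarrow> d s = 0"
    and e: "AE s in lborel. s \<in> {0<..t} \<longrightarrow> e s = of_bool (0 < z s) * d s"
  shows "max 0 (z t) \<le> (LINT s|lborel. indicator {0<..t} s * (G s - e s))"
proof -
  (* up n s is the first grid point that is not to the left of s *)
  define up where "up n s = t * of_int \<lceil>real (Suc n) * s / t\<rceil> / real (Suc n)" for n s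
  define \<theta> where "\<theta> n s = (of_bool (0 < z (up n s)) :: real)" for n s
  have up: "s \<le> up n s" "up n s < s + t / real (Suc n)" for n s
  proof -
    define N where "N = real (Suc n)"
    have "0 < N" by (simp add: N_def)
    then have s: "s = t * (N * s / t) / N" using t by simp
    have "t * (N * s / t) / N \<le> t * of_int \<lceil>N * s / t\<rceil> / N"
      using t \<open>0 < N\<close> by (intro divide_right_mono mult_left_mono) auto
    then show "s \<le> up n s" using s by (simp add: up_def N_def)
    have "t * of_int \<lceil>N * s / t\<rceil> / N < t * (N * s / t + 1) / N"
      using t \<open>0 < N\<close> by (intro divide_strict_right_mono mult_strict_left_mono) linarith+
    also have "\<dots> = s + t / N" using t \<open>0 < N\<close> by (simp add: field_simps)
    finally show "up n s < s + t / real (Suc n)" by (simp add: up_def N_def)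
  qed
  define g where "g n j = t * real j / real (Suc n)" for n j
  have up_grid: "up n s = g n (Suc j)" if s: "s \<in> {g n j<..g n (Suc j)}" for n j s
  proof -
    have "\<lceil>real (Suc n) * s / t\<rceil> = int (Suc j)"
      using s t by (intro ceiling_unique) (auto simp: g_def field_simps)
    then show ?thesis by (simp add: up_def g_def)
  qed
  have up_le: "up n s \<le> t" if "s \<le> t" for n s
  proof -
    have "\<lceil>real (Suc n) * s / t\<rceil> \<le> int (Suc n)"
      using mult_right_mono[OF that, of "real (Suc n)"] t by (simp add: ceiling_le_iff field_simps)
    then have "(of_int \<lceil>real (Suc n) * s / t\<rceil> :: real) \<le> real (Suc n)" by linarith
    then show ?thesis using t unfolding up_def
      by (simp add: pos_divide_le_eq mult_left_mono del: of_nat_Suc)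
  qed
  have ups: "(\<lambda>n. up n s) \<longlonglongrightarrow> s" for s
  proof (rule tendsto_sandwich[OF _ _ tendsto_const])
    show "(\<lambda>n. s + t / real (Suc n)) \<longlonglongrightarrow> s"
      using tendsto_add[OF tendsto_const tendsto_mult[OF tendsto_const LIMSEQ_inverse_real_of_nat], of s t]
      by (simp add: divide_inverse)
  qed (auto simp: up(1) less_imp_le[OF up(2)] simp del: of_nat_Suc)
  have \<theta>_meas[measurable]: "(\<lambda>s. indicator {0<..t} s * \<theta> n s) \<in> borel_measurable borel" for n
  proof -
    have [measurable]: "(\<lambda>s. indicator {0..t} s * z s) \<in> borel_measurable borel"
      using borel_measurable_continuous_on_indicator[OF _ cont] by simp
    have "(\<lambda>s. indicator {0<..t} s * \<theta> n s) =
        (\<lambda>s. indicator {0<..t} s * (of_bool (0 < (indicator {0..t} (up n s) * z (up n s))) :: real))"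
    proof
      fix s
      have "up n s \<in> {0..t}" if "s \<in> {0<..t}"
        using up(1)[of s n] up_le[of s n] that by simp
      then show "indicator {0<..t} s * \<theta> n s =
          indicator {0<..t} s * (of_bool (0 < (indicator {0..t} (up n s) * z (up n s))) :: real)"
        by (cases "s \<in> {0<..t}") (simp_all add: \<theta>_def)
    qed
    also have "\<dots> \<in> borel_measurable borel"
      unfolding up_def of_bool_def by measurable
    finally show ?thesis .
  qed
  have int\<theta>: "integrable lborel (\<lambda>s. indicator {0<..t} s * (\<theta> n s * h s))"
    if "integrable lborel (\<lambda>s. indicator {0<..t} s * h s)" for n h
  proof (rule Bochner_Integration.integrable_bound[OF that])
    have "(\<lambda>s. (indicator {0<..t} s * \<theta> n s) * (indicator {0<..t} s * h s)) \<in> borel_measurable lborel"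
      by (rule borel_measurable_times[OF _ borel_measurable_integrable[OF that]]) (use \<theta>_meas in simp)
    also have "(\<lambda>s. (indicator {0<..t} s * \<theta> n s) * (indicator {0<..t} s * h s))
        = (\<lambda>s. indicator {0<..t} s * (\<theta> n s * h s))"
      by (auto simp: indicator_def)
    finally show "(\<lambda>s. indicator {0<..t} s * (\<theta> n s * h s)) \<in> borel_measurable lborel" .
  qed (auto simp: \<theta>_def indicator_def)
  have grid: "max 0 (z (g n j)) \<le> (LINT s|lborel. indicator {0<..g n j} s * (\<theta> n s * \<kappa> s))"
    if "j \<le> Suc n" for n j
    using that
  proof (induction j)
    case 0
    then show ?case using z0 by (simp add: g_def)
  next
    case (Suc j)
    have g: "0 \<le> g n j" "g n j \<le> g n (Suc j)" "g n (Suc j) \<le> t"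
      using Suc.prems t by (auto simp: g_def field_simps)
    let ?b = "of_bool (0 < z (g n (Suc j))) :: real"
    (* convexity of the positive part, with its subgradient at the right end point *)
    have "max 0 (z (g n (Suc j))) \<le> max 0 (z (g n j)) + ?b * (z (g n (Suc j)) - z (g n j))"
      by auto
    also have "?b * (z (g n (Suc j)) - z (g n j))
        = ?b * (LINT s|lborel. indicator {g n j<..g n (Suc j)} s * \<kappa> s)"
      by (subst z) (use g in auto)
    also have "\<dots> = (LINT s|lborel. ?b * (indicator {g n j<..g n (Suc j)} s * \<kappa> s))"
      by simp
    also have "\<dots> = (LINT s|lborel. indicator {g n j<..g n (Suc j)} s * (\<theta> n s * \<kappa> s))"
      by (intro Bochner_Integration.integral_cong) (auto simp: \<theta>_def up_grid indicator_def)
    also have "max 0 (z (g n j)) + \<dots> \<le> (LINT s|lborel. indicator {0<..g n j} s * (\<theta> n s * \<kappa> s)) + \<dots>"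
      using Suc by simp
    also have "\<dots> = (LINT s|lborel. indicator {0<..g n j} s * (\<theta> n s * \<kappa> s)
        + indicator {g n j<..g n (Suc j)} s * (\<theta> n s * \<kappa> s))"
      by (intro Bochner_Integration.integral_add[symmetric] integrable_subinterval[OF int\<theta>[OF int(1)]])
        (use g in auto)
    also have "\<dots> = (LINT s|lborel. indicator {0<..g n (Suc j)} s * (\<theta> n s * \<kappa> s))"
      using g by (intro Bochner_Integration.integral_cong) (auto simp: indicator_def)
    finally show ?case by simp
  qed
  have bound: "max 0 (z t) \<le> (LINT s|lborel. indicator {0<..t} s * (G s - \<theta> n s * d s))" for n
  proof -
    have "g n (Suc n) = t" by (simp add: g_def)
    then have "max 0 (z t) \<le> (LINT s|lborel. indicator {0<..t} s * (\<theta> n s * \<kappa> s))"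
      using grid[of "Suc n" n] by simp
    also have "\<dots> \<le> (LINT s|lborel. indicator {0<..t} s * (G s - \<theta> n s * d s))"
    proof (rule integral_mono_AE[OF int\<theta>[OF int(1)]])
      show "integrable lborel (\<lambda>s. indicator {0<..t} s * (G s - \<theta> n s * d s))"
        using Bochner_Integration.integrable_diff[OF int(3) int\<theta>[OF int(2), of n]] by (simp add: right_diff_distrib)
      show "AE s in lborel. indicator {0<..t} s * (\<theta> n s * \<kappa> s) \<le> indicator {0<..t} s * (G s - \<theta> n s * d s)"
        using le by eventually_elim (use G in \<open>auto simp: \<theta>_def indicator_def\<close>)
    qed
    finally show ?thesis .
  qed
  have "(\<lambda>n. LINT s|lborel. indicator {0<..t} s * (G s - \<theta> n s * d s))
      \<longlonglongrightarrow> (LINT s|lborel. indicator {0<..t} s * (G s - e s))"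
  proof (rule integral_dominated_convergence[where
        w = "\<lambda>s. norm (indicator {0<..t} s * G s) + norm (indicator {0<..t} s * d s)"])
    show "(\<lambda>s. indicator {0<..t} s * (G s - \<theta> n s * d s)) \<in> borel_measurable lborel" for n
      using borel_measurable_integrable[OF Bochner_Integration.integrable_diff[OF int(3) int\<theta>[OF int(2), of n]]]
      by (simp add: right_diff_distrib)
    show "(\<lambda>s. indicator {0<..t} s * (G s - e s)) \<in> borel_measurable lborel"
      using borel_measurable_integrable[OF Bochner_Integration.integrable_diff[OF int(3,4)]]
      by (simp add: right_diff_distrib)
    show "integrable lborel (\<lambda>s. norm (indicator {0<..t} s * G s) + norm (indicator {0<..t} s * d s))"
      using int by (intro Bochner_Integration.integrable_add integrable_norm)
    show "AE s in lborel. norm (indicator {0<..t} s * (G s - \<theta> n s * d s))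
        \<le> norm (indicator {0<..t} s * G s) + norm (indicator {0<..t} s * d s)" for n
      by (intro AE_I2) (auto simp: \<theta>_def indicator_def)
    show "AE s in lborel. (\<lambda>n. indicator {0<..t} s * (G s - \<theta> n s * d s))
        \<longlonglongrightarrow> indicator {0<..t} s * (G s - e s)"
      using d0 e
    proof eventually_elim
      case (elim s)
      show ?case
      proof (cases "s \<in> {0<..t} \<and> z s \<noteq> 0")
        case False
        then show ?thesis using elim by (auto simp: indicator_def)
      next
        case True
        have "(\<lambda>n. z (up n s)) \<longlonglongrightarrow> z s"
          using True up(1)[of s] up_le[of s]
          by (intro continuous_on_tendsto_compose[OF cont ups] always_eventually) (auto intro: order_trans[of 0 s])
        then have "\<forall>\<^sub>F n in sequentially. \<theta> n s = of_bool (0 < z s)"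
        proof (cases "0 < z s")
          case True
          with order_tendstoD(1)[OF \<open>(\<lambda>n. z (up n s)) \<longlonglongrightarrow> z s\<close>, of 0] show ?thesis
            by (auto simp: \<theta>_def elim!: eventually_mono)
        next
          case False
          with \<open>s \<in> {0<..t} \<and> z s \<noteq> 0\<close> have "z s < 0" by simp
          with order_tendstoD(2)[OF \<open>(\<lambda>n. z (up n s)) \<longlonglongrightarrow> z s\<close>, of 0] show ?thesis
            by (auto simp: \<theta>_def elim!: eventually_mono)
        qed
        then show ?thesis using True elim by (intro tendsto_eventually) (auto elim!: eventually_mono)
      qed
    qed
  qed
  then show ?thesis by (rule LIMSEQ_le_const) (use bound in auto)
qed

section \<open>Mild solutions and comparison\<close>

text \<open>
  The right-hand side \<open>J * U\<^sup>m - U\<^sup>m\<close> of the equation, and the initial datum plus its time integral.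
  Unlike \<open>u\<close> in the weak formulation, \<open>U\<close> takes a pair.
\<close>

definition reaction :: "('a::euclidean_space \<Rightarrow> real) \<Rightarrow> real \<Rightarrow> ('a \<times> real \<Rightarrow> real) \<Rightarrow> 'a \<times> real \<Rightarrow> real" where
  "reaction J m U z = space_conv J (\<lambda>z. U z powr m) z - U z powr m"

definition trajectory ::
  "('a::euclidean_space \<Rightarrow> real) \<Rightarrow> real \<Rightarrow> ('a \<Rightarrow> real) \<Rightarrow> ('a \<times> real \<Rightarrow> real) \<Rightarrow> 'a \<Rightarrow> real \<Rightarrow> real" where
  "trajectory J m u0 U x t = u0 x + (LINT s|lborel. indicator {0<..t} s * reaction J m U (x, s))"

lemma space_conv_time_factor:
  "space_conv J (\<lambda>z. \<phi> (snd z) * f z) z = \<phi> (snd z) * space_conv J f z"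
  by (simp add: space_conv_def mult.left_commute[of _ "\<phi> _"])

text \<open>
  The integrability under which both sides of the integrated equation make sense. Kernel, datum and
  solution are Borel representatives, kernel and solution are nonnegative everywhere, and the kernel
  is a probability density.
\<close>

locale evolution_data =
  fixes J :: "'a::euclidean_space \<Rightarrow> real" and m :: real
    and u0 :: "'a \<Rightarrow> real" and U :: "'a \<times> real \<Rightarrow> real"
  assumes m: "1 < m"
    and J: "integrable lborel J" and J_nonneg: "\<And>x. 0 \<le> J x" and J_integral: "(LINT x|lborel. J x) = 1"
    and u0: "integrable lborel u0"
    and U_measurable [measurable]: "U \<in> borel_measurable borel" and U_nonneg: "\<And>z. 0 \<le> U z"
    and U_integrable: "\<And>T. integrable lborel (\<lambda>z. indicator {0<..T} (snd z) * U z)"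
    and Um_integrable: "\<And>T. integrable lborel (\<lambda>z. indicator {0<..T} (snd z) * U z powr m)"
begin

lemma J_measurable [measurable]: "J \<in> borel_measurable borel"
  and u0_measurable [measurable]: "u0 \<in> borel_measurable borel"
  using J u0 by (simp_all add: integrable_iff_bounded)

lemma reaction_measurable [measurable]: "reaction J m U \<in> borel_measurable borel"
  unfolding reaction_def[abs_def] by measurable

lemma conv_integrable:
  "integrable lborel (\<lambda>z. indicator {0<..T} (snd z) * space_conv J (\<lambda>z. U z powr m) z)"
  using space_conv_integrable[OF J Um_integrable[of T]]
  by (simp add: space_conv_time_factor[of J "indicator {0<..T}", abs_def])

lemma reaction_integrable: "integrable lborel (\<lambda>z. indicator {0<..T} (snd z) * reaction J m U z)"
  unfolding reaction_def right_diff_distrib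
  by (intro Bochner_Integration.integrable_diff conv_integrable Um_integrable)

lemma trajectory_measurable [measurable]:
  "(\<lambda>z. trajectory J m u0 U (fst z) (snd z)) \<in> borel_measurable borel"
proof -
  have "(\<lambda>z. LINT s|lborel. (if 0 < s \<and> s \<le> snd z then reaction J m U (fst z, s) else 0))
      \<in> borel_measurable (borel :: ('a \<times> real) measure)"
    unfolding borel_prod[symmetric] by measurable
  also have "(\<lambda>z. LINT s|lborel. (if 0 < s \<and> s \<le> snd z then reaction J m U (fst z, s) else 0))
      = (\<lambda>z. LINT s|lborel. indicator {0<..snd z} s * reaction J m U (fst z, s))"
    by (intro ext Bochner_Integration.integral_cong) (auto simp: indicator_def)
  finally have "(\<lambda>z. LINT s|lborel. indicator {0<..snd z} s * reaction J m U (fst z, s))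
      \<in> borel_measurable (borel :: ('a \<times> real) measure)" .
  moreover have "(\<lambda>z. u0 (fst z)) \<in> borel_measurable (borel :: ('a \<times> real) measure)"
    by (rule measurable_compose[OF _ u0_measurable])
      (intro borel_measurable_continuous_onI continuous_intros)
  ultimately show ?thesis unfolding trajectory_def by (rule borel_measurable_add[rotated])
qed

text \<open>The points at which the integrated equation has an absolutely convergent right-hand side.\<close>

definition regular_at :: "'a \<Rightarrow> bool" where
  "regular_at x \<longleftrightarrow> (\<forall>T. integrable lborel (\<lambda>s. indicator {0<..T} s * reaction J m U (x, s)))"

lemma AE_regular_at: "AE x in lborel. regular_at x"
proof -
  have "AE x in lborel. \<forall>n::nat. integrable lborel (\<lambda>s. indicator {0<..real n} s * reaction J m U (x, s))"
    unfolding AE_all_countable using AE_integrable_lborel_fst[OF reaction_integrable] by auto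
  then show ?thesis
  proof eventually_elim
    case (elim x)
    show ?case unfolding regular_at_def
    proof
      fix T :: real
      obtain n :: nat where n: "T \<le> real n" using real_arch_simple by blast
      show "integrable lborel (\<lambda>s. indicator {0<..T} s * reaction J m U (x, s))"
        by (rule integrable_subinterval[of "real n"]) (use elim n in auto)
    qed
  qed
qed

lemma trajectory_0: "trajectory J m u0 U x 0 = u0 x"
  by (simp add: trajectory_def)

lemma trajectory_increment:
  assumes "regular_at x" "0 \<le> a" "a \<le> b"
  shows "trajectory J m u0 U x b - trajectory J m u0 U x a
    = (LINT s|lborel. indicator {a<..b} s * reaction J m U (x, s))"
proof -
  have i: "integrable lborel (\<lambda>s. indicator {0<..b} s * reaction J m U (x, s))"
    using assms(1) by (simp add: regular_at_def)
  have "(LINT s|lborel. indicator {0<..b} s * reaction J m U (x, s)) =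
      (LINT s|lborel. indicator {0<..a} s * reaction J m U (x, s) + indicator {a<..b} s * reaction J m U (x, s))"
    using assms by (intro Bochner_Integration.integral_cong) (auto simp: indicator_def)
  also have "\<dots> = (LINT s|lborel. indicator {0<..a} s * reaction J m U (x, s))
      + (LINT s|lborel. indicator {a<..b} s * reaction J m U (x, s))"
    using assms by (intro Bochner_Integration.integral_add integrable_subinterval[OF i]) auto
  finally show ?thesis by (simp add: trajectory_def)
qed

lemma trajectory_continuous:
  assumes "regular_at x"
  shows "continuous_on {0..T} (trajectory J m u0 U x)"
proof -
  have "integrable lborel (\<lambda>s. indicator {0<..T} s * reaction J m U (x, s))"
    using assms by (simp add: regular_at_def)
  from continuous_on_indefinite_integral[OF this]
  have "continuous_on {0..T} (\<lambda>t. u0 x + (LINT s|lborel. indicator {0<..t} s * (indicator {0<..T} s * reaction J m U (x, s))))"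
    by (intro continuous_intros) (auto intro: continuous_on_subset)
  also have "continuous_on {0..T} (\<lambda>t. u0 x + (LINT s|lborel. indicator {0<..t} s * (indicator {0<..T} s * reaction J m U (x, s))))
      \<longleftrightarrow> ?thesis"
    unfolding trajectory_def
    by (intro continuous_on_cong refl arg_cong2[where f="(+)"] Bochner_Integration.integral_cong)
       (auto simp: indicator_def)
  finally show ?thesis .
qed

lemma trajectory_integrable: "integrable lborel (\<lambda>x. trajectory J m u0 U x t)"
  unfolding trajectory_def
  using integrable_lborel_fst[OF reaction_integrable[of t]]
  by (intro Bochner_Integration.integrable_add u0) simp

text \<open>Conservation of mass: the kernel has integral one, so the reaction term has integral zero.\<close>

lemma trajectory_integral: "(LINT x|lborel. trajectory J m u0 U x t) = (LINT x|lborel. u0 x)"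
proof -
  let ?w = "\<lambda>z. indicator {0<..t} (snd z) * U z powr m"
  have "(LINT x|lborel. LINT s|lborel. indicator {0<..t} s * reaction J m U (x, s))
      = (LINT z|lborel. indicator {0<..t} (snd z) * reaction J m U z)"
    using integral_lborel_fst[OF reaction_integrable[of t]] by simp
  also have "\<dots> = (LINT z|lborel. space_conv J ?w z - ?w z)"
    by (simp add: reaction_def space_conv_time_factor[of J "indicator {0<..t}"] right_diff_distrib)
  also have "\<dots> = 0"
    by (simp add: space_conv_integrable[OF J] Um_integrable space_conv_integral[OF J] J_integral)
  finally show ?thesis
    unfolding trajectory_def using integrable_lborel_fst[OF reaction_integrable[of t]] u0 by simp
qed

end

text \<open>A mild solution satisfies the equation integrated in time, almost everywhere in space-time.\<close>

locale mild_solution = evolution_data +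
  assumes U_eq: "AE z in lborel. 0 < snd z \<longrightarrow> U z = trajectory J m u0 U (fst z) (snd z)"

text \<open>
  Comparison. The positive part of the difference of two solutions grows at most at the
  rate \<open>J * f\<^sup>+ - f\<^sup>+\<close> with \<open>f = U\<^sup>m - V\<^sup>m\<close>, because \<open>f\<close> has the sign of \<open>U - V\<close>. The integral of this rate over
  space vanishes, so the \<open>L\<^sup>1\<close> norm of the positive part cannot increase from zero.
\<close>

lemma mild_solution_comparison:
  fixes J :: "'a::euclidean_space \<Rightarrow> real"
  assumes "mild_solution J m u0 U" "mild_solution J m v0 V"
    and le0: "AE x in lborel. u0 x \<le> v0 x" and t: "0 < t"
  shows "AE x in lborel. trajectory J m u0 U x t \<le> trajectory J m v0 V x t"
proof -
  interpret U: mild_solution J m u0 U by fact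
  interpret V: mild_solution J m v0 V by fact
  define z where "z x s = trajectory J m u0 U x s - trajectory J m v0 V x s" for x s
  define f where "f p = U p powr m - V p powr m" for p
  define f' where "f' p = indicator {0<..t} (snd p) * max 0 (f p)" for p
  have fi: "integrable lborel (\<lambda>p. indicator {0<..t} (snd p) * f p)"
    unfolding f_def right_diff_distrib
    by (intro Bochner_Integration.integrable_diff U.Um_integrable V.Um_integrable)
  have f'i: "integrable lborel f'"
    using integrable_max[OF integrable_zero fi]
    by (rule back_subst[of "integrable lborel"]) (auto simp: f'_def indicator_def fun_eq_iff)
  have conv_f': "space_conv J f' p = indicator {0<..t} (snd p) * space_conv J (\<lambda>p. max 0 (f p)) p" for p
    unfolding f'_def by (rule space_conv_time_factor)
  have "AE p in lborel. snd p \<in> {0<..t} \<longrightarrow> reaction J m U p - reaction J m V p \<le> space_conv J f' p - f p"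
    using space_conv_AE_integrable[OF U.J U.Um_integrable[of t]]
      space_conv_AE_integrable[OF U.J V.Um_integrable[of t]]
      space_conv_AE_integrable[OF U.J f'i]
  proof eventually_elim
    case (elim p)
    show ?case
    proof
      assume p: "snd p \<in> {0<..t}"
      have i: "integrable lborel (\<lambda>y. J (fst p - y) * U (y, snd p) powr m)"
        "integrable lborel (\<lambda>y. J (fst p - y) * V (y, snd p) powr m)"
        using elim(1,2) p by simp_all
      have "space_conv J (\<lambda>z. U z powr m) p - space_conv J (\<lambda>z. V z powr m) p
          = (LINT y|lborel. J (fst p - y) * f (y, snd p))"
        using i by (simp add: space_conv_def f_def right_diff_distrib)
      also have "\<dots> \<le> (LINT y|lborel. J (fst p - y) * f' (y, snd p))"
      proof (rule integral_mono)
        show "integrable lborel (\<lambda>y. J (fst p - y) * f (y, snd p))"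
          using i by (simp add: f_def right_diff_distrib)
        show "J (fst p - y) * f (y, snd p) \<le> J (fst p - y) * f' (y, snd p)" for y
          using p U.J_nonneg by (intro mult_left_mono) (auto simp: f'_def)
      qed (use elim(3) in simp)
      finally show "reaction J m U p - reaction J m V p \<le> space_conv J f' p - f p"
        by (simp add: reaction_def f_def space_conv_def)
    qed
  qed
  note le = AE_lborel_prod_fst[OF this]
  note fint = AE_integrable_lborel_fst[OF fi] and f'int = AE_integrable_lborel_fst[OF f'i]
    and cint = AE_integrable_lborel_fst[OF space_conv_integrable[OF U.J f'i]]
  have "AE x in lborel. max 0 (z x t) \<le> (LINT s|lborel. space_conv J f' (x, s) - f' (x, s))"
    using U.AE_regular_at V.AE_regular_at le0 le AE_lborel_prod_fst[OF U.U_eq] AE_lborel_prod_fst[OF V.U_eq]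
      fint f'int cint
  proof eventually_elim
    case (elim x)
    have sign: "AE s in lborel. s \<in> {0<..t} \<longrightarrow>
        (z x s = 0 \<longrightarrow> f (x, s) = 0) \<and> of_bool (0 < z x s) * f (x, s) = max 0 (f (x, s))"
      using elim(5,6)
    proof eventually_elim
      case (elim s)
      show ?case
      proof
        assume "s \<in> {0<..t}"
        then have "z x s = U (x, s) - V (x, s)" using elim by (simp add: z_def)
        moreover have "U (x, s) < V (x, s) \<Longrightarrow> U (x, s) powr m < V (x, s) powr m"
          "V (x, s) < U (x, s) \<Longrightarrow> V (x, s) powr m < U (x, s) powr m"
          using U.m U.U_nonneg V.U_nonneg by (auto intro!: powr_less_mono2)
        ultimately show "(z x s = 0 \<longrightarrow> f (x, s) = 0) \<and> of_bool (0 < z x s) * f (x, s) = max 0 (f (x, s))"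
          by (cases "U (x, s)" "V (x, s)" rule: linorder_cases) (auto simp: f_def)
      qed
    qed
    have ci: "integrable lborel (\<lambda>s. indicator {0<..t} s * space_conv J f' (x, s))"
      using elim(9) by (rule back_subst[of "integrable lborel"]) (auto simp: conv_f' indicator_def fun_eq_iff)
    have fi': "integrable lborel (\<lambda>s. indicator {0<..t} s * f (x, s))"
      using elim(7) by simp
    have "max 0 (z x t) \<le> (LINT s|lborel. indicator {0<..t} s * (space_conv J f' (x, s) - f' (x, s)))"
    proof (rule positive_part_le_integral[where \<kappa> = "\<lambda>s. reaction J m U (x, s) - reaction J m V (x, s)", OF t _ fi' ci])
      show "integrable lborel (\<lambda>s. indicator {0<..t} s * f' (x, s))"
        using elim(8) by (rule back_subst[of "integrable lborel"]) (auto simp: f'_def indicator_def fun_eq_iff)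
      show "AE s in lborel. s \<in> {0<..t} \<longrightarrow> f' (x, s) = of_bool (0 < z x s) * f (x, s)"
        using sign by eventually_elim (simp add: f'_def)
      show "integrable lborel (\<lambda>s. indicator {0<..t} s * (reaction J m U (x, s) - reaction J m V (x, s)))"
        using elim(1,2) unfolding U.regular_at_def V.regular_at_def right_diff_distrib by simp
      show "z x b - z x a = (LINT s|lborel. indicator {a<..b} s * (reaction J m U (x, s) - reaction J m V (x, s)))"
        if "0 \<le> a" "a \<le> b" "b \<le> t" for a b
      proof -
        have "integrable lborel (\<lambda>s. indicator {a<..b} s * reaction J m U (x, s))"
          "integrable lborel (\<lambda>s. indicator {a<..b} s * reaction J m V (x, s))"
          using elim(1,2) that unfolding U.regular_at_def V.regular_at_def
          by (auto intro: integrable_subinterval)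
        then show ?thesis
          using U.trajectory_increment[OF elim(1) that(1,2)] V.trajectory_increment[OF elim(2) that(1,2)]
          by (simp add: z_def right_diff_distrib)
      qed
      show "continuous_on {0..t} (z x)"
        unfolding z_def by (intro continuous_on_diff U.trajectory_continuous V.trajectory_continuous elim)
      show "z x 0 \<le> 0" using elim(3) by (simp add: z_def U.trajectory_0 V.trajectory_0)
      show "0 \<le> space_conv J f' (x, s)" for s
        unfolding space_conv_def using U.J_nonneg by (intro integral_nonneg_AE) (auto simp: f'_def)
      show "AE s in lborel. s \<in> {0<..t} \<longrightarrow>
          reaction J m U (x, s) - reaction J m V (x, s) \<le> space_conv J f' (x, s) - f (x, s)"
        using elim(4) by simp
      show "AE s in lborel. s \<in> {0<..t} \<longrightarrow> z x s = 0 \<longrightarrow> f (x, s) = 0"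
        using sign by eventually_elim simp
    qed
    also have "\<dots> = (LINT s|lborel. space_conv J f' (x, s) - f' (x, s))"
      by (intro Bochner_Integration.integral_cong) (auto simp: conv_f' f'_def indicator_def)
    finally show ?case .
  qed
  note bound = this
  have di: "integrable lborel (\<lambda>p. space_conv J f' p - f' p)"
    by (intro Bochner_Integration.integrable_diff f'i space_conv_integrable[OF U.J])
  have zi: "integrable lborel (\<lambda>x. max 0 (z x t))"
    unfolding z_def
    by (intro integrable_max integrable_zero Bochner_Integration.integrable_diff U.trajectory_integrable V.trajectory_integrable)
  have "(LINT x|lborel. max 0 (z x t)) \<le> (LINT x|lborel. LINT s|lborel. space_conv J f' (x, s) - f' (x, s))"
    by (rule integral_mono_AE[OF zi integrable_lborel_fst[OF di] bound])
  also have "\<dots> = 0"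
    unfolding integral_lborel_fst[OF di]
    by (simp add: f'i space_conv_integrable[OF U.J] space_conv_integral[OF U.J] U.J_integral)
  finally have "(LINT x|lborel. max 0 (z x t)) = 0"
    by (intro antisym integral_nonneg_AE) auto
  then have "AE x in lborel. max 0 (z x t) = 0"
    using integral_nonneg_eq_0_iff_AE[OF zi] by simp
  then show ?thesis by eventually_elim (auto simp: z_def max_def split: if_splits)
qed

section \<open>Time scaling and the differential inequality\<close>

lemma borel_measurable_scale_time:
  fixes F :: "'a::euclidean_space \<times> real \<Rightarrow> 'b::topological_space"
  assumes "F \<in> borel_measurable borel"
  shows "(\<lambda>z. F (fst z, c * snd z)) \<in> borel_measurable borel"
  by (rule measurable_compose[OF _ assms]) (intro borel_measurable_continuous_onI continuous_intros)

lemma nn_integral_scale_time: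
  fixes F :: "'a::euclidean_space \<times> real \<Rightarrow> ennreal"
  assumes F[measurable]: "F \<in> borel_measurable borel" and c: "0 < c"
  shows "(\<integral>\<^sup>+z. F z \<partial>lborel) = ennreal c * (\<integral>\<^sup>+z. F (fst z, c * snd z) \<partial>lborel)"
proof -
  have [measurable]: "(\<lambda>z. F (fst z, c * snd z)) \<in> borel_measurable (borel :: ('a \<times> real) measure)"
    by (rule borel_measurable_scale_time[OF F])
  have s: "(\<lambda>t. F (x, t)) \<in> borel_measurable borel" for x
    by (rule measurable_compose[OF _ F]) (intro borel_measurable_continuous_onI continuous_intros)
  have "(\<integral>\<^sup>+z. F z \<partial>lborel) = (\<integral>\<^sup>+x. \<integral>\<^sup>+t. F (x, t) \<partial>lborel \<partial>lborel)"
    by (rule nn_integral_lborel_prod_fst) measurable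
  also have "\<dots> = (\<integral>\<^sup>+x. ennreal c * (\<integral>\<^sup>+t. F (x, c * t) \<partial>lborel) \<partial>lborel)"
    using c by (intro nn_integral_cong, subst nn_integral_real_affine[OF s, of c _ 0]) auto
  also have "\<dots> = ennreal c * (\<integral>\<^sup>+x. \<integral>\<^sup>+t. F (x, c * t) \<partial>lborel \<partial>lborel)"
    by (intro nn_integral_cmult) measurable
  also have "(\<integral>\<^sup>+x. \<integral>\<^sup>+t. F (x, c * t) \<partial>lborel \<partial>lborel) = (\<integral>\<^sup>+z. F (fst z, c * snd z) \<partial>lborel)"
    by (subst nn_integral_lborel_prod_fst) simp_all
  finally show ?thesis .
qed

lemma integrable_scale_time:
  fixes f :: "'a::euclidean_space \<times> real \<Rightarrow> real"
  assumes f: "integrable lborel f" and c: "0 < c"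
  shows "integrable lborel (\<lambda>z. f (fst z, c * snd z))"
proof (rule integrableI_bounded)
  have [measurable]: "f \<in> borel_measurable borel" using f by (simp add: integrable_iff_bounded)
  show "(\<lambda>z. f (fst z, c * snd z)) \<in> borel_measurable lborel"
    by (simp add: borel_measurable_scale_time)
  have "ennreal c * (\<integral>\<^sup>+z. ennreal (norm (f (fst z, c * snd z))) \<partial>lborel) = (\<integral>\<^sup>+z. ennreal (norm (f z)) \<partial>lborel)"
    by (rule nn_integral_scale_time[symmetric, OF _ c]) measurable
  also have "\<dots> < \<infinity>" using f by (simp add: integrable_iff_bounded)
  finally show "(\<integral>\<^sup>+z. ennreal (norm (f (fst z, c * snd z))) \<partial>lborel) < \<infinity>"
    using c by (auto simp: ennreal_mult_less_top ennreal_mult_eq_top_iff less_top)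
qed

lemma AE_scale_time:
  fixes P :: "'a::euclidean_space \<times> real \<Rightarrow> bool"
  assumes P: "AE z in lborel. P z" and c: "0 < c"
  shows "AE z in lborel. P (fst z, c * snd z)"
proof -
  obtain N where N: "N \<in> null_sets lborel" "\<And>z. z \<notin> N \<Longrightarrow> P z"
    using P by (auto elim!: AE_E3)
  have [measurable]: "N \<in> sets borel" using null_setsD2[OF N(1)] by simp
  have "ennreal c * (\<integral>\<^sup>+z. indicator N (fst z, c * snd z) \<partial>lborel) = (\<integral>\<^sup>+z. indicator N z \<partial>lborel)"
    by (rule nn_integral_scale_time[symmetric, OF _ c]) measurable
  also have "\<dots> = 0" using N(1) by (simp add: null_sets_def)
  finally have 0: "(\<integral>\<^sup>+z. indicator N (fst z, c * snd z) \<partial>lborel) = 0" using c by simp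
  have "AE z in lborel. indicator N (fst z, c * snd z) = (0 :: ennreal)"
    using 0 by (subst (asm) nn_integral_0_iff_AE)
      (auto intro: borel_measurable_scale_time[of "indicator N"])
  then show ?thesis by eventually_elim (auto simp: indicator_def intro: N(2) split: if_splits)
qed

context mild_solution
begin

text \<open>If \<open>U\<close> solves the equation then so does \<open>\<lambda> U(x, \<lambda>\<^bsup>m-1\<^esup> t)\<close>; here \<open>c = \<lambda>\<^bsup>m-1\<^esup>\<close>.\<close>

lemma
  assumes c: "0 < c"
  defines "l \<equiv> c powr (1 / (m - 1))"
  shows trajectory_scaled: "trajectory J m (\<lambda>x. l * u0 x) (\<lambda>z. l * U (fst z, c * snd z)) x t
      = l * trajectory J m u0 U x (c * t)"
    and mild_solution_scaled: "mild_solution J m (\<lambda>x. l * u0 x) (\<lambda>z. l * U (fst z, c * snd z))"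
proof -
  let ?V = "\<lambda>z. l * U (fst z, c * snd z)"
  have l: "0 < l" using c by (simp add: l_def)
  have lm: "l powr m = c * l"
  proof -
    have "m / (m - 1) = 1 + 1 / (m - 1)" using m by (simp add: field_simps)
    then show ?thesis using c by (simp add: l_def powr_powr powr_add)
  qed
  have Vm: "?V z powr m = l powr m * U (fst z, c * snd z) powr m" for z
    using l U_nonneg by (simp add: powr_mult)
  have r: "reaction J m ?V (x, s) = l powr m * reaction J m U (x, c * s)" for x s
    unfolding reaction_def Vm by (simp add: space_conv_def mult.left_commute[of _ "l powr m"] right_diff_distrib)
  have tr: "trajectory J m (\<lambda>x. l * u0 x) ?V x t = l * trajectory J m u0 U x (c * t)" for x t
  proof -
    have "(LINT s|lborel. indicator {0<..t} s * reaction J m ?V (x, s))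
        = (LINT s|lborel. l * c * (indicator {0<..c * t} (0 + c * s) * reaction J m U (x, 0 + c * s)))"
      using c by (intro Bochner_Integration.integral_cong) (auto simp: indicator_def r lm mult_le_cancel_left_pos zero_less_mult_iff)
    also have "\<dots> = l * (c * (LINT s|lborel. indicator {0<..c * t} (0 + c * s) * reaction J m U (x, 0 + c * s)))"
      by (simp add: mult.assoc)
    also have "c * (LINT s|lborel. indicator {0<..c * t} (0 + c * s) * reaction J m U (x, 0 + c * s))
        = (LINT s|lborel. indicator {0<..c * t} s * reaction J m U (x, s))"
      using c by (subst (2) lborel_integral_real_affine[of c _ 0]) auto
    finally show ?thesis by (simp add: trajectory_def distrib_left)
  qed
  then show "trajectory J m (\<lambda>x. l * u0 x) ?V x t = l * trajectory J m u0 U x (c * t)" .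
  have ind: "indicator {0<..c * T} (c * s) = (indicator {0<..T} s :: real)" for T s
    using c by (auto simp: indicator_def zero_less_mult_iff)
  show "mild_solution J m (\<lambda>x. l * u0 x) ?V"
  proof unfold_locales
    show "?V \<in> borel_measurable borel"
      by (intro borel_measurable_times borel_measurable_const borel_measurable_scale_time U_measurable)
    show "integrable lborel (\<lambda>z. indicator {0<..T} (snd z) * ?V z)" for T
      using integrable_mult_right[OF integrable_scale_time[OF U_integrable[of "c * T"] c], of l]
      by (simp add: ind mult.left_commute[of _ l])
    show "integrable lborel (\<lambda>z. indicator {0<..T} (snd z) * ?V z powr m)" for T
      using integrable_mult_right[OF integrable_scale_time[OF Um_integrable[of "c * T"] c], of "l powr m"]
      by (simp add: ind Vm mult.left_commute[of _ "l powr m"])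
    show "AE z in lborel. 0 < snd z \<longrightarrow> ?V z = trajectory J m (\<lambda>x. l * u0 x) ?V (fst z) (snd z)"
      using AE_scale_time[OF U_eq c] by eventually_elim (use c in \<open>auto simp: tr\<close>)
  qed (use m J J_nonneg J_integral u0 l U_nonneg in auto)
qed

text \<open>The monotonicity of Benilan and Crandall: \<open>t\<^bsup>1/(m-1)\<^esup> U(x,t)\<close> is nondecreasing in time.\<close>

lemma trajectory_time_monotone:
  assumes nn: "AE x in lborel. 0 \<le> u0 x" and s: "0 < s" "s \<le> t"
  shows "AE x in lborel. trajectory J m u0 U x s \<le> (t / s) powr (1 / (m - 1)) * trajectory J m u0 U x t"
proof -
  have c: "0 < t / s" "1 \<le> t / s" using s by auto
  let ?l = "(t / s) powr (1 / (m - 1))"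
  have "1 \<le> ?l" using c m by (simp add: ge_one_powr_ge_zero)
  then have "u \<le> ?l * u" if "0 \<le> u" for u
    using mult_right_mono[of 1 ?l u] that by simp
  then have "AE x in lborel. u0 x \<le> ?l * u0 x"
    using nn by (auto elim!: eventually_mono)
  from mild_solution_comparison[OF mild_solution_axioms mild_solution_scaled[OF c(1)] this s(1)]
  show ?thesis using s unfolding trajectory_scaled[OF c(1)] by simp
qed

lemma AE_trajectory_time_monotone:
  assumes nn: "AE x in lborel. 0 \<le> u0 x" and s: "0 < s"
  shows "AE x in lborel. AE \<tau> in lborel. s \<le> \<tau> \<longrightarrow>
    trajectory J m u0 U x s \<le> (\<tau> / s) powr (1 / (m - 1)) * trajectory J m u0 U x \<tau>"
proof -
  let ?P = "\<lambda>z. s \<le> snd z \<longrightarrow>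
    trajectory J m u0 U (fst z) s \<le> (snd z / s) powr (1 / (m - 1)) * trajectory J m u0 U (fst z) (snd z)"
  have [measurable]: "(\<lambda>z. trajectory J m u0 U (fst z) s) \<in> borel_measurable (borel :: ('a \<times> real) measure)"
  proof -
    have "(\<lambda>z. (fst z, s)) \<in> borel_measurable (borel :: ('a \<times> real) measure)"
      by (intro borel_measurable_continuous_onI continuous_intros)
    from measurable_compose[OF this trajectory_measurable] show ?thesis by simp
  qed
  have [measurable]: "snd \<in> borel_measurable (borel :: ('a \<times> real) measure)"
    by (intro borel_measurable_continuous_onI continuous_intros)
  have "AE z in lborel. ?P z"
  proof (rule AE_lborel_prodI)
    show "Measurable.pred borel ?P" by measurable
    show "AE t in lborel. AE x in lborel. ?P (x, t)"
    proof (rule AE_I2)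
      fix t :: real
      show "AE x in lborel. ?P (x, t)"
        by (cases "s \<le> t") (use trajectory_time_monotone[OF nn s, of t] in auto)
    qed
  qed
  from AE_lborel_prod_fst[OF this] show ?thesis by simp
qed

text \<open>
  The integrand is nonnegative in the mean over every time interval: the monotonicity bounds
  the decrease of the trajectory by the integral of \<open>U/((m-1)\<tau>)\<close>.
\<close>

lemma integral_differential_inequality:
  assumes nn: "AE x in lborel. 0 \<le> u0 x" and st: "0 < s" "s < t"
  shows "AE x in lborel. 0 \<le> (LINT \<tau>|lborel. indicator {s<..t} \<tau> * (reaction J m U (x, \<tau>) + U (x, \<tau>) / ((m - 1) * \<tau>)))"
  using AE_regular_at AE_trajectory_time_monotone[OF nn st(1)] trajectory_time_monotone[OF nn st(1) less_imp_le[OF st(2)]]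
    AE_lborel_prod_fst[OF U_eq] AE_integrable_lborel_fst[OF U_integrable[of t]]
proof eventually_elim
  case (elim x)
  let ?a = "1 / (m - 1)" and ?r = "trajectory J m u0 U x"
  have a: "0 < ?a" using m by simp
  have int_r: "integrable lborel (\<lambda>\<tau>. indicator {s<..t} \<tau> * reaction J m U (x, \<tau>))"
    using elim(1) st by (auto simp: regular_at_def intro: integrable_subinterval)
  have int_U: "integrable lborel (\<lambda>\<tau>. indicator {s<..t} \<tau> * (U (x, \<tau>) / ((m - 1) * \<tau>)))"
  proof (rule Bochner_Integration.integrable_bound)
    show "integrable lborel (\<lambda>\<tau>. (1 / ((m - 1) * s)) * (indicator {0<..t} \<tau> * U (x, \<tau>)))"
      using elim(5) by simp
    show "(\<lambda>\<tau>. indicator {s<..t} \<tau> * (U (x, \<tau>) / ((m - 1) * \<tau>))) \<in> borel_measurable lborel"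
      using borel_measurable_sections(2)[OF U_measurable, of x] by measurable
    show "AE \<tau> in lborel. norm (indicator {s<..t} \<tau> * (U (x, \<tau>) / ((m - 1) * \<tau>)))
        \<le> norm (1 / ((m - 1) * s) * (indicator {0<..t} \<tau> * U (x, \<tau>)))"
      using m st U_nonneg
      by (intro AE_I2) (auto simp: indicator_def abs_mult intro!: divide_left_mono mult_left_mono mult_pos_pos)
  qed
  have FTC: "has_bochner_integral lborel (\<lambda>\<tau>. indicator {s..t} \<tau> *\<^sub>R ((s / \<tau>) powr ?a * (?a / \<tau>)))
      (- ((s / t) powr ?a) - (- ((s / s) powr ?a)))"
  proof (rule has_bochner_integral_FTC_Icc)
    show "((\<lambda>\<tau>. - ((s / \<tau>) powr ?a)) has_vector_derivative (s / \<tau>) powr ?a * (?a / \<tau>)) (at \<tau> within {s..t})"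
      if "s \<le> \<tau>" "\<tau> \<le> t" for \<tau>
    proof -
      have \<tau>: "0 < \<tau>" using st that by simp
      have "((\<lambda>\<tau>. - ((s / \<tau>) powr a)) has_real_derivative (s / \<tau>) powr a * (a / \<tau>)) (at \<tau>)" for a
        using \<tau> st by (auto intro!: derivative_eq_intros simp: powr_diff power2_eq_square field_simps)
      from this[of ?a] show ?thesis
        by (simp add: has_real_derivative_iff_has_vector_derivative has_vector_derivative_at_within)
    qed
    show "continuous_on {s..t} (\<lambda>\<tau>. (s / \<tau>) powr ?a * (?a / \<tau>))"
      using st by (intro continuous_intros) auto
  qed (use st in simp)
  have "?r s * (1 - (s / t) powr ?a) = ?r s * (LINT \<tau>|lborel. indicator {s..t} \<tau> * ((s / \<tau>) powr ?a * (?a / \<tau>)))"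
    using has_bochner_integral_integral_eq[OF FTC] st by simp
  also have "\<dots> = (LINT \<tau>|lborel. ?r s * (indicator {s..t} \<tau> * ((s / \<tau>) powr ?a * (?a / \<tau>))))"
    by (rule integral_mult_right_zero[symmetric])
  (* the monotonicity bounds U(x,\<tau>) from below by r(s) (s/\<tau>)^a *)
  also have "\<dots> \<le> (LINT \<tau>|lborel. indicator {s<..t} \<tau> * (U (x, \<tau>) / ((m - 1) * \<tau>)))"
  proof (rule integral_mono_AE[OF _ int_U])
    show "integrable lborel (\<lambda>\<tau>. ?r s * (indicator {s..t} \<tau> * ((s / \<tau>) powr ?a * (?a / \<tau>))))"
      using integrable.intros[OF FTC] unfolding real_scaleR_def by (rule integrable_mult_right)
    show "AE \<tau> in lborel. ?r s * (indicator {s..t} \<tau> * ((s / \<tau>) powr ?a * (?a / \<tau>)))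
        \<le> indicator {s<..t} \<tau> * (U (x, \<tau>) / ((m - 1) * \<tau>))"
      using elim(2,4) AE_lborel_singleton[of s]
    proof eventually_elim
      case (elim \<tau>)
      show ?case
      proof (cases "\<tau> \<in> {s<..t}")
        case True
        then have \<tau>: "0 < \<tau>" "s < \<tau>" using st by auto
        have "?r s * (s / \<tau>) powr ?a \<le> ((\<tau> / s) powr ?a * ?r \<tau>) * (s / \<tau>) powr ?a"
          using elim(1) \<tau> by (intro mult_right_mono) auto
        also have "\<dots> = U (x, \<tau>)"
          using elim(2) \<tau> st by (simp add: powr_divide)
        finally have "(?r s * (s / \<tau>) powr ?a) * (?a / \<tau>) \<le> U (x, \<tau>) * (?a / \<tau>)"
          using a \<tau> by (intro mult_right_mono) auto
        then show ?thesis using True by (simp add: mult_ac)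
      next
        case False
        then show ?thesis using elim(3) by (auto simp: indicator_def)
      qed
    qed
  qed
  finally have U: "?r s * (1 - (s / t) powr ?a) \<le> (LINT \<tau>|lborel. indicator {s<..t} \<tau> * (U (x, \<tau>) / ((m - 1) * \<tau>)))" .
  have "?r s * (s / t) powr ?a \<le> ((t / s) powr ?a * ?r t) * (s / t) powr ?a"
    using elim(3) by (intro mult_right_mono) auto
  also have "\<dots> = ?r t" using st by (simp add: powr_divide)
  finally have "?r s * (s / t) powr ?a \<le> ?r t" .
  with U have "0 \<le> (?r t - ?r s) + (LINT \<tau>|lborel. indicator {s<..t} \<tau> * (U (x, \<tau>) / ((m - 1) * \<tau>)))"
    by (simp add: algebra_simps)
  also have "?r t - ?r s = (LINT \<tau>|lborel. indicator {s<..t} \<tau> * reaction J m U (x, \<tau>))"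
    using st by (intro trajectory_increment elim(1)) auto
  also have "(LINT \<tau>|lborel. indicator {s<..t} \<tau> * reaction J m U (x, \<tau>)) + (LINT \<tau>|lborel. indicator {s<..t} \<tau> * (U (x, \<tau>) / ((m - 1) * \<tau>)))
      = (LINT \<tau>|lborel. indicator {s<..t} \<tau> * (reaction J m U (x, \<tau>) + U (x, \<tau>) / ((m - 1) * \<tau>)))"
    using int_r int_U by (simp add: distrib_left)
  finally show ?case .
qed

text \<open>The pointwise form of the monotonicity, \<open>\<partial>\<^sub>t U \<ge> - U/((m-1)t)\<close>, with \<open>\<partial>\<^sub>t U\<close> expressed by the equation.\<close>

lemma differential_inequality:
  assumes nn: "AE x in lborel. 0 \<le> u0 x"
  shows "AE z in lborel. 0 < snd z \<longrightarrow>
    U z powr m \<le> space_conv J (\<lambda>z. U z powr m) z + U z / ((m - 1) * snd z)"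
proof -
  define h where "h z = reaction J m U z + U z / ((m - 1) * snd z)" for z
  have [measurable]: "snd \<in> borel_measurable (borel :: ('a \<times> real) measure)"
    by (intro borel_measurable_continuous_onI continuous_intros)
  have h_meas[measurable]: "h \<in> borel_measurable borel" unfolding h_def[abs_def] by measurable
  have "AE z in lborel. 0 \<le> indicator {1 / real (Suc n)<..real (Suc n)} (snd z) * h z" for n
  proof (rule AE_nonneg_if_box_integrals_nonneg)
    define N where "N = real (Suc n)"
    have N: "0 < N" by (simp add: N_def)
    have "integrable lborel (\<lambda>z. indicator {1 / N<..N} (snd z) * (indicator {0<..N} (snd z) * reaction J m U z)
        + indicator {1 / N<..N} (snd z) * (U z / ((m - 1) * snd z)))"
    proof (rule Bochner_Integration.integrable_add)
      show "integrable lborel (\<lambda>z. indicator {1 / N<..N} (snd z) * (indicator {0<..N} (snd z) * reaction J m U z))"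
        by (rule Bochner_Integration.integrable_bound[OF reaction_integrable[of N]]) (auto simp: indicator_def)
      show "integrable lborel (\<lambda>z. indicator {1 / N<..N} (snd z) * (U z / ((m - 1) * snd z)))"
      proof (rule Bochner_Integration.integrable_bound)
        show "integrable lborel (\<lambda>z. (N / (m - 1)) * (indicator {0<..N} (snd z) * U z))"
          using U_integrable[of N] by simp
        have "U z / ((m - 1) * s) \<le> N * U z / (m - 1)" if "1 / N < s" for z s
        proof -
          have "0 < 1 / N" using N by simp
          then have "0 < s" using that by linarith
          moreover have "1 < s * N" using that N by (simp add: divide_less_eq)
          ultimately have "1 / s \<le> N" by (simp add: divide_le_eq mult.commute)
          from mult_left_mono[OF this, of "U z / (m - 1)"] show ?thesis using U_nonneg m by (simp add: mult_ac)
        qed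
        moreover have "0 < s" if "1 / N < s" for s
          using that N by (meson divide_pos_pos less_trans zero_less_one)
        ultimately show "AE z in lborel. norm (indicator {1 / N<..N} (snd z) * (U z / ((m - 1) * snd z)))
            \<le> norm (N / (m - 1) * (indicator {0<..N} (snd z) * U z))"
          using m N U_nonneg by (intro AE_I2) (auto simp: indicator_def abs_mult)
      qed measurable
    qed
    also have "(\<lambda>z. indicator {1 / N<..N} (snd z) * (indicator {0<..N} (snd z) * reaction J m U z)
        + indicator {1 / N<..N} (snd z) * (U z / ((m - 1) * snd z))) = (\<lambda>z. indicator {1 / N<..N} (snd z) * h z)"
    proof
      fix z :: "'a \<times> real"
      have "0 < snd z" if "1 / N < snd z" using that N by (meson divide_pos_pos less_trans zero_less_one)
      then show "indicator {1 / N<..N} (snd z) * (indicator {0<..N} (snd z) * reaction J m U z)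
        + indicator {1 / N<..N} (snd z) * (U z / ((m - 1) * snd z)) = indicator {1 / N<..N} (snd z) * h z"
        by (auto simp: indicator_def h_def)
    qed
    finally show int: "integrable lborel (\<lambda>z. indicator {1 / real (Suc n)<..real (Suc n)} (snd z) * h z)"
      by (simp add: N_def)
    fix p q :: "'a \<times> real"
    define s where "s = max (snd p) (1 / N)"
    define t where "t = min (snd q) N"
    have s: "0 < s" using N by (simp add: s_def less_max_iff_disj)
    let ?g = "\<lambda>z. indicator (box p q) z * (indicator {1 / N<..N} (snd z) * h z)"
    have gi: "integrable lborel ?g"
      using integrable_mult_indicator[OF _ int, of "box p q"] by (simp add: N_def)
    have "AE x in lborel. 0 \<le> (LINT \<tau>|lborel. ?g (x, \<tau>))"
    proof -
      have g: "AE \<tau> in lborel. ?g (x, \<tau>) = indicator (box (fst p) (fst q)) x * (indicator {s<..t} \<tau> * h (x, \<tau>))" for x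
        using AE_lborel_singleton[of t]
      proof eventually_elim
        case (elim \<tau>)
        have "(x, \<tau>) \<in> box p q \<and> \<tau> \<in> {1 / N<..N} \<longleftrightarrow> x \<in> box (fst p) (fst q) \<and> \<tau> \<in> {s<..t}"
          using elim by (auto simp: s_def t_def box_prod[of p q] box_real)
        then show ?case unfolding indicator_def by auto
      qed
      have [measurable]: "(\<lambda>\<tau>. h (x, \<tau>)) \<in> borel_measurable borel" for x
        by (rule borel_measurable_sections) simp
      have [measurable]: "(\<lambda>\<tau>. ?g (x, \<tau>)) \<in> borel_measurable borel" for x
        using borel_measurable_integrable[OF gi] by (intro borel_measurable_sections) simp
      have g': "(LINT \<tau>|lborel. ?g (x, \<tau>)) = indicator (box (fst p) (fst q)) x * (LINT \<tau>|lborel. indicator {s<..t} \<tau> * h (x, \<tau>))" for x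
        by (subst integral_cong_AE[OF _ _ g]) simp_all
      have "AE x in lborel. 0 \<le> (LINT \<tau>|lborel. indicator {s<..t} \<tau> * h (x, \<tau>))"
      proof (cases "s < t")
        case True
        from integral_differential_inequality[OF nn s this] show ?thesis by (simp add: h_def)
      qed simp
      then show ?thesis unfolding g' by eventually_elim simp
    qed
    then have "0 \<le> (LINT x|lborel. LINT \<tau>|lborel. ?g (x, \<tau>))" by (rule integral_nonneg_AE)
    also have "\<dots> = integral\<^sup>L lborel ?g" by (rule integral_lborel_fst[OF gi])
    finally show "0 \<le> (LINT z:box p q|lborel. indicator {1 / real (Suc n)<..real (Suc n)} (snd z) * h z)"
      by (simp add: set_lebesgue_integral_def N_def)
  qed
  then have "AE z in lborel. \<forall>n. 0 \<le> indicator {1 / real (Suc n)<..real (Suc n)} (snd z) * h z"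
    by (simp add: AE_all_countable)
  then show ?thesis
  proof eventually_elim
    case (elim z)
    show ?case
    proof
      assume z: "0 < snd z"
      obtain n :: nat where n: "max (snd z) (1 / snd z) < real n" using reals_Archimedean2 by blast
      then have "1 / real (Suc n) < snd z" "snd z \<le> real (Suc n)"
        using z by (auto simp: field_simps)
      then have "0 \<le> h z" using elim[rule_format, of n] by (simp add: indicator_def)
      then show "U z powr m \<le> space_conv J (\<lambda>z. U z powr m) z + U z / ((m - 1) * snd z)"
        by (simp add: h_def reaction_def)
    qed
  qed
qed

end

section \<open>From the differential inequality to the supremum bound\<close>

lemma
  fixes F :: "'a::euclidean_space \<Rightarrow> real"
  assumes F: "integrable lborel F"
  shows integrable_lborel_reflect: "integrable lborel (\<lambda>y. F (x - y))"
    and integral_lborel_reflect: "(LINT y|lborel. F (x - y)) = (LINT y|lborel. F y)"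
proof -
  have [measurable]: "F \<in> borel_measurable borel" using F by (simp add: integrable_iff_bounded)
  show "integrable lborel (\<lambda>y. F (x - y))"
    using integrable_distr[of "\<lambda>y. x - y" lborel borel F] F unfolding lborel_reflect by simp
  have "(LINT y|lborel. F y) = (LINT y|distr lborel borel (\<lambda>y. x - y). F y)"
    by (simp only: lborel_reflect)
  also have "\<dots> = (LINT y|lborel. F (x - y))"
    by (subst integral_distr) simp_all
  finally show "(LINT y|lborel. F (x - y)) = (LINT y|lborel. F y)" by simp
qed

text \<open>
  An integrable kernel is a bounded one plus one of small \<open>L\<^sup>1\<close> norm. The bounded part maps \<open>L\<^sup>1\<close> to
  \<open>L\<^sup>\<infinity>\<close>, and the small one is absorbed: the \<open>L\<^sup>1\<close> norm of the excess of \<open>v\<^sup>m\<close> over a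
  large constant is at most half of itself, so the excess vanishes.
\<close>

lemma AE_bounded_of_inequality:
  fixes J v :: "'a::euclidean_space \<Rightarrow> real"
  assumes m: "1 < m" and b: "0 < b"
    and J: "integrable lborel J" "\<And>x. 0 \<le> J x"
    and v: "v \<in> borel_measurable borel" "\<And>x. 0 \<le> v x" and vm: "integrable lborel (\<lambda>x. v x powr m)"
    and le: "AE x in lborel. v x powr m \<le> (LINT y|lborel. J (x - y) * v y powr m) + v x / b"
  shows "\<exists>K. AE x in lborel. v x \<le> K"
proof -
  have [measurable]: "J \<in> borel_measurable borel" using J by (simp add: integrable_iff_bounded)
  note v(1)[measurable]
  define J2 where "J2 k x = (if J x \<le> real k then 0 else J x)" for k x
  have J2_meas[measurable]: "J2 k \<in> borel_measurable borel" for k unfolding J2_def by measurable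
  have J2_int: "integrable lborel (J2 k)" for k
    by (rule Bochner_Integration.integrable_bound[OF J(1)]) (auto simp: J2_def)
  have "(\<lambda>k. LINT x|lborel. J2 k x) \<longlonglongrightarrow> (LINT x::'a|lborel. 0)"
  proof (rule integral_dominated_convergence[where w = J])
    show "AE x in lborel. (\<lambda>k. J2 k x) \<longlonglongrightarrow> 0"
    proof (intro AE_I2 tendsto_eventually)
      fix x
      obtain n :: nat where "J x \<le> real n" using real_arch_simple by blast
      then show "\<forall>\<^sub>F k in sequentially. J2 k x = 0"
        by (auto simp: J2_def eventually_sequentially intro!: exI[of _ n])
    qed
  qed (use J in \<open>auto simp: J2_def\<close>)
  then have "\<forall>\<^sub>F k in sequentially. (LINT x|lborel. J2 k x) < 1 / 4"
    by (intro order_tendstoD(2)) auto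
  then obtain k where k: "(LINT x|lborel. J2 k x) < 1 / 4" by (auto simp: eventually_sequentially)
  let ?w = "\<lambda>x. v x powr m" and ?\<epsilon> = "LINT x|lborel. J2 k x"
  have \<epsilon>: "0 \<le> ?\<epsilon>" using J(2) by (intro integral_nonneg_AE) (auto simp: J2_def)
  define c where "c = (2 / b) powr (1 / (m - 1)) / b"
  (* the linear term is absorbed into half of the power; c is its value at the crossover *)
  have Young: "s / b \<le> s powr m / 2 + c" if "0 \<le> s" for s
  proof (cases "s \<le> (2 / b) powr (1 / (m - 1))")
    case True
    then have "s / b \<le> c" using b by (simp add: c_def divide_right_mono)
    then show ?thesis by (simp add: add_increasing)
  next
    case False
    then have s: "0 < s" by (smt (verit) powr_ge_zero)
    have "2 / b = ((2 / b) powr (1 / (m - 1))) powr (m - 1)" using m b by (simp add: powr_powr)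
    also have "\<dots> \<le> s powr (m - 1)" using False m by (intro powr_mono2) auto
    finally have "s * (2 / b) \<le> s * s powr (m - 1)" using s by (intro mult_left_mono) auto
    also have "\<dots> = s powr m" using s by (simp add: powr_diff)
    finally show ?thesis using b by (simp add: c_def add_increasing2)
  qed
  have c: "0 \<le> c" using b by (simp add: c_def)
  define D where "D = 2 * (real k * (LINT y|lborel. ?w y) + c)"
  have D: "0 \<le> D" unfolding D_def using c by simp
  (* the excess over 2 D: a kernel of mass at most 1/4 maps the constant 2 D to at most D/2, which leaves room *)
  define e where "e x = max 0 (?w x - 2 * D)" for x
  have e_int: "integrable lborel e"
    by (rule Bochner_Integration.integrable_bound[OF vm]) (use D in \<open>auto simp: e_def[abs_def]\<close>)
  have e_le: "AE x in lborel. e x \<le> 2 * (LINT y|lborel. J2 k (x - y) * e y)"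
    using le convolution_AE_integrable[OF J(1) vm] convolution_AE_integrable[OF J2_int[of k] vm]
      convolution_AE_integrable[OF J2_int[of k] e_int]
  proof eventually_elim
    case (elim x)
    let ?I = "LINT y|lborel. J2 k (x - y) * e y"
    have I: "0 \<le> ?I" using J(2) by (intro integral_nonneg_AE) (auto simp: J2_def e_def)
    have J2x: "integrable lborel (\<lambda>y. J2 k (x - y))"
      by (rule integrable_lborel_reflect[OF J2_int])
    have "(LINT y|lborel. J (x - y) * ?w y)
        \<le> (LINT y|lborel. real k * ?w y + (J2 k (x - y) * (2 * D) + J2 k (x - y) * e y))"
    proof (rule integral_mono)
      show "integrable lborel (\<lambda>y. J (x - y) * ?w y)" by (rule elim)
      show "integrable lborel (\<lambda>y. real k * ?w y + (J2 k (x - y) * (2 * D) + J2 k (x - y) * e y))"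
        using vm elim(4) J2x by simp
      fix y
      show "J (x - y) * ?w y \<le> real k * ?w y + (J2 k (x - y) * (2 * D) + J2 k (x - y) * e y)"
      proof (cases "J (x - y) \<le> real k")
        case True
        then show ?thesis by (simp add: J2_def mult_right_mono)
      next
        case False
        have "J (x - y) * ?w y \<le> J (x - y) * (2 * D + e y)"
          using J(2) by (intro mult_left_mono) (auto simp: e_def)
        also have "\<dots> = J2 k (x - y) * (2 * D) + J2 k (x - y) * e y"
          using False by (simp add: J2_def distrib_left)
        finally show ?thesis by (simp add: add_increasing)
      qed
    qed
    also have "\<dots> = real k * (LINT y|lborel. ?w y) + (?\<epsilon> * (2 * D) + ?I)"
      using vm elim(4) J2x by (simp add: integral_lborel_reflect[OF J2_int])
    also have "\<dots> \<le> real k * (LINT y|lborel. ?w y) + (1 / 4 * (2 * D) + ?I)"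
      using k D by (intro add_mono mult_right_mono) auto
    finally have "?w x \<le> real k * (LINT y|lborel. ?w y) + (1 / 4 * (2 * D) + ?I) + (?w x / 2 + c)"
      using elim(1) Young[OF v(2)[of x]] by linarith
    moreover have "w \<le> P + (1 / 4 * (2 * D) + I) + (w / 2 + c) \<Longrightarrow> D = 2 * (P + c) \<Longrightarrow> w \<le> 2 * D + 2 * I"
      for w P I :: real by (simp add: field_simps)
    ultimately have "?w x \<le> 2 * D + 2 * ?I" using D_def by blast
    then show ?case using I by (simp add: e_def)
  qed
  have "(LINT x|lborel. e x) \<le> (LINT x|lborel. 2 * (LINT y|lborel. J2 k (x - y) * e y))"
    using convolution_integrable[OF J2_int e_int] by (intro integral_mono_AE e_int e_le) simp
  also have "\<dots> = 2 * ?\<epsilon> * (LINT x|lborel. e x)"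
    by (simp add: convolution_integral[OF J2_int e_int])
  finally have le': "(LINT x|lborel. e x) \<le> 2 * ?\<epsilon> * (LINT x|lborel. e x)" .
  have e0: "0 \<le> (LINT x|lborel. e x)" by (intro integral_nonneg_AE) (auto simp: e_def)
  have "2 * ?\<epsilon> * (LINT x|lborel. e x) \<le> 1 / 2 * (LINT x|lborel. e x)"
    using k e0 by (intro mult_right_mono) auto
  with le' e0 have "(LINT x|lborel. e x) = 0" by simp
  moreover have "AE x in lborel. 0 \<le> e x" by (simp add: e_def)
  ultimately have "AE x in lborel. e x = 0"
    using integral_nonneg_eq_0_iff_AE[OF e_int] by simp
  then have "AE x in lborel. v x \<le> (2 * D) powr (1 / m)"
  proof eventually_elim
    case (elim x)
    then have "?w x \<le> 2 * D" by (simp add: e_def max_def split: if_splits)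
    then have "?w x powr (1 / m) \<le> (2 * D) powr (1 / m)" using m by (intro powr_mono2) auto
    then show ?case using m v(2)[of x] by (simp add: powr_powr)
  qed
  then show ?thesis by blast
qed

text \<open>
  Hoelder's inequality for \<open>J * v\<^sup>m\<close>, combined with the interpolation
  \<open>\<parallel>v\<^sup>m\<parallel>\<^sub>q \<le> M\<^bsup>1/q\<^esup> K\<^bsup>m-1/q\<^esup>\<close> of \<open>v\<close> between its mass \<open>M\<close> and its bound \<open>K\<close>.
\<close>

lemma convolution_powr_bound:
  fixes J v :: "'a::euclidean_space \<Rightarrow> real"
  assumes m: "1 < m" and p: "1 < p" and q: "q = p / (p - 1)"
    and J: "\<And>x. 0 \<le> J x" "integrable lborel (\<lambda>x. J x powr p)" "(LINT x|lborel. J x powr p) \<le> C powr p"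
    and v: "\<And>x. 0 \<le> v x" "integrable lborel v" "(LINT x|lborel. v x) \<le> M" "AE x in lborel. v x \<le> K"
    and pos: "0 < C" "0 < M" "0 < K"
  shows "(LINT y|lborel. J (x - y) * v y powr m) \<le> C * M powr (1 / q) * K powr (m - 1 / q)"
proof -
  define B where "B = M powr (1 / q) * K powr (m - 1 / q)"
  have B: "0 < B" using pos by (simp add: B_def)
  have q1: "1 < q" "1 / p + 1 / q = 1" using p by (auto simp: q field_simps)
  let ?g = "\<lambda>y. C * B * (J (x - y) powr p / C powr p / p + v y / M / q)"
  have Jx: "integrable lborel (\<lambda>y. J (x - y) powr p)"
    by (rule integrable_lborel_reflect[OF J(2)])
  have "(LINT y|lborel. J (x - y) * v y powr m) \<le> (LINT y|lborel. ?g y)"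
  proof (rule integral_mono_AE')
    show "integrable lborel ?g" using Jx v(2) by simp
    show "AE y in lborel. 0 \<le> ?g y"
      using p q1 pos B v(1) by (intro AE_I2 mult_nonneg_nonneg add_nonneg_nonneg divide_nonneg_nonneg) auto
    show "AE y in lborel. J (x - y) * v y powr m \<le> ?g y"
      using v(4)
    proof eventually_elim
      case (elim y)
      have "(v y powr m) powr q \<le> v y * K powr (m * q - 1)"
      proof (cases "v y = 0")
        case False
        then have vy: "0 < v y" using v(1)[of y] by simp
        have mq: "1 < m * q" using m q1 by (simp add: less_1_mult)
        have "(v y powr m) powr q = v y * v y powr (m * q - 1)"
          using vy by (simp add: powr_powr powr_diff)
        also have "\<dots> \<le> v y * K powr (m * q - 1)"
          using vy elim mq by (intro mult_left_mono powr_mono2) auto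
        finally show ?thesis .
      qed simp
      moreover have "B powr q = M * K powr (m * q - 1)"
        using pos q1 by (simp add: B_def powr_mult powr_powr left_diff_distrib)
      moreover have "(v y powr m / B) powr q = (v y powr m) powr q / B powr q"
        using B by (simp add: powr_divide)
      ultimately have "(v y powr m / B) powr q \<le> v y * K powr (m * q - 1) / (M * K powr (m * q - 1))"
        using pos by (metis divide_right_mono mult_nonneg_nonneg less_imp_le powr_ge_zero)
      also have "\<dots> = v y / M" using pos by simp
      finally have 1: "(v y powr m / B) powr q / q \<le> v y / M / q" using q1 by (intro divide_right_mono) auto
      have "J (x - y) / C * (v y powr m / B) \<le> (J (x - y) / C) powr p / p + (v y powr m / B) powr q / q"
        using p q1 pos B J(1) by (intro Youngs_inequality) auto
      also have "\<dots> \<le> J (x - y) powr p / C powr p / p + v y / M / q"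
        using 1 pos J(1) by (simp add: powr_divide)
      finally have "C * B * (J (x - y) / C * (v y powr m / B)) \<le> ?g y"
        using pos B by (intro mult_left_mono) auto
      then show ?case using pos B by simp
    qed
  qed
  also have "(LINT y|lborel. ?g y)
      = C * B * ((LINT y|lborel. J y powr p) / C powr p / p + (LINT y|lborel. v y) / M / q)"
    using Jx v(2) by (simp add: integral_lborel_reflect[OF J(2)])
  also have "\<dots> \<le> C * B * (1 / p + 1 / q)"
  proof -
    have "(LINT y|lborel. J y powr p) / C powr p \<le> 1" "(LINT y|lborel. v y) / M \<le> 1"
      using J(3) v(3) pos by simp_all
    then show ?thesis using p q1 pos B by (intro mult_left_mono add_mono divide_right_mono) auto
  qed
  finally show ?thesis using q1 by (simp add: B_def mult.assoc)
qed

lemma convolution_sup_bound: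
  fixes J v :: "'a::euclidean_space \<Rightarrow> real"
  assumes m: "1 < m"
    and J: "\<And>x. 0 \<le> J x" "AE x in lborel. J x \<le> C"
    and v: "\<And>x. 0 \<le> v x" "integrable lborel v" "(LINT x|lborel. v x) \<le> M" "AE x in lborel. v x \<le> K"
    and pos: "0 < C" "0 < M" "0 < K"
  shows "(LINT y|lborel. J (x - y) * v y powr m) \<le> C * M * K powr (m - 1)"
proof -
  have "(LINT y|lborel. J (x - y) * v y powr m) \<le> (LINT y|lborel. C * K powr (m - 1) * v y)"
  proof (rule integral_mono_AE')
    show "integrable lborel (\<lambda>y. C * K powr (m - 1) * v y)" using v(2) by simp
    show "AE y in lborel. 0 \<le> C * K powr (m - 1) * v y" using v(1) pos by simp
    show "AE y in lborel. J (x - y) * v y powr m \<le> C * K powr (m - 1) * v y"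
      using v(4) AE_lborel_reflect[OF J(2), of x]
    proof eventually_elim
      case (elim y)
      have "v y powr m = v y powr (m - 1) * v y" using v(1)[of y] by (cases "v y = 0") (auto simp: powr_diff)
      also have "\<dots> \<le> K powr (m - 1) * v y" using elim v(1)[of y] m by (intro mult_right_mono powr_mono2) auto
      finally have "J (x - y) * v y powr m \<le> C * (K powr (m - 1) * v y)"
        using elim J(1) pos by (intro mult_mono) auto
      then show ?case by (simp add: mult.assoc)
    qed
  qed
  also have "\<dots> = C * K powr (m - 1) * (LINT y|lborel. v y)" by simp
  also have "\<dots> \<le> C * K powr (m - 1) * M" using pos v(3) by (intro mult_left_mono) auto
  finally show ?thesis by (simp add: mult_ac)
qed

lemma least_AE_bound:
  fixes v :: "'a \<Rightarrow> real"
  assumes bdd: "AE x in N. v x \<le> K" and pos: "\<not> (AE x in N. v x \<le> 0)" and nn: "\<And>x. 0 \<le> v x"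
  obtains L where "0 < L" "AE x in N. v x \<le> L" "\<And>L'. AE x in N. v x \<le> L' \<Longrightarrow> L \<le> L'"
proof -
  define S where "S = {L. AE x in N. v x \<le> L}"
  have S0: "0 < L" if "L \<in> S" for L
  proof (rule ccontr)
    assume "\<not> 0 < L"
    then have "AE x in N. v x \<le> 0" using that unfolding S_def by (auto elim!: eventually_mono)
    with pos show False by blast
  qed
  have bb: "bdd_below S" using S0 by (intro bdd_belowI[of _ 0]) (auto intro: less_imp_le)
  have ne: "K \<in> S" using bdd by (simp add: S_def)
  have "AE x in N. v x \<le> Inf S + inverse (real (Suc n))" for n
  proof -
    have "Inf S < Inf S + inverse (real (Suc n))" by simp
    then obtain L where "L \<in> S" "L < Inf S + inverse (real (Suc n))"
      using cInf_less_iff[of S] ne bb by blast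
    then show ?thesis unfolding S_def by (auto elim!: eventually_mono)
  qed
  then have "AE x in N. \<forall>n. v x \<le> Inf S + inverse (real (Suc n))" by (simp add: AE_all_countable)
  then have "AE x in N. v x \<le> Inf S"
  proof eventually_elim
    case (elim x)
    have "(\<lambda>n. Inf S + inverse (real (Suc n))) \<longlonglongrightarrow> Inf S + 0"
      by (intro tendsto_intros LIMSEQ_inverse_real_of_nat)
    from LIMSEQ_le_const[OF this, of "v x"] show ?case using elim by auto
  qed
  moreover from this have "Inf S \<in> S" by (simp add: S_def)
  ultimately show ?thesis
    using that[of "Inf S"] S0 cInf_lower[OF _ bb] by (auto simp: S_def)
qed

text \<open>
  The bound \<open>max ((2C)\<^sup>q M) ((2/b)\<^bsup>1/(m-1)\<^esup>)\<close>: were the essential supremum \<open>K\<close> larger, each of the two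
  terms on the right of the inequality would be less than half of \<open>K\<^sup>m\<close>.
\<close>

lemma AE_le_max_of_inequality:
  fixes J v :: "'a::euclidean_space \<Rightarrow> real"
  assumes m: "1 < m" and b: "0 < b" and q: "1 \<le> q" and C: "0 < C" and M: "0 < M"
    and J: "integrable lborel J" "\<And>x. 0 \<le> J x"
    and v: "v \<in> borel_measurable borel" "\<And>x. 0 \<le> v x" and vm: "integrable lborel (\<lambda>x. v x powr m)"
    and le: "AE x in lborel. v x powr m \<le> (LINT y|lborel. J (x - y) * v y powr m) + v x / b"
    and conv: "\<And>x K. 0 < K \<Longrightarrow> AE x in lborel. v x \<le> K \<Longrightarrow>
      (LINT y|lborel. J (x - y) * v y powr m) \<le> C * M powr (1 / q) * K powr (m - 1 / q)"
  shows "AE x in lborel. v x \<le> max ((2 * C) powr q * M) ((2 / b) powr (1 / (m - 1)))"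
proof (cases "AE x in lborel. v x \<le> 0")
  case True
  then show ?thesis by eventually_elim (simp add: le_max_iff_disj order_trans[OF _ powr_ge_zero])
next
  case False
  obtain K0 where "AE x in lborel. v x \<le> K0"
    using AE_bounded_of_inequality[OF m b J v vm le] by blast
  from least_AE_bound[OF this False v(2)] obtain K
    where K: "0 < K" "AE x in lborel. v x \<le> K" "\<And>L. AE x in lborel. v x \<le> L \<Longrightarrow> K \<le> L" by metis
  have "K \<le> max ((2 * C) powr q * M) ((2 / b) powr (1 / (m - 1)))"
  proof (rule ccontr)
    assume "\<not> ?thesis"
    then have K1: "(2 * C) powr q * M < K" and K2: "(2 / b) powr (1 / (m - 1)) < K" by auto
    define D where "D = C * M powr (1 / q) * K powr (m - 1 / q) + K / b"
    have D0: "0 \<le> D" using C K b by (simp add: D_def)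
    have "((2 * C) powr q * M) powr (1 / q) < K powr (1 / q)"
      using K1 q C M by (intro powr_less_mono2) auto
    then have "2 * C * M powr (1 / q) < K powr (1 / q)"
      using q C M by (simp add: powr_mult powr_powr)
    then have "2 * C * M powr (1 / q) * K powr (m - 1 / q) < K powr (1 / q) * K powr (m - 1 / q)"
      using K by (intro mult_strict_right_mono) auto
    then have 1: "2 * C * M powr (1 / q) * K powr (m - 1 / q) < K powr m"
      by (simp flip: powr_add)
    have "((2 / b) powr (1 / (m - 1))) powr (m - 1) < K powr (m - 1)"
      using K2 m by (intro powr_less_mono2) auto
    then have "2 / b * K < K powr (m - 1) * K"
      using m b K by (intro mult_strict_right_mono) (auto simp: powr_powr)
    also have "\<dots> = K powr m" using K by (simp add: powr_diff)
    finally have 2: "2 / b * K < K powr m" .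
    have "2 * D = 2 * C * M powr (1 / q) * K powr (m - 1 / q) + 2 / b * K"
      by (simp add: D_def distrib_left)
    with 1 2 have D: "D < K powr m" by linarith
    have "AE x in lborel. v x \<le> D powr (1 / m)"
      using le K(2)
    proof eventually_elim
      case (elim x)
      have "v x powr m \<le> D"
        using elim conv[OF K(1,2), of x] b by (simp add: D_def) (smt (verit) divide_right_mono)
      then have "(v x powr m) powr (1 / m) \<le> D powr (1 / m)" using m by (intro powr_mono2) auto
      then show ?case using m v(2)[of x] by (simp add: powr_powr)
    qed
    then have "K \<le> D powr (1 / m)" by (rule K(3))
    also have "\<dots> < (K powr m) powr (1 / m)" using D D0 m by (intro powr_less_mono2) auto
    also have "\<dots> = K" using m K by (simp add: powr_powr)
    finally show False by simp
  qed
  with K(2) show ?thesis by (auto elim!: eventually_mono)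
qed

section \<open>Very weak solutions are mild\<close>

lemma AE_lborel_ex_in_interval:
  fixes a b :: real
  assumes "AE x in lborel. P x" "a < b"
  obtains x where "x \<in> {a<..<b}" "P x"
proof -
  have "\<exists>x\<in>{a<..<b}. P x"
  proof (rule ccontr)
    assume "\<not> ?thesis"
    then have "AE x in lborel. x \<notin> {a<..<b}" using assms(1) by (auto elim!: eventually_mono)
    then have "emeasure lborel {a<..<b} = 0"
      by (subst (asm) AE_iff_measurable[of "{a<..<b}"]) auto
    then show False using assms(2) by simp
  qed
  then show ?thesis using that by blast
qed

text \<open>The weak formulation holds for almost every pair of times; continuity extends it to all pairs.\<close>

lemma continuous_eq_if_AE_pairs_eq:
  fixes H :: "real \<Rightarrow> real"
  assumes cont: "continuous_on {0..T} H"
    and ae: "AE z in lborel. 0 < fst z \<and> fst z \<le> snd z \<and> snd z \<le> T \<longrightarrow> H (fst z) = H (snd z)"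
    and t: "t \<in> {0..T}"
  shows "H t = H 0"
proof (rule ccontr)
  assume ne: "H t \<noteq> H 0"
  define e where "e = \<bar>H t - H 0\<bar> / 2"
  have e: "0 < e" using ne by (simp add: e_def)
  have t0: "0 < t" using t ne by (cases "t = 0") auto
  have c: "\<exists>d>0. \<forall>s'\<in>{0..T}. dist s' s < d \<longrightarrow> dist (H s') (H s) < e" if "s \<in> {0..T}" for s
    using cont that e unfolding continuous_on_iff by blast
  obtain d1 where d1: "0 < d1" "\<And>s. s \<in> {0..T} \<Longrightarrow> dist s 0 < d1 \<Longrightarrow> dist (H s) (H 0) < e"
    using c[of 0] t by auto
  obtain d2 where d2: "0 < d2" "\<And>s. s \<in> {0..T} \<Longrightarrow> dist s t < d2 \<Longrightarrow> dist (H s) (H t) < e"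
    using c[OF t] by blast
  define d where "d = min (min d1 d2) (t / 2)"
  have d: "0 < d" "d \<le> d1" "d \<le> d2" "d \<le> t / 2" using d1(1) d2(1) t0 by (auto simp: d_def)
  have "AE a in lborel. AE b in lborel. 0 < a \<and> a \<le> b \<and> b \<le> T \<longrightarrow> H a = H b"
    using AE_lborel_prod_fst[OF ae] by simp
  from AE_lborel_ex_in_interval[OF this d(1)]
  obtain a where a: "a \<in> {0<..<d}" "AE b in lborel. 0 < a \<and> a \<le> b \<and> b \<le> T \<longrightarrow> H a = H b"
    by blast
  have "t - d < t" using d by simp
  from AE_lborel_ex_in_interval[OF a(2) this]
  obtain b where b: "b \<in> {t - d<..<t}" "0 < a \<and> a \<le> b \<and> b \<le> T \<longrightarrow> H a = H b"
    by blast
  have "H a = H b" using a(1) b d t by auto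
  moreover have "dist (H a) (H 0) < e" using a(1) d t by (intro d1(2)) (auto simp: dist_real_def)
  moreover have "dist (H b) (H t) < e" using b(1) d t t0 by (intro d2(2)) (auto simp: dist_real_def)
  ultimately show False by (auto simp: e_def dist_real_def abs_if split: if_splits)
qed

context evolution_data
begin

text \<open>In the following lemmas \<open>J0\<close>, \<open>v0\<close> and \<open>u\<close> are the given functions, of which \<open>J\<close>, \<open>u0\<close> and \<open>U\<close> are Borel versions.\<close>

lemma convolve_eq_space_conv:
  assumes "AE z in lborel. J0 z = J z" "AE y in lborel. u y = U (y, t)"
  shows "convolve J0 (\<lambda>y. u y powr m) x = space_conv J (\<lambda>z. U z powr m) (x, t)"
  unfolding convolve_def space_conv_def fst_conv snd_conv
proof (rule lebesgue_integral_eq_lborel)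
  show "AE y in lborel. J0 (x - y) * u y powr m = J (x - y) * U (y, t) powr m"
    using AE_lborel_reflect[OF assms(1), of x] assms(2) by eventually_elim simp
  have [measurable]: "(\<lambda>y. U (y, t)) \<in> borel_measurable borel"
    by (rule borel_measurable_sections) simp
  show "(\<lambda>y. J (x - y) * U (y, t) powr m) \<in> borel_measurable borel" by measurable
qed

text \<open>
  The integrated equation, averaged against a bump in space. The test function is the bump times
  a function of time that is one on \<open>[0, T]\<close>, so that the term with the time derivative drops out.
\<close>

lemma bump_identity:
  fixes u :: "'a \<Rightarrow> real \<Rightarrow> real" and a b :: 'a and n :: real
  assumes vws: "very_weak_solution J0 m v0 T u" and T: "0 < T"
    and J0: "AE z in lborel. J0 z = J z"
    and U: "AE z in lborel. 0 < snd z \<longrightarrow> U z = u (fst z) (snd z)"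
    and n: "0 < n" and t: "t \<in> {0..T}"
  shows "(LINT x|lebesgue. u x t * box_bump n a b x) - (LINT x|lebesgue. u x 0 * box_bump n a b x)
    = (LINT x|lborel. (trajectory J m u0 U x t - u0 x) * box_bump n a b x)"
proof -
  let ?\<phi> = "box_bump n a b"
  have \<phi>_meas[measurable]: "?\<phi> \<in> borel_measurable borel"
    using box_bump_continuous by (rule borel_measurable_continuous_onI)
  have \<phi>_bd: "\<bar>?\<phi> x\<bar> \<le> indicator (cbox a b) x" for x
    using box_bump_bounds[of n a b x] box_bump_support[OF n, of x a b] box_subset_cbox[of a b]
    by (auto simp: indicator_def)
  define G where "G t = (LINT x|lebesgue. u x t * ?\<phi> x)" for t
  define V where "V s = (LINT x|lborel. reaction J m U (x, s) * ?\<phi> x)" for s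
  define W where "W z = indicator {0<..T} (snd z) * (reaction J m U z * ?\<phi> (fst z))" for z
  have W_int: "integrable lborel W"
  proof (rule Bochner_Integration.integrable_bound[OF reaction_integrable[of T]])
    have [measurable]: "(\<lambda>z. ?\<phi> (fst z)) \<in> borel_measurable (borel :: ('a \<times> real) measure)"
      by (rule measurable_compose[OF _ \<phi>_meas]) (intro borel_measurable_continuous_onI continuous_intros)
    have [measurable]: "snd \<in> borel_measurable (borel :: ('a \<times> real) measure)"
      by (intro borel_measurable_continuous_onI continuous_intros)
    show "W \<in> borel_measurable lborel" unfolding W_def by measurable
    have "\<bar>?\<phi> x\<bar> \<le> 1" for x using box_bump_bounds[of n a b x] by simp
    then show "AE z in lborel. norm (W z) \<le> norm (indicator {0<..T} (snd z) * reaction J m U z)"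
      by (intro AE_I2) (auto simp: W_def abs_mult indicator_def mult_left_le)
  qed
  have V_W: "indicator {0<..T} s * V s = (LINT x|lborel. W (x, s))" for s
    by (simp add: W_def V_def)
  have V_int: "integrable lborel (\<lambda>s. indicator {0<..T} s * V s)"
    unfolding V_W by (rule integrable_lborel_snd[OF W_int])
  have V_meas[measurable]: "V \<in> borel_measurable borel"
  proof -
    have "(\<lambda>s. LINT x|lborel. reaction J m U (x, s) * ?\<phi> x) \<in> borel_measurable borel" by measurable
    then show ?thesis by (simp add: V_def[abs_def])
  qed
  have u_int: "integrable lebesgue (\<lambda>x. indicator (cbox a b) x * u x s)" if "s \<in> {0..T}" for s
    using vws that compact_cbox unfolding very_weak_solution_def continuous_into_L1_loc_def set_integrable_def
    by fastforce
  have u\<phi>_int: "integrable lebesgue (\<lambda>x. u x s * ?\<phi> x)" if "s \<in> {0..T}" for s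
  proof (rule Bochner_Integration.integrable_bound[OF u_int[OF that]])
    have "(\<lambda>x. (indicator (cbox a b) x * u x s) * ?\<phi> x) \<in> borel_measurable lebesgue"
      by (intro borel_measurable_times borel_measurable_integrable[OF u_int[OF that]])
        (simp add: measurable_completion)
    also have "(\<lambda>x. (indicator (cbox a b) x * u x s) * ?\<phi> x) = (\<lambda>x. u x s * ?\<phi> x)"
    proof
      fix x show "(indicator (cbox a b) x * u x s) * ?\<phi> x = u x s * ?\<phi> x"
        using \<phi>_bd[of x] by (cases "x \<in> cbox a b") simp_all
    qed
    finally show "(\<lambda>x. u x s * ?\<phi> x) \<in> borel_measurable lebesgue" .
    show "AE x in lebesgue. norm (u x s * ?\<phi> x) \<le> norm (indicator (cbox a b) x * u x s)"
      using mult_left_mono[OF \<phi>_bd abs_ge_zero] by (intro AE_I2) (simp add: abs_mult mult.commute)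
  qed
  have G_cont: "continuous_on {0..T} G"
    unfolding continuous_on_def
  proof
    fix s assume s: "s \<in> {0..T}"
    have lim: "((\<lambda>r. LINT x:cbox a b|lebesgue. \<bar>u x r - u x s\<bar>) \<longlongrightarrow> 0) (at s within {0..T})"
      using vws s compact_cbox unfolding very_weak_solution_def continuous_into_L1_loc_def by blast
    have "\<forall>\<^sub>F r in at s within {0..T}. dist (G r) (G s) \<le> (LINT x:cbox a b|lebesgue. \<bar>u x r - u x s\<bar>)"
    proof (rule eventually_at_filter[THEN iffD2], rule always_eventually, intro allI impI)
      fix r assume r: "r \<in> {0..T}"
      have "dist (G r) (G s) = \<bar>LINT x|lebesgue. u x r * ?\<phi> x - u x s * ?\<phi> x\<bar>"
        using u\<phi>_int[OF r] u\<phi>_int[OF s] by (simp add: G_def dist_real_def)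
      also have "\<dots> \<le> (LINT x|lebesgue. \<bar>u x r * ?\<phi> x - u x s * ?\<phi> x\<bar>)"
        by (rule integral_abs_bound)
      also have "\<dots> \<le> (LINT x|lebesgue. indicator (cbox a b) x * \<bar>u x r - u x s\<bar>)"
      proof (rule integral_mono)
        show "integrable lebesgue (\<lambda>x. \<bar>u x r * ?\<phi> x - u x s * ?\<phi> x\<bar>)"
          using u\<phi>_int[OF r] u\<phi>_int[OF s] by simp
        have "integrable lebesgue (\<lambda>x. \<bar>indicator (cbox a b) x * u x r - indicator (cbox a b) x * u x s\<bar>)"
          using u_int[OF r] u_int[OF s] by (intro integrable_abs Bochner_Integration.integrable_diff)
        then show "integrable lebesgue (\<lambda>x. indicator (cbox a b) x * \<bar>u x r - u x s\<bar>)"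
          by (rule back_subst[of "integrable lebesgue"]) (auto simp: indicator_def)
        show "\<bar>u x r * ?\<phi> x - u x s * ?\<phi> x\<bar> \<le> indicator (cbox a b) x * \<bar>u x r - u x s\<bar>" for x
          using mult_right_mono[OF \<phi>_bd[of x], of "\<bar>u x r - u x s\<bar>"]
          by (simp add: abs_mult left_diff_distrib[symmetric] mult.commute)
      qed
      finally show "dist (G r) (G s) \<le> (LINT x:cbox a b|lebesgue. \<bar>u x r - u x s\<bar>)"
        by (simp add: set_lebesgue_integral_def)
    qed
    then have "((\<lambda>r. dist (G r) (G s)) \<longlongrightarrow> 0) (at s within {0..T})"
      by (intro tendsto_sandwich[OF _ _ tendsto_const lim]) auto
    then show "(G \<longlongrightarrow> G s) (at s within {0..T})" by (subst tendsto_dist_iff)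
  qed
  define H where "H t = G t - (LINT s|lborel. indicator {0<..t} s * (indicator {0<..T} s * V s))" for t
  have H_cont: "continuous_on {0..T} H"
    unfolding H_def using continuous_on_indefinite_integral[OF V_int] G_cont
    by (intro continuous_on_diff) (auto intro: continuous_on_subset)
  obtain \<eta> where \<eta>: "C_infinity \<eta>" "\<And>s. s \<in> {-1..T + 1} \<Longrightarrow> \<eta> s = 1" "\<And>s. s \<notin> {-2..T + 2} \<Longrightarrow> \<eta> s = 0"
    using smooth_cutoff_exists[of T] T by (metis less_imp_le)
  let ?\<psi> = "\<lambda>z. ?\<phi> (fst z) * \<eta> (snd z)"
  have \<psi>: "test_function ?\<psi>" by (rule test_function_box_bump_cutoff[OF \<eta>(1,3) n])
  have \<eta>_deriv: "deriv (\<lambda>s. ?\<phi> x * \<eta> s) s = 0" if "s \<in> {0..T}" for x s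
  proof (rule DERIV_imp_deriv)
    have "\<forall>\<^sub>F r in nhds s. r \<in> {-1<..<T+1}"
      by (rule eventually_nhds_in_open) (use that in auto)
    then have "\<forall>\<^sub>F r in nhds s. ?\<phi> x = ?\<phi> x * \<eta> r"
      by eventually_elim (simp add: \<eta>(2))
    moreover have "((\<lambda>s. ?\<phi> x) has_real_derivative 0) (at s)" by simp
    ultimately show "((\<lambda>s. ?\<phi> x * \<eta> s) has_real_derivative 0) (at s)"
      by (rule DERIV_cong_ev[THEN iffD1, OF refl _ refl])
  qed
  let ?inner = "\<lambda>s. LINT x|lebesgue. u x s * deriv (\<lambda>s. ?\<psi> (x, s)) s - neg_L J0 (\<lambda>y. u y s powr m) x * ?\<psi> (x, s)"
  have inner: "AE s in lborel. s \<in> {0<..T} \<longrightarrow> ?inner s = V s"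
    using AE_lborel_prod_snd[OF U]
  proof eventually_elim
    case (elim s)
    show ?case
    proof
      assume s: "s \<in> {0<..T}"
      have ae: "AE y in lborel. u y s = U (y, s)" using elim s by (auto elim!: eventually_mono)
      show "?inner s = V s" unfolding V_def
      proof (rule lebesgue_integral_eq_lborel)
        show "AE x in lborel. u x s * deriv (\<lambda>s. ?\<psi> (x, s)) s - neg_L J0 (\<lambda>y. u y s powr m) x * ?\<psi> (x, s)
            = reaction J m U (x, s) * ?\<phi> x"
          using ae
        proof eventually_elim
          case (elim x)
          then show ?case using s \<eta>_deriv[of s x] \<eta>(2)[of s]
            by (simp add: neg_L_def convolve_eq_space_conv[OF J0 ae] reaction_def algebra_simps)
        qed
        have [measurable]: "(\<lambda>x. reaction J m U (x, s)) \<in> borel_measurable borel"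
          by (rule borel_measurable_sections) simp
        show "(\<lambda>x. reaction J m U (x, s) * ?\<phi> x) \<in> borel_measurable borel" by measurable
      qed
    qed
  qed
  have "AE z in lebesgue. 0 < fst z \<and> fst z \<le> snd z \<and> snd z \<le> T \<longrightarrow>
      (LINT s:{fst z..snd z}|lebesgue. ?inner s)
      = (LINT x|lebesgue. u x (snd z) * ?\<psi> (x, snd z)) - (LINT x|lebesgue. u x (fst z) * ?\<psi> (x, fst z))"
  proof -
    have "AE (\<tau>\<^sub>1, \<tau>\<^sub>2) in lebesgue. 0 < \<tau>\<^sub>1 \<and> \<tau>\<^sub>1 \<le> \<tau>\<^sub>2 \<and> \<tau>\<^sub>2 \<le> T \<longrightarrow>
        (\<forall>\<psi>. test_function \<psi> \<longrightarrow>
           (LINT t:{\<tau>\<^sub>1..\<tau>\<^sub>2}|lebesgue. LINT x|lebesgue.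
              u x t * deriv (\<lambda>s. \<psi> (x, s)) t - neg_L J0 (\<lambda>y. u y t powr m) x * \<psi> (x, t))
           = (LINT x|lebesgue. u x \<tau>\<^sub>2 * \<psi> (x, \<tau>\<^sub>2)) - (LINT x|lebesgue. u x \<tau>\<^sub>1 * \<psi> (x, \<tau>\<^sub>1)))"
      using vws unfolding very_weak_solution_def by blast
    then show ?thesis
    proof eventually_elim
      case (elim z)
      show ?case
        using elim[unfolded split_beta, rule_format, OF _ \<psi>] by (intro impI) simp
    qed
  qed
  then have "AE z in lborel. 0 < fst z \<and> fst z \<le> snd z \<and> snd z \<le> T \<longrightarrow> H (fst z) = H (snd z)"
    unfolding AE_completion_iff
  proof eventually_elim
    case (elim z)
    show ?case
    proof
      assume z: "0 < fst z \<and> fst z \<le> snd z \<and> snd z \<le> T"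
      have "(LINT s:{fst z..snd z}|lebesgue. ?inner s) = (LINT s|lborel. indicator {fst z<..snd z} s * V s)"
        unfolding set_lebesgue_integral_def
      proof (rule lebesgue_integral_eq_lborel)
        show "AE s in lborel. indicator {fst z..snd z} s *\<^sub>R ?inner s = indicator {fst z<..snd z} s * V s"
          using inner AE_lborel_singleton[of "fst z"]
          by eventually_elim (use z in \<open>auto simp: indicator_def\<close>)
      qed measurable
      also have "\<dots> = (LINT s|lborel. indicator {0<..snd z} s * (indicator {0<..T} s * V s)
          - indicator {0<..fst z} s * (indicator {0<..T} s * V s))"
        using z by (intro Bochner_Integration.integral_cong) (auto simp: indicator_def)
      also have "\<dots> = (LINT s|lborel. indicator {0<..snd z} s * (indicator {0<..T} s * V s))
          - (LINT s|lborel. indicator {0<..fst z} s * (indicator {0<..T} s * V s))"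
        using integrable_mult_indicator[OF _ V_int, of "{0<..snd z}"] integrable_mult_indicator[OF _ V_int, of "{0<..fst z}"]
        by (intro Bochner_Integration.integral_diff) simp_all
      also have "(LINT s:{fst z..snd z}|lebesgue. ?inner s) = G (snd z) - G (fst z)"
        using elim z \<eta>(2) by (simp add: G_def)
      finally show "H (fst z) = H (snd z)" by (simp add: H_def)
    qed
  qed
  from continuous_eq_if_AE_pairs_eq[OF H_cont this t] have "H t = H 0" .
  then have "G t - G 0 = (LINT s|lborel. indicator {0<..t} s * (indicator {0<..T} s * V s))"
    by (simp add: H_def)
  also have "\<dots> = (LINT s|lborel. LINT x|lborel. indicator {0<..t} s * W (x, s))"
    by (simp add: V_W)
  also have "\<dots> = (LINT x|lborel. LINT s|lborel. indicator {0<..t} s * W (x, s))"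
  proof -
    have [measurable]: "snd \<in> borel_measurable (borel :: ('a \<times> real) measure)"
      by (intro borel_measurable_continuous_onI continuous_intros)
    have "integrable lborel (\<lambda>z. indicator {0<..t} (snd z) * W z)"
      by (rule Bochner_Integration.integrable_bound[OF W_int])
        (use borel_measurable_integrable[OF W_int] in \<open>auto simp: indicator_def\<close>)
    from integral_lborel_fst[OF this] integral_lborel_snd[OF this] show ?thesis by simp
  qed
  also have "\<dots> = (LINT x|lborel. (trajectory J m u0 U x t - u0 x) * ?\<phi> x)"
  proof (rule Bochner_Integration.integral_cong)
    fix x
    have "(LINT s|lborel. indicator {0<..t} s * W (x, s))
        = (LINT s|lborel. (indicator {0<..t} s * reaction J m U (x, s)) * ?\<phi> x)"
      using t by (intro Bochner_Integration.integral_cong) (auto simp: W_def indicator_def)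
    then show "(LINT s|lborel. indicator {0<..t} s * W (x, s)) = (trajectory J m u0 U x t - u0 x) * ?\<phi> x"
      by (simp add: trajectory_def)
  qed simp
  finally show ?thesis by (simp add: G_def)
qed

text \<open>Letting the bumps tend to indicators of boxes, the identity gives the integrated equation at each positive time, almost everywhere in space.\<close>

lemma AE_eq_trajectory:
  fixes u :: "'a \<Rightarrow> real \<Rightarrow> real"
  assumes vws: "very_weak_solution J0 m v0 t u" and t: "0 < t"
    and J0: "AE z in lborel. J0 z = J z"
    and v0: "AE x in lborel. v0 x = u0 x"
    and U: "AE z in lborel. 0 < snd z \<longrightarrow> U z = u (fst z) (snd z)"
  shows "AE x in lborel. u x t = trajectory J m u0 U x t"
proof -
  have u_int: "set_integrable lebesgue K (\<lambda>x. u x t)" if "compact K" for K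
    using vws that t unfolding very_weak_solution_def continuous_into_L1_loc_def by auto
  define B where "B k = box (- (real k *\<^sub>R One)) (real k *\<^sub>R One :: 'a)" for k
  have "AE x in lborel. x \<in> B k \<longrightarrow> u x t = trajectory J m u0 U x t" for k
  proof -
    let ?C = "cbox (- (real k *\<^sub>R One)) (real k *\<^sub>R One :: 'a)"
    have meas: "(\<lambda>x. indicator ?C x * u x t) \<in> borel_measurable lebesgue"
      using borel_measurable_integrable[OF u_int[OF compact_cbox, unfolded set_integrable_def]] by simp
    obtain f where f: "f \<in> borel_measurable lborel" "AE x in lborel. indicator ?C x * u x t = f x"
      using completion_ex_borel_measurable_real[OF meas] by blast
    have f_meas[measurable]: "f \<in> borel_measurable borel" using f(1) by simp
    have f_int: "integrable lborel f"
      using lebesgue_integrable_iff_lborel[OF f(2) f_meas] u_int[OF compact_cbox, unfolded set_integrable_def] by simp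
    define g where "g x = indicator (B k) x * (f x - trajectory J m u0 U x t)" for x
    have g0_int: "integrable lborel (\<lambda>x. f x - trajectory J m u0 U x t)"
      by (intro Bochner_Integration.integrable_diff f_int trajectory_integrable)
    have g_int: "integrable lborel g"
      unfolding g_def using integrable_mult_indicator[OF _ g0_int, of "B k"] by (simp add: B_def)
    have "AE x in lborel. g x = 0"
    proof (rule AE_eq_0_if_box_integrals_eq_0[OF g_int])
      fix a b :: 'a
      obtain c d where cd: "box a b \<inter> B k = box c d" using box_Int_box unfolding B_def by blast
      have [measurable]: "box_bump n c d \<in> borel_measurable borel" for n
        using box_bump_continuous by (rule borel_measurable_continuous_onI)
      have 0: "(LINT x|lborel. (f x - trajectory J m u0 U x t) * box_bump (real (Suc n)) c d x) = 0" for n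
      proof -
        let ?\<phi> = "box_bump (real (Suc n)) c d"
        have \<phi>1: "\<bar>?\<phi> x\<bar> \<le> 1" for x using box_bump_bounds[of "real (Suc n)" c d x] by simp
        have int: "integrable lborel (\<lambda>x. h x * ?\<phi> x)" if "integrable lborel h" for h :: "'a \<Rightarrow> real"
          by (rule Bochner_Integration.integrable_bound[OF that])
            (use borel_measurable_integrable[OF that] \<phi>1 in \<open>auto simp: abs_mult intro!: mult_left_le\<close>)
        have C: "?\<phi> x = 0" if "x \<notin> ?C" for x
          using that cd box_subset_cbox by (intro box_bump_support) (auto simp: B_def)
        have "(LINT x|lebesgue. u x t * ?\<phi> x) = (LINT x|lborel. f x * ?\<phi> x)"
        proof (rule lebesgue_integral_eq_lborel)
          show "AE x in lborel. u x t * ?\<phi> x = f x * ?\<phi> x"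
            using f(2)
          proof eventually_elim
            case (elim x)
            then show ?case using C[of x] by (cases "x \<in> ?C") simp_all
          qed
        qed measurable
        moreover have "(LINT x|lebesgue. u x 0 * ?\<phi> x) = (LINT x|lborel. u0 x * ?\<phi> x)"
        proof (rule lebesgue_integral_eq_lborel)
          have "AE x in lborel. u x 0 = v0 x"
            using vws unfolding very_weak_solution_def AE_completion_iff by blast
          then show "AE x in lborel. u x 0 * ?\<phi> x = u0 x * ?\<phi> x"
            using v0 by eventually_elim simp
        qed measurable
        moreover have "(LINT x|lebesgue. u x t * ?\<phi> x) - (LINT x|lebesgue. u x 0 * ?\<phi> x)
            = (LINT x|lborel. (trajectory J m u0 U x t - u0 x) * ?\<phi> x)"
          using t by (intro bump_identity[OF vws t J0 U]) auto
        moreover have "(LINT x|lborel. (trajectory J m u0 U x t - u0 x) * ?\<phi> x)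
            = (LINT x|lborel. trajectory J m u0 U x t * ?\<phi> x) - (LINT x|lborel. u0 x * ?\<phi> x)"
          using int[OF trajectory_integrable[of t]] int[OF u0] by (simp add: left_diff_distrib)
        moreover have "(LINT x|lborel. (f x - trajectory J m u0 U x t) * ?\<phi> x)
            = (LINT x|lborel. f x * ?\<phi> x) - (LINT x|lborel. trajectory J m u0 U x t * ?\<phi> x)"
          using int[OF trajectory_integrable[of t]] int[OF f_int] by (simp add: left_diff_distrib)
        ultimately show ?thesis by simp
      qed
      have "(\<lambda>n. LINT x|lborel. (f x - trajectory J m u0 U x t) * box_bump (real (Suc n)) c d x)
          \<longlonglongrightarrow> (LINT x|lborel. (f x - trajectory J m u0 U x t) * indicator (box c d) x)"
      proof (rule integral_dominated_convergence[where w = "\<lambda>x. \<bar>f x - trajectory J m u0 U x t\<bar>"])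
        show "AE x in lborel. norm ((f x - trajectory J m u0 U x t) * box_bump (real (Suc n)) c d x)
            \<le> \<bar>f x - trajectory J m u0 U x t\<bar>" for n
          using box_bump_bounds[of "real (Suc n)" c d]
          by (intro AE_I2) (auto simp: abs_mult intro!: mult_left_le)
        show "AE x in lborel. (\<lambda>n. (f x - trajectory J m u0 U x t) * box_bump (real (Suc n)) c d x)
            \<longlonglongrightarrow> (f x - trajectory J m u0 U x t) * indicator (box c d) x"
          by (intro AE_I2 tendsto_mult tendsto_const box_bump_tendsto)
        show "integrable lborel (\<lambda>x. \<bar>f x - trajectory J m u0 U x t\<bar>)" using g0_int by simp
        show "(\<lambda>x. (f x - trajectory J m u0 U x t) * box_bump (real (Suc n)) c d x) \<in> borel_measurable lborel"
          "(\<lambda>x. (f x - trajectory J m u0 U x t) * indicator (box c d) x) \<in> borel_measurable lborel" for n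
          using borel_measurable_integrable[OF g0_int] by simp_all
      qed
      then have "(LINT x|lborel. (f x - trajectory J m u0 U x t) * indicator (box c d) x) = 0"
        unfolding 0 by (simp add: LIMSEQ_const_iff)
      then show "(LINT x:box a b|lborel. g x) = 0"
        by (simp add: set_lebesgue_integral_def g_def cd[symmetric] indicator_inter_arith mult_ac)
    qed
    then show ?thesis using f(2)
    proof eventually_elim
      case (elim x)
      show ?case
      proof
        assume x: "x \<in> B k"
        then have "x \<in> ?C" using box_subset_cbox unfolding B_def by blast
        with elim x show "u x t = trajectory J m u0 U x t" by (simp add: g_def)
      qed
    qed
  qed
  then have "AE x in lborel. \<forall>k. x \<in> B k \<longrightarrow> u x t = trajectory J m u0 U x t"
    by (subst AE_all_countable) auto
  then show ?thesis
  proof eventually_elim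
    case (elim x)
    obtain k :: nat where k: "norm x < real k" using reals_Archimedean2 by blast
    have "x \<in> B k"
      unfolding B_def mem_box using k Basis_le_norm[of _ x] by (fastforce simp: abs_less_iff)
    then show ?case using elim by blast
  qed
qed

end

section \<open>Comparison of the constants\<close>

lemma le_two_powr: "0 < a \<Longrightarrow> a \<le> 2 powr a" for a :: real
proof -
  assume a: "0 < a"
  have "ln (a / 2) \<le> a / 2 - 1" using a by (intro ln_le_minus_one) auto
  then have "ln a \<le> a / 2 - 1 + ln 2" using a by (simp add: ln_div)
  also have "\<dots> \<le> a / 2" using ln_le_minus_one[of "2::real"] by simp
  also have "\<dots> \<le> a * ln 2" using a ln2_ge_two_thirds by simp
  finally have "exp (ln a) \<le> exp (a * ln 2)" by simp
  then show "a \<le> 2 powr a" using a by (simp add: powr_def)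
qed

context
  fixes m q C M :: real
  assumes m: "1 < m" and q: "1 \<le> q" and C: "0 < C" and M: "0 \<le> M"
begin

text \<open>The two branches of the estimate, for times before and after the critical time.\<close>

definition early_bound :: "real \<Rightarrow> real" where
  "early_bound t = 2 * (m * q * C_m m powr (m / (m - 1))) powr (1 / m) * t powr (- (1 / (m - 1)))"

definition late_bound :: real where
  "late_bound = 2 * (m * C_m m / (m - 1) * C) powr q * M"

lemma early_antimono: "0 < s \<Longrightarrow> s \<le> t \<Longrightarrow> early_bound t \<le> early_bound s"
  unfolding early_bound_def using m by (intro mult_left_mono powr_mono2') auto

lemma C_m_ge_2: "2 \<le> C_m m"
proof -
  have "2 powr 1 \<le> 2 powr (m / (m - 1))" using m by (intro powr_mono) (auto simp: field_simps)
  then show ?thesis by (simp add: C_m_def)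
qed

lemma decay_le_early:
  assumes t: "0 < t"
  shows "(2 / ((m - 1) * t)) powr (1 / (m - 1)) \<le> early_bound t"
proof -
  define a where "a = 1 / (m - 1)"
  have a: "0 < a" using m by (simp add: a_def)
  have ma: "m / (m - 1) = a + 1" using m by (simp add: a_def field_simps)
  have "2 / ((m - 1) * t) = 2 * a / t" using m t by (simp add: a_def)
  then have "(2 / ((m - 1) * t)) powr a = (2 * a) powr a * t powr - a"
    using a t by (simp add: powr_divide powr_minus_divide)
  also have "(2 * a) powr a \<le> (2 * 2 powr a) powr a"
    using a le_two_powr[OF a] by (intro powr_mono2) auto
  also have "2 * 2 powr a = C_m m" by (simp add: C_m_def ma powr_add)
  also have "C_m m powr a = 1 * (C_m m powr (m / (m - 1))) powr (1 / m)"
    using m by (simp add: powr_powr a_def)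
  also have "\<dots> \<le> (2 * (m * q) powr (1 / m)) * (C_m m powr (m / (m - 1))) powr (1 / m)"
  proof (rule mult_right_mono)
    have "1 * 1 \<le> m * q" using m q by (intro mult_mono) auto
    then have "1 \<le> (m * q) powr (1 / m)" using m by (intro ge_one_powr_ge_zero) auto
    then show "1 \<le> 2 * (m * q) powr (1 / m)" by linarith
  qed simp
  also have "\<dots> = 2 * (m * q * C_m m powr (m / (m - 1))) powr (1 / m)"
    using m q by (simp add: powr_mult)
  finally show ?thesis by (simp add: early_bound_def a_def mult_right_mono)
qed

lemma smoothing_le_late: "(2 * C) powr q * M \<le> late_bound"
proof -
  have "2 * 1 \<le> C_m m * (m / (m - 1))"
    using C_m_ge_2 m by (intro mult_mono) (auto simp: field_simps)
  then have "2 * C \<le> m * C_m m / (m - 1) * C"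
    using mult_right_mono[of 2 "m * C_m m / (m - 1)" C] C by (simp add: mult.commute)
  then have "(2 * C) powr q \<le> (m * C_m m / (m - 1) * C) powr q"
    using C q by (intro powr_mono2) auto
  then have "1 * ((2 * C) powr q * M) \<le> 2 * ((m * C_m m / (m - 1) * C) powr q * M)"
    using M by (intro mult_mono) auto
  then show ?thesis by (simp add: late_bound_def mult.assoc)
qed

text \<open>The two bounds agree at the critical time.\<close>

lemma early_critical_time:
  assumes M0: "0 < M" and t0: "critical_time m q C M = ereal t0"
  shows "0 < t0" "early_bound t0 = late_bound"
proof -
  define A where "A = m * q"
  define B where "B = m / (m - 1) * C"
  define K where "K = C_m m"
  have pos: "0 < A" "0 < B" "0 < K" using m q C C_m_ge_2 by (auto simp: A_def B_def K_def)
  have t0: "t0 = A powr ((m - 1) / m) * B powr (- (q * (m - 1))) * K powr (1 - q * (m - 1)) * M powr (- (m - 1))"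
    using t0 M0 by (simp add: critical_time_def A_def B_def K_def)
  then show "0 < t0" using pos M0 by simp
  let ?a = "1 / (m - 1)"
  have e: "(m - 1) / m * - ?a = - (1 / m)" "- (q * (m - 1)) * - ?a = q"
    "(1 - q * (m - 1)) * - ?a = q - ?a" "- (m - 1) * - ?a = 1"
    using m by (auto simp: field_simps)
  have t0a: "t0 powr (- ?a) = A powr (- (1 / m)) * B powr q * K powr (q - ?a) * M"
    unfolding t0 using pos M0 by (simp only: powr_mult powr_powr e) simp
  have "m / (m - 1) * (1 / m) = ?a" using m by simp
  then have "(A * K powr (m / (m - 1))) powr (1 / m) = A powr (1 / m) * K powr ?a"
    using pos by (simp only: powr_mult powr_powr)
  then have "early_bound t0 = 2 * (A powr (1 / m) * K powr ?a) * (A powr (- (1 / m)) * B powr q * K powr (q - ?a) * M)"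
    unfolding early_bound_def t0a[symmetric] A_def[symmetric] K_def[symmetric] by simp
  also have "\<dots> = 2 * (A powr (1 / m) * A powr (- (1 / m))) * (K powr ?a * K powr (q - ?a)) * B powr q * M"
    by (simp only: mult_ac)
  also have "\<dots> = 2 * (B * K) powr q * M"
    using pos by (simp add: powr_mult flip: powr_add)
  also have "B * K = m * C_m m / (m - 1) * C" by (simp add: B_def K_def)
  finally show "early_bound t0 = late_bound" by (simp add: late_bound_def)
qed

lemma max_bound_le:
  assumes t: "0 < t"
  defines "b \<equiv> max ((2 * C) powr q * M) ((2 / ((m - 1) * t)) powr (1 / (m - 1)))"
  shows "ereal t \<le> critical_time m q C M \<Longrightarrow>
      b \<le> 2 * (m * q * C_m m powr (m / (m - 1))) powr (1 / m) * t powr (- (1 / (m - 1)))"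
    and "critical_time m q C M < ereal t \<Longrightarrow> b \<le> 2 * (m * C_m m / (m - 1) * C) powr q * M"
proof -
  have early_bound: "(2 / ((m - 1) * t)) powr (1 / (m - 1)) \<le> early_bound t" by (rule decay_le_early[OF t])
  have "b \<le> early_bound t" if le: "ereal t \<le> critical_time m q C M"
  proof (cases "M = 0")
    case True
    have "0 \<le> early_bound t" by (rule order_trans[OF powr_ge_zero early_bound])
    then show ?thesis using early_bound True by (simp add: b_def)
  next
    case False
    then obtain t0 where t0: "critical_time m q C M = ereal t0" by (simp add: critical_time_def)
    have "late_bound = early_bound t0" using early_critical_time(2)[OF _ t0] M False by simp
    also have "early_bound t0 \<le> early_bound t" using le t t0 by (intro early_antimono) auto
    finally show ?thesis using early_bound smoothing_le_late by (simp add: b_def)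
  qed
  then show "ereal t \<le> critical_time m q C M \<Longrightarrow>
      b \<le> 2 * (m * q * C_m m powr (m / (m - 1))) powr (1 / m) * t powr (- (1 / (m - 1)))"
    by (simp add: early_bound_def)
  have "b \<le> late_bound" if less: "critical_time m q C M < ereal t"
  proof -
    have M0: "0 < M" using less M by (cases "M = 0") (auto simp: critical_time_def)
    then obtain t0 where t0: "critical_time m q C M = ereal t0" by (simp add: critical_time_def)
    have "early_bound t \<le> early_bound t0"
      using less t0 early_critical_time(1)[OF M0 t0] by (intro early_antimono) auto
    then show ?thesis
      using early_bound smoothing_le_late early_critical_time(2)[OF M0 t0] by (simp add: b_def)
  qed
  then show "critical_time m q C M < ereal t \<Longrightarrow> b \<le> 2 * (m * C_m m / (m - 1) * C) powr q * M"
    by (simp add: late_bound_def)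
qed

end

section \<open>The smoothing estimate\<close>

lemma Lp_norm_1_eq:
  assumes "integrable N f"
  shows "Lp_norm 1 N f = ennreal (LINT x|N. \<bar>f x\<bar>)"
proof -
  have "(\<integral>\<^sup>+x. ennreal \<bar>f x\<bar> \<partial>N) = ennreal (LINT x|N. \<bar>f x\<bar>)"
    using assms by (intro nn_integral_eq_integral) auto
  moreover have "0 \<le> (LINT x|N. \<bar>f x\<bar>)" by simp
  ultimately show ?thesis by (simp add: Lp_norm_def one_ereal_def)
qed

lemma borel_representative_nonneg:
  fixes f :: "'a::euclidean_space \<Rightarrow> real"
  assumes f: "integrable lebesgue f" and nn: "AE x in lebesgue. 0 \<le> f x"
  obtains g where "g \<in> borel_measurable borel" "\<And>x. 0 \<le> g x" "AE x in lborel. f x = g x"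
    "integrable lborel g" "(LINT x|lborel. g x) = (LINT x|lebesgue. \<bar>f x\<bar>)"
proof -
  obtain h where h: "h \<in> borel_measurable lborel" "AE x in lborel. f x = h x"
    using completion_ex_borel_measurable_real[OF borel_measurable_integrable[OF f]] by blast
  define g where "g x = max 0 (h x)" for x
  have g: "g \<in> borel_measurable borel" unfolding g_def[abs_def] using h(1) by simp
  have ae: "AE x in lborel. f x = g x"
    using h(2) nn unfolding AE_completion_iff by eventually_elim (simp add: g_def)
  have ae': "AE x in lborel. \<bar>f x\<bar> = g x"
    using ae by eventually_elim (simp add: g_def)
  have "\<And>x. 0 \<le> g x" by (simp add: g_def)
  moreover have "integrable lborel g" using lebesgue_integrable_iff_lborel[OF ae g] f by simp
  ultimately show ?thesis
    using that g ae lebesgue_integral_eq_lborel[OF ae' g] by metis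
qed

text \<open>The two shapes of the \<open>L\<^sup>p\<close> hypothesis, for finite and infinite \<open>p\<close>, in terms of a representative.\<close>

lemma Lp_norm_le_finite:
  fixes J :: "'a::euclidean_space \<Rightarrow> real"
  assumes p: "1 < r" and le: "Lp_norm (ereal r) lebesgue J \<le> ennreal C"
    and g[measurable]: "g \<in> borel_measurable borel" and ae: "AE x in lborel. J x = g x" and nn: "\<And>x. 0 \<le> g x"
  shows "integrable lborel (\<lambda>x. g x powr r)" "(LINT x|lborel. g x powr r) \<le> max 0 C powr r"
proof -
  define I where "I = (\<integral>\<^sup>+x. ennreal (\<bar>J x\<bar> powr r) \<partial>lebesgue)"
  have I: "I = (\<integral>\<^sup>+x. ennreal (g x powr r) \<partial>lborel)"
  proof -
    have "I = (\<integral>\<^sup>+x. ennreal (g x powr r) \<partial>lebesgue)"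
      unfolding I_def by (intro nn_integral_cong_AE AE_completion) (use ae nn in \<open>auto elim!: eventually_mono\<close>)
    then show ?thesis by (simp add: nn_integral_completion)
  qed
  have fin: "I \<noteq> \<infinity>" using le by (auto simp: Lp_norm_def I_def[symmetric] Let_def top_unique)
  show int: "integrable lborel (\<lambda>x. g x powr r)"
    using fin by (intro integrableI_bounded) (auto simp: I less_top)
  have Ir: "I = ennreal (LINT x|lborel. g x powr r)"
    unfolding I by (rule nn_integral_eq_integral[OF int]) simp
  have nn': "0 \<le> (LINT x|lborel. g x powr r)" by simp
  have "ennreal ((LINT x|lborel. g x powr r) powr (1 / r)) \<le> ennreal C"
    using le fin by (simp add: Lp_norm_def I_def[symmetric] Let_def) (simp add: Ir)
  also have "ennreal C = ennreal (max 0 C)" by (simp add: ennreal_max_0)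
  finally have "(LINT x|lborel. g x powr r) powr (1 / r) \<le> max 0 C" by simp
  then have "((LINT x|lborel. g x powr r) powr (1 / r)) powr r \<le> max 0 C powr r"
    using p by (intro powr_mono2) auto
  then show "(LINT x|lborel. g x powr r) \<le> max 0 C powr r"
    using p by (simp add: powr_powr)
qed

lemma Lp_norm_le_infinite:
  fixes J :: "'a::euclidean_space \<Rightarrow> real"
  assumes le: "Lp_norm \<infinity> lebesgue J \<le> ennreal C"
    and ae: "AE x in lborel. J x = g x" and nn: "\<And>x. 0 \<le> g x"
  shows "AE x in lborel. g x \<le> max 0 C"
proof -
  have "AE x in lborel. ennreal \<bar>J x\<bar> \<le> Lp_norm \<infinity> lebesgue J"
    using esssup_AE[of "\<lambda>x. ennreal \<bar>J x\<bar>" "lebesgue :: 'a measure"]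
    unfolding AE_completion_iff by (simp add: Lp_norm_def)
  then show ?thesis using ae
  proof eventually_elim
    case (elim x)
    have "ennreal (g x) \<le> ennreal (max 0 C)"
      using elim le nn[of x] by (simp add: ennreal_max_0 order_trans)
    then show ?case by (subst (asm) ennreal_le_iff) auto
  qed
qed

text \<open>
  A very weak solution on all bounded time intervals has a single Borel representative for positive
  times. Its values at nonpositive times play no role.
\<close>

lemma very_weak_solution_representative:
  fixes u :: "'a::euclidean_space \<Rightarrow> real \<Rightarrow> real"
  assumes vws: "\<And>T. 0 < T \<Longrightarrow> very_weak_solution J m u0 T u"
  obtains U where "U \<in> borel_measurable borel" "\<And>z. 0 \<le> U z"
    "AE z in lborel. 0 < snd z \<longrightarrow> U z = u (fst z) (snd z)"
    "\<And>T. integrable lborel (\<lambda>z. indicator {0<..T} (snd z) * U z)"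
    "\<And>T. integrable lborel (\<lambda>z. indicator {0<..T} (snd z) * U z powr m)"
proof -
  define f where "f z = (if 0 < snd z then u (fst z) (snd z) else 0)" for z :: "'a \<times> real"
  have cyl: "z \<in> cylinder T \<longleftrightarrow> 0 < snd z \<and> snd z < T" for z :: "'a \<times> real" and T
    by (auto simp: cylinder_def mem_Times_iff)
  have "f \<in> borel_measurable lebesgue"
  proof (rule borel_measurable_LIMSEQ_real)
    show "(\<lambda>z. indicator (cylinder (real (Suc n))) z *\<^sub>R (case z of (x, t) \<Rightarrow> u x t)) \<in> borel_measurable lebesgue" for n
      using vws[of "real (Suc n)"] unfolding very_weak_solution_def set_borel_measurable_def by simp
    fix z :: "'a \<times> real"
    obtain k :: nat where k: "snd z < real k" using reals_Archimedean2 by blast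
    have "\<forall>\<^sub>F n in sequentially. indicator (cylinder (real (Suc n))) z *\<^sub>R (case z of (x, t) \<Rightarrow> u x t) = f z"
      using eventually_ge_at_top[of k]
      by eventually_elim (use k in \<open>auto simp: f_def indicator_def cyl split_def\<close>)
    then show "(\<lambda>n. indicator (cylinder (real (Suc n))) z *\<^sub>R (case z of (x, t) \<Rightarrow> u x t)) \<longlonglongrightarrow> f z"
      by (rule tendsto_eventually)
  qed
  then obtain h where h: "h \<in> borel_measurable lborel" "AE z in lborel. f z = h z"
    using completion_ex_borel_measurable_real by blast
  define U where "U z = max 0 (h z)" for z
  have U_meas[measurable]: "U \<in> borel_measurable borel" unfolding U_def[abs_def] using h(1) by simp
  have U_nonneg: "0 \<le> U z" for z by (simp add: U_def)
  have "AE z in lborel. z \<in> cylinder (real (Suc n)) \<longrightarrow> 0 \<le> u (fst z) (snd z)" for n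
    using vws[of "real (Suc n)"] unfolding very_weak_solution_def AE_completion_iff by (simp add: split_def)
  then have "AE z in lborel. \<forall>n. z \<in> cylinder (real (Suc n)) \<longrightarrow> 0 \<le> u (fst z) (snd z)"
    by (subst AE_all_countable) auto
  then have ae: "AE z in lborel. 0 < snd z \<longrightarrow> U z = u (fst z) (snd z)"
    using h(2)
  proof eventually_elim
    case (elim z)
    obtain k :: nat where k: "snd z < real k" using reals_Archimedean2 by blast
    have "0 < snd z \<Longrightarrow> z \<in> cylinder (real (Suc k))" using k by (simp add: cyl)
    then show ?case using elim by (auto simp: U_def f_def)
  qed
  have snd_meas[measurable]: "snd \<in> borel_measurable (borel :: ('a \<times> real) measure)"
    by (intro borel_measurable_continuous_onI continuous_intros)
  have int: "integrable lborel (\<lambda>z. indicator {0<..T} (snd z) * g (U z))"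
    if g[measurable]: "g \<in> borel_measurable borel"
      and g_int: "\<And>S. 0 < S \<Longrightarrow> set_integrable lebesgue (cylinder S) (\<lambda>(x, t). g (u x t))" for g :: "real \<Rightarrow> real" and T
  proof -
    let ?S = "max T 0 + 1"
    have "AE z in lborel. indicator (cylinder ?S) z *\<^sub>R (case z of (x, t) \<Rightarrow> g (u x t))
        = indicator {0<..<?S} (snd z) * g (U z)"
      using ae by eventually_elim (auto simp: indicator_def cyl split_def)
    from lebesgue_integrable_iff_lborel[OF this] have i: "integrable lborel (\<lambda>z. indicator {0<..<?S} (snd z) * g (U z))"
      using g_int[of ?S] by (simp add: set_integrable_def)
    show ?thesis
      by (rule Bochner_Integration.integrable_bound[OF i]) (auto simp: indicator_def)
  qed
  show ?thesis
  proof (rule that[OF U_meas U_nonneg ae])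
    show "integrable lborel (\<lambda>z. indicator {0<..T} (snd z) * U z)" for T
      using int[of "\<lambda>s. s"] vws unfolding very_weak_solution_def by simp
    show "integrable lborel (\<lambda>z. indicator {0<..T} (snd z) * U z powr m)" for T
      using int[of "\<lambda>s. s powr m"] vws unfolding very_weak_solution_def by simp
  qed
qed

text \<open>The estimate with the bound in its natural form, as a maximum; positivity of \<open>C\<close> follows from the unit mass of \<open>J\<close>.\<close>

lemma very_weak_solution_AE_bound:
  fixes J u0 :: "'a::euclidean_space \<Rightarrow> real" and u :: "'a \<Rightarrow> real \<Rightarrow> real"
  assumes m: "1 < m"
    and u0: "integrable lebesgue u0" "AE x in lebesgue. 0 \<le> u0 x"
    and J: "integrable lebesgue J" "AE z in lebesgue. 0 \<le> J z" "Lp_norm 1 lebesgue J = 1"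
    and p: "1 < p" and Jp: "Lp_norm p lebesgue J \<le> ennreal C"
    and vws: "\<And>T. 0 < T \<Longrightarrow> very_weak_solution J m u0 T u"
  defines "q \<equiv> conj_exponent p" and "M \<equiv> enn2real (Lp_norm 1 lebesgue u0)"
  shows "0 < C" "1 \<le> q"
    and "AE t in lborel. 0 < t \<longrightarrow>
      Lp_norm \<infinity> lebesgue (\<lambda>x. u x t)
        \<le> ennreal (max ((2 * C) powr q * M) ((2 / ((m - 1) * t)) powr (1 / (m - 1))))"
proof -
  from borel_representative_nonneg[OF J(1,2)]
  obtain J' where J': "J' \<in> borel_measurable borel" "\<And>x. 0 \<le> J' x" "AE x in lborel. J x = J' x"
    "integrable lborel J'" "(LINT x|lborel. J' x) = (LINT x|lebesgue. \<bar>J x\<bar>)"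
    by blast
  have J'1: "(LINT x|lborel. J' x) = 1"
    using J(3) J'(5) by (simp add: Lp_norm_1_eq[OF J(1)])
  from borel_representative_nonneg[OF u0]
  obtain v0 where v0: "v0 \<in> borel_measurable borel" "\<And>x. 0 \<le> v0 x" "AE x in lborel. u0 x = v0 x"
    "integrable lborel v0" "(LINT x|lborel. v0 x) = (LINT x|lebesgue. \<bar>u0 x\<bar>)"
    by blast
  have M: "M = (LINT x|lborel. v0 x)" by (simp add: M_def Lp_norm_1_eq[OF u0(1)] v0(5))
  from very_weak_solution_representative[OF vws]
  obtain U where U: "U \<in> borel_measurable borel" "\<And>z. 0 \<le> U z"
    "AE z in lborel. 0 < snd z \<longrightarrow> U z = u (fst z) (snd z)"
    "\<And>T. integrable lborel (\<lambda>z. indicator {0<..T} (snd z) * U z)"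
    "\<And>T. integrable lborel (\<lambda>z. indicator {0<..T} (snd z) * U z powr m)"
    by blast
  interpret evolution_data J' m v0 U
    by unfold_locales (use m J' J'1 v0 U in auto)
  have traj: "AE x in lborel. u x t = trajectory J' m v0 U x t" if "0 < t" for t
    by (rule AE_eq_trajectory[OF vws[OF that] that J'(3) v0(3) U(3)])
  note Usnd = AE_lborel_prod_snd[OF U(3)]
  have "AE z in lborel. 0 < snd z \<longrightarrow> U z = trajectory J' m v0 U (fst z) (snd z)"
  proof (rule AE_lborel_prodI)
    have [measurable]: "snd \<in> borel_measurable (borel :: ('a \<times> real) measure)"
      by (intro borel_measurable_continuous_onI continuous_intros)
    show "Measurable.pred borel (\<lambda>z. 0 < snd z \<longrightarrow> U z = trajectory J' m v0 U (fst z) (snd z))"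
      by measurable
    show "AE t in lborel. AE x in lborel. 0 < snd (x, t) \<longrightarrow> U (x, t) = trajectory J' m v0 U (fst (x, t)) (snd (x, t))"
      using Usnd
    proof eventually_elim
      case (elim t)
      show ?case
      proof (cases "0 < t")
        case True
        from elim traj[OF True] show ?thesis by eventually_elim simp
      qed simp
    qed
  qed
  then interpret mild_solution J' m v0 U by unfold_locales
  have p_cases: "p = \<infinity> \<or> (\<exists>r. p = ereal r \<and> 1 < r)" using p by (cases p) auto
  show C: "0 < C"
  proof (rule ccontr)
    assume "\<not> 0 < C"
    then have C0: "max 0 C = 0" by simp
    from p_cases have "AE x in lborel. J' x = 0"
    proof
      assume "p = \<infinity>"
      then have "AE x in lborel. J' x \<le> max 0 C" using Lp_norm_le_infinite[OF _ J'(3,2)] Jp by simp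
      then show ?thesis by eventually_elim (simp only: C0, meson J'(2) antisym)
    next
      assume "\<exists>r. p = ereal r \<and> 1 < r"
      then obtain r where r: "p = ereal r" "1 < r" by blast
      note * = Lp_norm_le_finite[OF r(2) Jp[unfolded r(1)] J'(1,3,2)]
      have "(LINT x|lborel. J' x powr r) = 0"
        using *(2) by (intro antisym) (simp_all add: C0)
      then have "AE x in lborel. J' x powr r = 0"
        using integral_nonneg_eq_0_iff_AE[OF *(1)] by simp
      then show ?thesis by eventually_elim simp
    qed
    then have "(LINT x|lborel. J' x) = 0" by (rule integral_eq_zero_AE)
    with J'1 show False by simp
  qed
  show q: "1 \<le> q"
    using p_cases by (auto simp: q_def conj_exponent_def field_simps)
  have conv: "(LINT y|lborel. J' (x - y) * v y powr m) \<le> C * M powr (1 / q) * K powr (m - 1 / q)"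
    if v: "\<And>x. 0 \<le> v x" "integrable lborel v" "(LINT x|lborel. v x) \<le> M" "AE x in lborel. v x \<le> K"
      and pos: "0 < M" "0 < K" for v x K
    using p_cases
  proof
    assume p: "p = \<infinity>"
    then have "AE x in lborel. J' x \<le> C"
      using Lp_norm_le_infinite[OF Jp[unfolded p] J'(3,2)] C by simp
    from convolution_sup_bound[OF m J'(2) this v C pos] show ?thesis
      using p pos by (simp add: q_def conj_exponent_def)
  next
    assume "\<exists>r. p = ereal r \<and> 1 < r"
    then obtain r where r: "p = ereal r" "1 < r" by blast
    note * = Lp_norm_le_finite[OF r(2) Jp[unfolded r(1)] J'(1,3,2)]
    show ?thesis
      by (rule convolution_powr_bound[OF m r(2) _ J'(2) *(1) _ v C pos])
        (use *(2) C r in \<open>auto simp: q_def conj_exponent_def max_def\<close>)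
  qed
  have U_int: "AE t in lborel. 0 < t \<longrightarrow> integrable lborel (\<lambda>x. g (U (x, t)))"
    if "\<And>T. integrable lborel (\<lambda>z. indicator {0<..T} (snd z) * g (U z))" for g :: "real \<Rightarrow> real"
  proof -
    have "AE t in lborel. \<forall>n::nat. integrable lborel (\<lambda>x. indicator {0<..real n} t * g (U (x, t)))"
      unfolding AE_all_countable using AE_integrable_lborel_snd[OF that] by auto
    then show ?thesis
    proof eventually_elim
      case (elim t)
      obtain n :: nat where "t < real n" using reals_Archimedean2 by blast
      then show ?case using elim[rule_format, of n] by (auto simp: indicator_def split: if_splits)
    qed
  qed
  have ineq: "AE z in lborel. 0 < snd z \<longrightarrow>
      U z powr m \<le> space_conv J' (\<lambda>z. U z powr m) z + U z / ((m - 1) * snd z)"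
    using v0(2) by (intro differential_inequality) auto
  show "AE t in lborel. 0 < t \<longrightarrow>
      Lp_norm \<infinity> lebesgue (\<lambda>x. u x t)
        \<le> ennreal (max ((2 * C) powr q * M) ((2 / ((m - 1) * t)) powr (1 / (m - 1))))"
    using Usnd U_int[of "\<lambda>s. s", OF U_integrable] U_int[of "\<lambda>s. s powr m", OF Um_integrable]
      AE_lborel_prod_snd[OF ineq] AE_lborel_prod_snd[OF U_eq]
  proof eventually_elim
    case (elim t)
    show ?case
    proof
      assume t: "0 < t"
      let ?b = "max ((2 * C) powr q * M) ((2 / ((m - 1) * t)) powr (1 / (m - 1)))"
      let ?v = "\<lambda>x. U (x, t)"
      have v_meas: "?v \<in> borel_measurable borel" by (rule borel_measurable_sections) simp
      have v_int: "integrable lborel ?v" and vm_int: "integrable lborel (\<lambda>x. ?v x powr m)"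
        using elim t by auto
      have mass: "(LINT x|lborel. ?v x) = M"
      proof -
        have "(LINT x|lborel. ?v x) = (LINT x|lborel. trajectory J' m v0 U x t)"
          using elim(5) t v_meas borel_measurable_integrable[OF trajectory_integrable[of t]]
          by (intro integral_cong_AE) (auto elim!: eventually_mono)
        then show ?thesis by (simp add: trajectory_integral M)
      qed
      have bound: "AE x in lborel. ?v x \<le> ?b"
      proof (cases "M = 0")
        case True
        then have "AE x in lborel. ?v x = 0"
          using integral_nonneg_eq_0_iff_AE[OF v_int] mass U_nonneg by simp
        then show ?thesis
          by eventually_elim (simp add: le_max_iff_disj)
      next
        case False
        have M0: "0 < M" using False mass integral_nonneg_AE[of ?v lborel] U_nonneg by simp
        show ?thesis
        proof (rule AE_le_max_of_inequality[OF m _ q C M0 J' (4,2) v_meas U_nonneg vm_int])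
          show "0 < (m - 1) * t" using m t by simp
          show "AE x in lborel. ?v x powr m \<le> (LINT y|lborel. J' (x - y) * ?v y powr m) + ?v x / ((m - 1) * t)"
            using elim(4) by eventually_elim (use t in \<open>simp add: space_conv_def\<close>)
          show "(LINT y|lborel. J' (x - y) * ?v y powr m) \<le> C * M powr (1 / q) * K powr (m - 1 / q)"
            if "0 < K" "AE x in lborel. ?v x \<le> K" for x K
            by (rule conv) (use U_nonneg v_int mass M0 that in auto)
        qed
      qed
      have uv: "AE x in lborel. u x t = ?v x" using elim(1) t by (auto elim!: eventually_mono)
      have "(\<lambda>x. u x t) \<in> borel_measurable lebesgue"
        by (rule lebesgue_measurable_if_AE_eq[OF uv v_meas])
      moreover have "AE x in lebesgue. ennreal \<bar>u x t\<bar> \<le> ennreal ?b"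
        using uv bound unfolding AE_completion_iff
        by eventually_elim (use U_nonneg in \<open>simp add: ennreal_leI\<close>)
      ultimately show "Lp_norm \<infinity> lebesgue (\<lambda>x. u x t) \<le> ennreal ?b"
        unfolding Lp_norm_def by (simp add: esssup_I)
    qed
  qed
qed

theorem theorem5p1:
  fixes J u0 :: "real ^ 'n \<Rightarrow> real"
    and u :: "real ^ 'n \<Rightarrow> real \<Rightarrow> real"
    and m C\<^sub>J q M :: real
    and p t0 :: ereal
  assumes "CARD('n) \<ge> 3"
    and "m > 1"
    and "integrable lebesgue u0"
    and "AE x in lebesgue. 0 \<le> u0 x"
    and "integrable lebesgue J"
    and "AE z in lebesgue. 0 \<le> J z"
    and "AE z in lebesgue. J (- z) = J z"
    and "Lp_norm 1 lebesgue J = 1"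
    and "1 < p"
    and "Lp_norm p lebesgue J \<le> ennreal C\<^sub>J"
    and "\<And>T. T > 0 \<Longrightarrow> very_weak_solution J m u0 T u"
  defines "q \<equiv> conj_exponent p"
    and "M \<equiv> enn2real (Lp_norm 1 lebesgue u0)"
    and "t0 \<equiv> critical_time m q C\<^sub>J M"
  shows "(AE t in lebesgue. 0 < t \<and> ereal t \<le> t0 \<longrightarrow>
           Lp_norm \<infinity> lebesgue (\<lambda>x. u x t)
             \<le> ennreal (2 * (m * q * C_m m powr (m / (m - 1))) powr (1 / m) * t powr (- (1 / (m - 1))))) \<and>
         (AE t in lebesgue. t0 < ereal t \<longrightarrow>
           Lp_norm \<infinity> lebesgue (\<lambda>x. u x t)
             \<le> ennreal (2 * (m * C_m m / (m - 1) * C\<^sub>J) powr q * M))"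
proof -
  note est = very_weak_solution_AE_bound[OF assms(2-6,8-11)]
  have C: "0 < C\<^sub>J" by (rule est(1))
  have q: "1 \<le> q" unfolding q_def by (rule est(2))
  have bound: "AE t in lborel. 0 < t \<longrightarrow> Lp_norm \<infinity> lebesgue (\<lambda>x. u x t)
      \<le> ennreal (max ((2 * C\<^sub>J) powr q * M) ((2 / ((m - 1) * t)) powr (1 / (m - 1))))"
    unfolding q_def M_def by (rule est(3))
  have M: "0 \<le> M" by (simp add: M_def)
  have t0: "0 < t" if "t0 < ereal t" for t
  proof (cases "M = 0")
    case False
    then obtain s where s: "t0 = ereal s" by (simp add: t0_def critical_time_def)
    then have "0 < s" using early_critical_time(1)[OF \<open>m > 1\<close> q C M] M False by (simp add: t0_def)
    then show ?thesis using that s by simp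
  qed (use that in \<open>simp add: t0_def critical_time_def\<close>)
  note bounds = max_bound_le[OF \<open>m > 1\<close> q C M, folded t0_def]
  show ?thesis
    unfolding AE_completion_iff
  proof (intro conjI)
    show "AE t in lborel. 0 < t \<and> ereal t \<le> t0 \<longrightarrow>
           Lp_norm \<infinity> lebesgue (\<lambda>x. u x t)
             \<le> ennreal (2 * (m * q * C_m m powr (m / (m - 1))) powr (1 / m) * t powr (- (1 / (m - 1))))"
      using bound
    proof eventually_elim
      case (elim t)
      then show ?case using ennreal_leI[OF bounds(1)] by (meson order_trans)
    qed
    show "AE t in lborel. t0 < ereal t \<longrightarrow>
           Lp_norm \<infinity> lebesgue (\<lambda>x. u x t)
             \<le> ennreal (2 * (m * C_m m / (m - 1) * C\<^sub>J) powr q * M)"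
      using bound
    proof eventually_elim
      case (elim t)
      then show ?case using ennreal_leI[OF bounds(2)] t0 by (meson order_trans)
    qed
  qed
qed

end
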